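(* Let $\Omega\subset\mathbb{R}^d$ be bounded with $C^\infty$ boundary, let $k$ be a continuous strictly positive definite kernel on $\Omega$ with $k(x,x)\le 1$ for all $x\in\Omega$, and assume that $k$ is well defined on the closure $\bar\Omega$ and that the extension $Ef\in\mathcal H_k(\bar\Omega)$ of any $f\in\mathcal H_k(\Omega)$ satisfies $\|Ef\|_{\mathcal H_k(\bar\Omega)}=\|f\|_{\mathcal H_k(\Omega)}$. Let $s>0$ and assume that $\mathcal H_k(\Omega)$ is continuously embedded into $\mathrm{Lip}(s,L_\infty(\Omega))$. Then there is a constant $C>0$ with $\varepsilon_n(\mathrm{co}(\Phi(\Omega)),\mathcal H_k(\Omega))\le C n^{-\frac sd-\frac12}$ for all $n\in\mathbb N$, $n\geq 1$, and, for any such $C$, any $\beta\in[0,\infty]$, any admissible $\gamma\in(0,1]$ and any $f\in\mathcal H_k(\Omega)$, any weak $\beta$-greedy algorithm with parameter $\gamma$ applied to $f$ satisfies $$\min_{n+1\le i\le 2n}\|f-I_{X_i}f\|_{L_\infty(\Omega)}\le c\,\gamma^{-1}\left(n^{-\frac sd-\frac\beta2}\right)^{\frac{1}{\max(1,\beta)}}\|f-I_{X_{n+1}}f\|_{\mathcal H_k(\Omega)},\qquad n\in\mathbb N,\ n\ge1,$$ where $c:=(C\sqrt5)^{\frac1{\max(1,\beta)}}$, and for $\beta=\infty$ one reads $c=1$ and $\left(n^{-\frac sd-\frac\beta2}\right)^{1/\max(1,\beta)}$ as its limit $n^{-1/2}$.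
   Context: Kernel interpolation. $k$ is a real-valued kernel and $\mathcal H_k(\Omega)$ is its Reproducing Kernel Hilbert Space on $\Omega$. For a finite set $X\subset\Omega$ of pairwise distinct points, $V(X):=\mathrm{span}\{k(\cdot,x):x\in X\}$ and $I_Xf\in V(X)$ is the unique function in $V(X)$ that interpolates $f$ at $X$ (for $f\in\mathcal H_k(\Omega)$ it is the orthogonal projection of $f$ onto $V(X)$; $I_\emptyset f=0$). The power function is $P_X(x):=\|k(\cdot,x)-\Pi_{V(X)}k(\cdot,x)\|_{\mathcal H_k(\Omega)}$, with $\Pi_V$ the orthogonal projection onto $V$. "$k$ is well defined on $\bar\Omega$" means that $k$ can be evaluated on $\bar\Omega$ and is continuous and strictly positive definite there. $\Phi(\Omega):=\{k(\cdot,x):x\in\Omega\}$. Weak $\beta$-greedy algorithm. Let $X_0:=\emptyset$, $X_{n+1}:=X_n\cup\{x_{n+1}\}$. For $\beta\in[0,\infty)$ put $\eta_\beta(f,X_n)(x):=|(f-I_{X_n}f)(x)|^\beta P_{X_n}(x)^{1-\beta}$, and $\eta_\infty(f,X_n)(x):=|(f-I_{X_n}f)(x)|/P_{X_n}(x)$. A weak $\beta$-greedy algorithm with parameter $\gamma$ applied to $f$ produces any sequence of points such that for all $n\ge0$, $x_{n+1}\in\Omega\setminus X_n$ and $\eta_\beta(f,X_n)(x_{n+1})\ge\gamma\sup_{z\in\Omega\setminus X_n}\eta_\beta(f,X_n)(z)$. Admissible $\gamma$ means $\gamma\in(0,1)$ if $\Omega$ is open and $\gamma\in(0,1]$ if $\Omega$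 is closed. Entropy numbers. For a subset $K$ of a Hilbert space $\mathcal H$: $\mathrm{co}(K):=\mathrm{clos}_{\mathcal H}\{\sum_i c_ig_i: g_i\in K,\ \sum_i|c_i|\le1\}$ (finite sums), and $\varepsilon_n(K,\mathcal H)$ is the infimum of all $\varepsilon>0$ such that $K$ can be covered by at most $2^n$ balls of radius $\varepsilon$ with centers in $\mathcal H$. Lipschitz classes. Write $s=m+\alpha$ with $m\in\mathbb N_0$, $\alpha\in(0,1]$. $f:\Omega\to\mathbb R$ is in $\mathrm{Lip}(s,L_\infty(\Omega))$ if its derivatives of order $m$ exist and $|f|_{\mathrm{Lip}(s,L_\infty(\Omega))}:=\max_{|\zeta|=m}\sup_{y\ne z\in\Omega}\frac{|D^\zeta f(y)-D^\zeta f(z)|}{|y-z|^\alpha}<\infty$. "$\mathcal H_k(\Omega)$ is continuously embedded into $\mathrm{Lip}(s,L_\infty(\Omega))$" means that $\mathcal H_k(\Omega)\subset \mathrm{Lip}(s,L_\infty(\Omega))$ and there is $c_e>0$ with $|u|_{\mathrm{Lip}(s,L_\infty(\Omega))}\le c_e\|u\|_{\mathcal H_k(\Omega)}$ for all $u\in\mathcal H_k(\Omega)$. *)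

theory Defs
  imports "HOL-Analysis.Analysis"
begin

definition strictly_pd_kernel :: "'a set \<Rightarrow> ('a \<Rightarrow> 'a \<Rightarrow> real) \<Rightarrow> bool" where
  "strictly_pd_kernel S k \<longleftrightarrow>
     (\<forall>x\<in>S. \<forall>y\<in>S. k x y = k y x) \<and>
     (\<forall>X c. finite X \<and> X \<subseteq> S \<and> (\<exists>x\<in>X. c x \<noteq> 0) \<longrightarrow>
        0 < (\<Sum>x\<in>X. \<Sum>y\<in>X. c x * c y * k x y))"

text \<open>
  A Hilbert space of functions on \<open>S\<close> is given by a Hilbert space type \<open>'h\<close> together with the
  map \<open>ev\<close> sending an element to the function it stands for; only the values of \<open>ev f\<close> on
  \<open>S\<close> matter. The second conjunct says that an element is determined by its values on \<open>S\<close>.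
\<close>

definition rkhs ::
  "'a set \<Rightarrow> ('a \<Rightarrow> 'a \<Rightarrow> real) \<Rightarrow> ('h::{real_inner,complete_space} \<Rightarrow> 'a \<Rightarrow> real) \<Rightarrow> bool" where
  "rkhs S k ev \<longleftrightarrow>
     (\<forall>x\<in>S. linear (\<lambda>f. ev f x)) \<and>
     (\<forall>f. (\<forall>x\<in>S. ev f x = 0) \<longrightarrow> f = 0) \<and>
     (\<forall>x\<in>S. \<exists>g. (\<forall>y\<in>S. ev g y = k y x) \<and> (\<forall>f. ev f x = f \<bullet> g))"

text \<open>The element \<open>k(\<cdot>,x)\<close>; it exists and is unique if \<^term>\<open>rkhs S k ev\<close> and \<open>x \<in> S\<close>.\<close>

definition kernel_at ::
  "'a set \<Rightarrow> ('a \<Rightarrow> 'a \<Rightarrow> real) \<Rightarrow> ('h::{real_inner,complete_space} \<Rightarrow> 'a \<Rightarrow> real) \<Rightarrow> 'a \<Rightarrow> 'h" where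
  "kernel_at S k ev x = (THE g. \<forall>y\<in>S. ev g y = k y x)"

definition trial_space ::
  "'a set \<Rightarrow> ('a \<Rightarrow> 'a \<Rightarrow> real) \<Rightarrow> ('h::{real_inner,complete_space} \<Rightarrow> 'a \<Rightarrow> real) \<Rightarrow> 'a set \<Rightarrow> 'h set" where
  "trial_space S k ev X = span (kernel_at S k ev ` X)"

definition interpolant ::
  "'a set \<Rightarrow> ('a \<Rightarrow> 'a \<Rightarrow> real) \<Rightarrow> ('h::{real_inner,complete_space} \<Rightarrow> 'a \<Rightarrow> real) \<Rightarrow> 'a set \<Rightarrow> 'h \<Rightarrow> 'h" where
  "interpolant S k ev X f = (THE g. g \<in> trial_space S k ev X \<and> (\<forall>x\<in>X. ev g x = ev f x))"

definition orth_proj :: "'h::real_inner set \<Rightarrow> 'h \<Rightarrow> 'h" where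
  "orth_proj V u = (THE v. v \<in> V \<and> (\<forall>w\<in>V. (u - v) \<bullet> w = 0))"

definition power_fun ::
  "'a set \<Rightarrow> ('a \<Rightarrow> 'a \<Rightarrow> real) \<Rightarrow> ('h::{real_inner,complete_space} \<Rightarrow> 'a \<Rightarrow> real) \<Rightarrow> 'a set \<Rightarrow> 'a \<Rightarrow> real" where
  "power_fun S k ev X x =
     norm (kernel_at S k ev x - orth_proj (trial_space S k ev X) (kernel_at S k ev x))"

definition sup_norm :: "'a set \<Rightarrow> ('a \<Rightarrow> real) \<Rightarrow> ennreal" where
  "sup_norm S g = (SUP x\<in>S. ennreal \<bar>g x\<bar>)"

text \<open>Since \<open>0 powr 0 = 0\<close>, the convention \<open>0\<^sup>0 = 1\<close> (needed for \<open>\<beta> = 0\<close>) is made explicit.\<close>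

definition rpow :: "real \<Rightarrow> real \<Rightarrow> real" where
  "rpow t a = (if a = 0 then 1 else t powr a)"

definition greedy_eta ::
  "'a set \<Rightarrow> ('a \<Rightarrow> 'a \<Rightarrow> real) \<Rightarrow> ('h::{real_inner,complete_space} \<Rightarrow> 'a \<Rightarrow> real) \<Rightarrow>
   ennreal \<Rightarrow> 'h \<Rightarrow> 'a set \<Rightarrow> 'a \<Rightarrow> real" where
  "greedy_eta S k ev \<beta> f X x =
     (let r = \<bar>ev (f - interpolant S k ev X f) x\<bar>; P = power_fun S k ev X x
      in if \<beta> = \<infinity> then r / P else rpow r (enn2real \<beta>) * rpow P (1 - enn2real \<beta>))"

text \<open>The chosen points are \<open>x 1, x 2, \<dots>\<close>; the value \<open>x 0\<close> is not used.\<close>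

definition weak_greedy ::
  "'a set \<Rightarrow> ('a \<Rightarrow> 'a \<Rightarrow> real) \<Rightarrow> ('h::{real_inner,complete_space} \<Rightarrow> 'a \<Rightarrow> real) \<Rightarrow>
   ennreal \<Rightarrow> real \<Rightarrow> 'h \<Rightarrow> (nat \<Rightarrow> 'a) \<Rightarrow> bool" where
  "weak_greedy S k ev \<beta> \<gamma> f x \<longleftrightarrow>
     (\<forall>n. let X = x ` {1..n} in
        x (n + 1) \<in> S - X \<and>
        ennreal (greedy_eta S k ev \<beta> f X (x (n + 1)))
          \<ge> ennreal \<gamma> * (SUP z\<in>S - X. ennreal (greedy_eta S k ev \<beta> f X z)))"

definition admissible_weakness :: "'a::topological_space set \<Rightarrow> real \<Rightarrow> bool" where
  "admissible_weakness S \<gamma> \<longleftrightarrow>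
     (open S \<and> 0 < \<gamma> \<and> \<gamma> < 1) \<or> (closed S \<and> 0 < \<gamma> \<and> \<gamma> \<le> 1)"

definition closed_abs_hull :: "'h::real_normed_vector set \<Rightarrow> 'h set" where
  "closed_abs_hull K =
     closure {(\<Sum>g\<in>F. c g *\<^sub>R g) |F c. finite F \<and> F \<subseteq> K \<and> (\<Sum>g\<in>F. \<bar>c g\<bar>) \<le> 1}"

definition entropy_number :: "nat \<Rightarrow> 'h::metric_space set \<Rightarrow> ennreal" where
  "entropy_number n K =
     Inf {ennreal \<epsilon> |\<epsilon>. 0 < \<epsilon> \<and> (\<exists>Z. finite Z \<and> card Z \<le> 2 ^ n \<and> K \<subseteq> (\<Union>z\<in>Z. cball z \<epsilon>))}"

text \<open>
  \<open>partial_deriv S [b\<^sub>1, \<dots>, b\<^sub>m] f\<close> is the mixed partial derivative of order \<open>m\<close> in the coordinate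
  directions \<open>b\<^sub>1, \<dots>, b\<^sub>m\<close>, so that the lists of length \<open>m\<close> over \<^term>\<open>Basis\<close> play the role of the
  multi-indices of order \<open>m\<close>. Differentiation is relative to \<open>S\<close>: on an open set this is ordinary
  differentiation, and at boundary points belonging to \<open>S\<close> it is one-sided. The derivative
  relative to \<open>S\<close> is unique if \<open>S\<close> is open or has a smooth boundary in the sense below.
  Asking for Frechet differentiability up to order \<open>m - 1\<close> costs nothing on an open set: in
  \<open>lip_class\<close> the partial derivatives of order \<open>m\<close> are continuous.
\<close>

primrec partial_deriv ::
  "'a::euclidean_space set \<Rightarrow> 'a list \<Rightarrow> ('a \<Rightarrow> real) \<Rightarrow> 'a \<Rightarrow> real" where
  "partial_deriv S [] f = f"
| "partial_deriv S (b # bs) f =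
     (\<lambda>x. frechet_derivative (partial_deriv S bs f) (at x within S) b)"

definition times_differentiable_on ::
  "nat \<Rightarrow> ('a::euclidean_space \<Rightarrow> real) \<Rightarrow> 'a set \<Rightarrow> bool" where
  "times_differentiable_on m f S \<longleftrightarrow>
     (\<forall>bs. set bs \<subseteq> Basis \<and> length bs < m \<longrightarrow> partial_deriv S bs f differentiable_on S)"

text \<open>The unique \<open>m \<in> \<nat>\<close> with \<open>s = m + \<alpha>\<close> and \<open>\<alpha> \<in> (0,1]\<close>, for \<open>s > 0\<close>.\<close>

definition lip_order :: "real \<Rightarrow> nat" where
  "lip_order s = nat (\<lceil>s\<rceil> - 1)"

definition lip_seminorm :: "real \<Rightarrow> 'a::euclidean_space set \<Rightarrow> ('a \<Rightarrow> real) \<Rightarrow> ennreal" where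
  "lip_seminorm s S f =
     (let m = lip_order s; \<alpha> = s - real m in
      SUP bs\<in>{bs. set bs \<subseteq> Basis \<and> length bs = m}.
        SUP (y, z)\<in>{(y, z). y \<in> S \<and> z \<in> S \<and> y \<noteq> z}.
          ennreal (\<bar>partial_deriv S bs f y - partial_deriv S bs f z\<bar> / norm (y - z) powr \<alpha>))"

definition lip_class :: "real \<Rightarrow> 'a::euclidean_space set \<Rightarrow> ('a \<Rightarrow> real) set" where
  "lip_class s S = {f. times_differentiable_on (lip_order s) f S \<and> lip_seminorm s S f < \<infinity>}"

definition continuously_embedded_lip ::
  "real \<Rightarrow> 'a::euclidean_space set \<Rightarrow> ('h::{real_inner,complete_space} \<Rightarrow> 'a \<Rightarrow> real) \<Rightarrow> bool" where
  "continuously_embedded_lip s S ev \<longleftrightarrow>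
     (\<forall>u. ev u \<in> lip_class s S) \<and>
     (\<exists>c>0. \<forall>u. lip_seminorm s S (ev u) \<le> ennreal (c * norm u))"

text \<open>
  Near every boundary point the interior of \<open>S\<close> is, up to relabelling and reorienting the
  coordinate axes, the set strictly above the graph of a smooth function of the other \<open>d - 1\<close>
  coordinates, and the boundary is that graph. Such a function is represented by a smooth
  \<open>g\<close> on the whole space that does not depend on the coordinate in direction \<open>b\<close>.
\<close>

definition smooth_boundary :: "'a::euclidean_space set \<Rightarrow> bool" where
  "smooth_boundary S \<longleftrightarrow>
     (\<forall>p\<in>frontier S. \<exists>r>0. \<exists>b g.
        (b \<in> Basis \<or> - b \<in> Basis) \<and>
        (\<forall>m. times_differentiable_on m g UNIV) \<and>
        (\<forall>x t. g (x + t *\<^sub>R b) = g x) \<and>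
        (\<forall>x\<in>ball p r. (x \<in> interior S \<longleftrightarrow> g x < x \<bullet> b) \<and> (x \<in> frontier S \<longleftrightarrow> x \<bullet> b = g x)))"

end

theory Submission
  imports Defs
begin

text \<open>
  Entropy bound. Near a boundary point the domain lies above a Lipschitz graph, so at every scale
  \<open>2\<^sup>-\<^sup>j\<close> a point \<open>x\<close> sees, along a segment in the interior, one of \<open>O(2\<^sup>j\<^sup>d)\<close> base points \<open>y\<close> at
  distance \<open>O(2\<^sup>-\<^sup>j)\<close>. By Taylor's formula a function whose derivatives of order at most \<open>m\<close> vanish
  at \<open>y\<close> is \<open>O(2\<^sup>-\<^sup>j\<^sup>s)\<close> at \<open>x\<close>; dually, \<open>k(\<cdot>,x)\<close> is within \<open>O(2\<^sup>-\<^sup>j\<^sup>s)\<close> of a space of bounded dimension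
  attached to \<open>y\<close>. Telescoping over the nested cells puts the absolutely convex hull into a sum over
  \<open>j\<close> of \<open>O(2\<^sup>-\<^sup>j\<^sup>s)\<close> times hulls of \<open>O(2\<^sup>j\<^sup>d)\<close> unit vectors, and Maurey's lemma covers each of
  these.

  Greedy bound. The values of the power function at \<open>n\<close> consecutive selected points are the diagonal
  of a triangular matrix, so their product is controlled by the volume of a crosspolytope in the
  hull; covering it by \<open>2\<^sup>n\<close> balls of radius \<open>\<epsilon>\<close> gives the bound \<open>n! \<omega>\<^sub>n \<epsilon>\<^sup>n \<le> (5 n)\<^bsup>n/2\<^esup> \<epsilon>\<^sup>n\<close>, where \<open>\<omega>\<^sub>n\<close> is the
  volume of the unit ball. The squares of the ratios of residual and power function telescope to at
  most \<open>\<parallel>f - I\<^sub>n\<^sub>+\<^sub>1 f\<parallel>\<^sup>2\<close>, and the inequality of arithmetic and geometric means combines the two.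
\<close>

section \<open>Volumes of crosspolytopes and balls\<close>

text \<open>The exponent 1/2 beyond s/d comes from sampling the hull at levels finer than the number
  of available bits resolves. With about 2^(LD) bits, Maurey averages reach level L + LD/(2s), where
  the tail is 2^(-L(s + D/2)). Bits and errors both decay geometrically away from level L, so no
  logarithm of n appears. The domain is not convex, while Taylor's formula needs the whole segment
  from base point to x; moving base points inward provides it. At interior points derivatives
  relative to the domain are ordinary ones, so this part is carried out in the interior and the
  remaining points follow from the continuity of the kernel. The seminorm sees only derivatives of
  order m, hence all lower ones are factored out as well, at the price of boundedly many dimensions
  per base point. The constant sqrt 5: a crosspolytope has volume 2^n / n!, the covering uses 2^n
  balls, and the powers of two cancel. What remains, n! times the volume of the unit ball, is at
  most (5n)^(n/2), and sqrt (5n) times C n^(-s/d - 1/2) is C sqrt 5 n^(-s/d). One n serves as the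
  index of the entropy number and as the number of points in the window n+1, ..., 2n.\<close>

definition triangular_map ::
  "(nat \<Rightarrow> real) \<Rightarrow> (nat \<Rightarrow> nat \<Rightarrow> real) \<Rightarrow> (nat \<Rightarrow> real) \<Rightarrow> nat \<Rightarrow> (nat \<Rightarrow> real) \<Rightarrow> nat \<Rightarrow> real" where
  "triangular_map p a b n c =
     (\<lambda>k\<in>{..<n}. p k * c k + (\<Sum>i\<in>{k<..<n}. c i * a i k) + b k)"

lemma measurable_triangular_map [measurable]:
  "triangular_map p a b n \<in> measurable (PiM {..<n} (\<lambda>_. lborel)) (PiM {..<n} (\<lambda>_. lborel))"
  unfolding triangular_map_def by measurable

text \<open>Tonelli with the last variable outermost: it enters its own coordinate by scaling with
  its diagonal entry and every earlier coordinate only as a translation, which is absorbed into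
  \<open>b\<close>; hence \<open>b\<close> is arbitrary in the induction. The product of the
  \<open>p k\<close> is the determinant of the triangular matrix.\<close>

lemma nn_integral_triangular_map:
  assumes "\<And>k. k < n \<Longrightarrow> p k > 0" "F \<in> borel_measurable (PiM {..<n} (\<lambda>_. lborel))"
  shows "(\<Prod>k<n. ennreal (p k)) * (\<integral>\<^sup>+c. F (triangular_map p a b n c) \<partial>PiM {..<n} (\<lambda>_. lborel)) =
         (\<integral>\<^sup>+u. F u \<partial>PiM {..<n} (\<lambda>_. lborel))"
  using assms
proof (induction n arbitrary: F b)
  case 0
  then show ?case
    by (simp add: PiM_empty nn_integral_count_space_finite triangular_map_def restrict_def)
next
  case (Suc n)
  interpret product_sigma_finite "\<lambda>_. lborel" by standard
  let ?M = "\<lambda>n. PiM {..<n} (\<lambda>_. lborel :: real measure)"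
  let ?P = "\<Prod>k<n. ennreal (p k)"
  note [measurable] = Suc.prems(2)
  define G where "G t = (\<integral>\<^sup>+u. F (u(n := t)) \<partial>?M n)" for t
  have ins: "{..<Suc n} = insert n {..<n}" by auto
  have upd [measurable]: "(\<lambda>(t, u). u(n := t)) \<in> measurable (borel \<Otimes>\<^sub>M ?M n) (?M (Suc n))"
    unfolding ins by measurable
  have upd1 [measurable]: "(\<lambda>u. u(n := t)) \<in> measurable (?M n) (?M (Suc n))" for t
    unfolding ins by measurable
  have Gm [measurable]: "G \<in> borel_measurable borel"
    unfolding G_def
  proof (rule sigma_finite_measure.borel_measurable_nn_integral)
    show "sigma_finite_measure (?M n)" by (rule sigma_finite) simp
    show "(\<lambda>(x, y). F (y(n := x))) \<in> borel_measurable (borel \<Otimes>\<^sub>M ?M n)"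
      using measurable_compose[OF upd Suc.prems(2)] by (simp add: case_prod_unfold)
  qed
  have FT [measurable]: "(\<lambda>c. F (triangular_map p a b (Suc n) c)) \<in> borel_measurable (?M (Suc n))"
    using measurable_compose[OF measurable_triangular_map Suc.prems(2)] .
  have T: "triangular_map p a b (Suc n) (x(n := y)) =
        (triangular_map p a (\<lambda>k. b k + y * a n k) n x)(n := p n * y + b n)" for x y
  proof
    fix k
    have "{k<..<Suc n} = insert n {k<..<n}" if "k < n" using that by auto
    moreover have "{n<..<Suc n} = {}" by auto
    ultimately show "triangular_map p a b (Suc n) (x(n := y)) k =
          ((triangular_map p a (\<lambda>k. b k + y * a n k) n x)(n := p n * y + b n)) k"
      by (cases "k < n"; cases "k = n") (auto simp: triangular_map_def intro!: sum.cong)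
  qed
  have 0: "(\<lambda>y. \<integral>\<^sup>+x. F ((triangular_map p a (\<lambda>k. b k + y * a n k) n x)(n := p n * y + b n)) \<partial>?M n)
             \<in> borel_measurable borel"
    unfolding T[symmetric]
  proof (rule sigma_finite_measure.borel_measurable_nn_integral)
    show "sigma_finite_measure (?M n)" by (rule sigma_finite) simp
    show "(\<lambda>(y, x). F (triangular_map p a b (Suc n) (x(n := y)))) \<in> borel_measurable (borel \<Otimes>\<^sub>M ?M n)"
      using measurable_compose[OF upd FT] by (simp add: case_prod_unfold)
  qed
  have "(\<integral>\<^sup>+c. F (triangular_map p a b (Suc n) c) \<partial>?M (Suc n)) =
        (\<integral>\<^sup>+y. (\<integral>\<^sup>+x. F (triangular_map p a b (Suc n) (x(n := y))) \<partial>?M n) \<partial>lborel)"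
    unfolding ins using FT by (subst product_nn_integral_insert_rev) (auto simp: ins)
  also have "\<dots> = (\<integral>\<^sup>+y. (\<integral>\<^sup>+x. F ((triangular_map p a (\<lambda>k. b k + y * a n k) n x)(n := p n * y + b n)) \<partial>?M n) \<partial>lborel)"
    unfolding T ..
  finally have 1: "(\<integral>\<^sup>+c. F (triangular_map p a b (Suc n) c) \<partial>?M (Suc n)) = \<dots>" .
  have "?P * (\<integral>\<^sup>+c. F (triangular_map p a b (Suc n) c) \<partial>?M (Suc n)) = 
     (\<integral>\<^sup>+y. ?P * (\<integral>\<^sup>+x. F ((triangular_map p a (\<lambda>k. b k + y * a n k) n x)(n := p n * y + b n)) \<partial>?M n) \<partial>lborel)"
    unfolding 1 using 0 by (intro nn_integral_cmult[symmetric]) simp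
  also have "\<dots> = (\<integral>\<^sup>+y. G (p n * y + b n) \<partial>lborel)"
    unfolding G_def
    by (intro nn_integral_cong Suc.IH[where F="\<lambda>u. F (u(n := t))" for t]) (use Suc.prems in auto)
  finally have 2: "?P * (\<integral>\<^sup>+c. F (triangular_map p a b (Suc n) c) \<partial>?M (Suc n)) = \<dots>" .
  have "(\<Prod>k<Suc n. ennreal (p k)) * (\<integral>\<^sup>+c. F (triangular_map p a b (Suc n) c) \<partial>?M (Suc n)) =
        ennreal (p n) * (\<integral>\<^sup>+y. G (p n * y + b n) \<partial>lborel)"
    using 2 by (simp add: mult_ac)
  also have "\<dots> = (\<integral>\<^sup>+y. G y \<partial>lborel)"
    using nn_integral_real_affine[OF Gm, of "p n" "b n"] Suc.prems(1)[of n] by (simp add: add.commute)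
  also have "\<dots> = (\<integral>\<^sup>+u. F u \<partial>?M (Suc n))"
    unfolding ins G_def using Suc.prems(2) by (subst product_nn_integral_insert_rev) (auto simp: ins)
  finally show ?case .
qed

text \<open>The slice of a crosspolytope of size \<open>t\<close> at height \<open>y\<close> is a
  crosspolytope of size \<open>t - |y|\<close> in one dimension less; this integrates the slice
  volumes. The halves \<open>y >= 0\<close> and \<open>y <= 0\<close> overlap only in 0.\<close>

lemma nn_integral_power_abs:
  assumes "t \<ge> (0::real)"
  shows "(\<integral>\<^sup>+y. ennreal ((2 * (t - \<bar>y\<bar>)) ^ n / fact n) * indicator {-t..t} y \<partial>lborel) =
         ennreal ((2 * t) ^ Suc n / fact (Suc n))"
proof -
  let ?f = "\<lambda>y::real. ennreal ((2 * (t - y)) ^ n / fact n) * indicator {0..t} y"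
  let ?g = "\<lambda>y::real. ennreal ((2 * (t + y)) ^ n / fact n) * indicator {-t..0} y"
  have f: "(\<integral>\<^sup>+y. ?f y \<partial>lborel) = ennreal ((2 * t) ^ Suc n / fact (Suc n) / 2)"
  proof (subst nn_integral_FTC_Icc[where F = "\<lambda>y. - ((2 * (t - y)) ^ Suc n / fact (Suc n) / 2)"])
    fix y assume "y \<in> {0..t}" then have "0 \<le> y" "y \<le> t" by auto
    show "((\<lambda>y. - ((2 * (t - y)) ^ Suc n / fact (Suc n) / 2)) has_real_derivative (2 * (t - y)) ^ n / fact n) (at y)"
      by (rule derivative_eq_intros refl | simp add: divide_simps del: of_nat_Suc)+
    show "0 \<le> (2 * (t - y)) ^ n / fact n" using \<open>y \<le> t\<close> by simp
  qed (use assms in auto)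
  have g: "(\<integral>\<^sup>+y. ?g y \<partial>lborel) = ennreal ((2 * t) ^ Suc n / fact (Suc n) / 2)"
  proof (subst nn_integral_FTC_Icc[where F = "\<lambda>y. ((2 * (t + y)) ^ Suc n / fact (Suc n) / 2)"])
    fix y assume "y \<in> {-t..0}" then have "-t \<le> y" "y \<le> 0" by auto
    show "((\<lambda>y. ((2 * (t + y)) ^ Suc n / fact (Suc n) / 2)) has_real_derivative (2 * (t + y)) ^ n / fact n) (at y)"
      by (rule derivative_eq_intros refl | simp add: divide_simps del: of_nat_Suc)+
    show "0 \<le> (2 * (t + y)) ^ n / fact n" using \<open>-t \<le> y\<close> by simp
  qed (use assms in auto)
  have "(\<integral>\<^sup>+y. ennreal ((2 * (t - \<bar>y\<bar>)) ^ n / fact n) * indicator {-t..t} y \<partial>lborel) =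
        (\<integral>\<^sup>+y. ?f y + ?g y \<partial>lborel)"
    by (intro nn_integral_cong_AE AE_I[of _ _ "{0}"]) (use assms in \<open>auto simp: indicator_def\<close>)
  also have "\<dots> = ennreal ((2 * t) ^ Suc n / fact (Suc n) / 2) + ennreal ((2 * t) ^ Suc n / fact (Suc n) / 2)"
    by (subst nn_integral_add) (simp_all only: f g, simp_all)
  also have "\<dots> = ennreal ((2 * t) ^ Suc n / fact (Suc n))"
    using assms by (subst ennreal_plus[symmetric]) (auto simp del: fact_Suc power_Suc)
  finally show ?thesis .
qed

lemma emeasure_crosspolytope:
  fixes t :: real
  assumes "finite A" "t \<ge> 0"
  shows "emeasure (PiM A (\<lambda>_. lborel)) ({c. (\<Sum>i\<in>A. \<bar>c i\<bar>) \<le> t} \<inter> space (PiM A (\<lambda>_. lborel))) =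
         ennreal ((2 * t) ^ card A / fact (card A))"
  using assms
proof (induction arbitrary: t)
  case empty
  then show ?case by (simp add: space_PiM)
next
  case (insert i A t)
  interpret product_sigma_finite "\<lambda>_. lborel" by standard
  let ?M = "\<lambda>A. PiM A (\<lambda>_. lborel :: real measure)"
  let ?X = "\<lambda>A t. {c. (\<Sum>i\<in>A. \<bar>c i\<bar>) \<le> t} \<inter> space (?M A)"
  have meas [measurable]: "?X B t \<in> sets (?M B)" if "finite B" for B t
    using that by measurable
  have "emeasure (?M (insert i A)) (?X (insert i A) t) =
        (\<integral>\<^sup>+y. \<integral>\<^sup>+x. indicator (?X (insert i A) t) (x(i := y)) \<partial>?M A \<partial>lborel)"
    using insert.hyps by (subst product_nn_integral_insert_rev[symmetric]) (auto intro!: nn_integral_indicator[symmetric] meas)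
  also have "\<dots> = (\<integral>\<^sup>+y. \<integral>\<^sup>+x. indicator {-t..t} y * indicator (?X A (t - \<bar>y\<bar>)) x \<partial>?M A \<partial>lborel)"
  proof (intro nn_integral_cong)
    fix y x assume x: "x \<in> space (?M A)"
    have *: "(\<Sum>j\<in>A. \<bar>if j = i then y else x j\<bar>) = (\<Sum>j\<in>A. \<bar>x j\<bar>)"
      using insert.hyps by (intro sum.cong) auto
    have **: "0 \<le> (\<Sum>j\<in>A. \<bar>x j\<bar>)" by (simp add: sum_nonneg)
    show "indicator (?X (insert i A) t) (x(i := y)) = (indicator {-t..t} y * indicator (?X A (t - \<bar>y\<bar>)) x :: ennreal)"
      using x ** insert.hyps
      by (cases "\<bar>y\<bar> \<le> t"; cases "\<bar>y\<bar> + (\<Sum>j\<in>A. \<bar>x j\<bar>) \<le> t"; linarith?)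
        (auto simp: indicator_def space_PiM PiE_def extensional_def * algebra_simps abs_le_iff)
  qed
  also have "\<dots> = (\<integral>\<^sup>+y. indicator {-t..t} y * emeasure (?M A) (?X A (t - \<bar>y\<bar>)) \<partial>lborel)"
    using insert.hyps by (subst nn_integral_cmult) (auto simp: nn_integral_indicator meas)
  also have "\<dots> = (\<integral>\<^sup>+y. ennreal ((2 * (t - \<bar>y\<bar>)) ^ card A / fact (card A)) * indicator {-t..t} y \<partial>lborel)"
    by (intro nn_integral_cong) (auto simp: indicator_def insert.IH abs_le_iff)
  also have "\<dots> = ennreal ((2 * t) ^ card (insert i A) / fact (card (insert i A)))"
    using nn_integral_power_abs[OF insert.prems, of "card A"] insert.hyps by simp
  finally show ?case .
qed

lemma emeasure_triangular_preimage_ball: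
  assumes "\<And>k. k < n \<Longrightarrow> p k > 0" "r > 0"
  shows "(\<Prod>k<n. ennreal (p k)) * emeasure (PiM {..<n} (\<lambda>_. lborel))
           ({c. (\<Sum>k<n. (triangular_map p a b n c k)\<^sup>2) \<le> r\<^sup>2} \<inter> space (PiM {..<n} (\<lambda>_. lborel))) =
         ennreal (unit_ball_vol (real n) * r ^ n)"
proof -
  let ?M = "PiM {..<n} (\<lambda>_. lborel :: real measure)"
  let ?B = "{f. sqrt (\<Sum>i<n. (f i)\<^sup>2) \<le> r} \<inter> space ?M"
  have meas: "?B \<in> sets ?M" by measurable
  have "emeasure ?M ({c. (\<Sum>k<n. (triangular_map p a b n c k)\<^sup>2) \<le> r\<^sup>2} \<inter> space ?M) =
        (\<integral>\<^sup>+c. indicator ?B (triangular_map p a b n c) \<partial>?M)"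
  proof (subst nn_integral_indicator[symmetric])
    have "(\<lambda>c. triangular_map p a b n c k) \<in> borel_measurable ?M" if "k < n" for k
      using measurable_compose[OF measurable_triangular_map measurable_component_singleton, of k n p a b] that by simp
    then have [measurable]: "(\<lambda>c. \<Sum>k<n. (triangular_map p a b n c k)\<^sup>2) \<in> borel_measurable ?M"
      by (intro borel_measurable_sum borel_measurable_power) auto
    show "{c. (\<Sum>k<n. (triangular_map p a b n c k)\<^sup>2) \<le> r\<^sup>2} \<inter> space ?M \<in> sets ?M" by measurable
    have "sqrt x \<le> r \<longleftrightarrow> x \<le> r\<^sup>2" if "x \<ge> 0" for x
      using assms(2) that real_sqrt_le_iff' by simp
    then show "(\<integral>\<^sup>+x. indicator ({c. (\<Sum>k<n. (triangular_map p a b n c k)\<^sup>2) \<le> r\<^sup>2} \<inter> space ?M) x \<partial>?M) =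
      (\<integral>\<^sup>+c. indicator ?B (triangular_map p a b n c) \<partial>?M)"
      using measurable_space[OF measurable_triangular_map, of _ n p a b]
      by (intro nn_integral_cong) (auto simp: indicator_def sum_nonneg)
  qed
  then show ?thesis
    using nn_integral_triangular_map[OF assms(1) borel_measurable_indicator[OF meas], where a=a and b=b]
      emeasure_cball_aux[OF finite_lessThan assms(2), of n] meas
    by (simp add: nn_integral_indicator)
qed

lemma bessel_sum_le:
  fixes e :: "'i \<Rightarrow> 'h::real_inner"
  assumes "finite A" and on: "\<And>i j. i \<in> A \<Longrightarrow> j \<in> A \<Longrightarrow> e i \<bullet> e j = (if i = j then 1 else 0)"
  shows "(\<Sum>k\<in>A. (v \<bullet> e k)\<^sup>2) \<le> (norm v)\<^sup>2"
proof -
  define w where "w = (\<Sum>k\<in>A. (v \<bullet> e k) *\<^sub>R e k)"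
  have 1: "w \<bullet> e k = v \<bullet> e k" if "k \<in> A" for k
  proof -
    have "w \<bullet> e k = (\<Sum>i\<in>A. if i = k then v \<bullet> e i else 0)"
      unfolding w_def inner_sum_left using on that by (intro sum.cong) auto
    also have "\<dots> = v \<bullet> e k" using assms(1) that by simp
    finally show ?thesis .
  qed
  have 2: "w \<bullet> w = (\<Sum>k\<in>A. (v \<bullet> e k)\<^sup>2)"
    by (subst (2) w_def) (simp add: inner_sum_right 1 power2_eq_square)
  have "v \<bullet> w = (\<Sum>k\<in>A. (v \<bullet> e k)\<^sup>2)"
    unfolding w_def by (simp add: inner_sum_right power2_eq_square)
  moreover have "0 \<le> (v - w) \<bullet> (v - w)" by simp
  ultimately show ?thesis
    using 2 by (simp add: inner_diff_left inner_diff_right power2_norm_eq_inner inner_commute)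
qed

text \<open>
  In the coordinates \<open>c\<close>, Bessel's inequality places the points within \<open>r\<close> of \<open>z\<close> in the preimage of
  a ball under a triangular map.
\<close>

lemma prod_inner_le_covering:
  fixes e g :: "nat \<Rightarrow> 'h::real_inner"
  assumes on: "\<And>i j. i < n \<Longrightarrow> j < n \<Longrightarrow> e i \<bullet> e j = (if i = j then 1 else 0)"
    and tri: "\<And>i k. i < k \<Longrightarrow> k < n \<Longrightarrow> g i \<bullet> e k = 0"
    and pos: "\<And>k. k < n \<Longrightarrow> g k \<bullet> e k > 0"
    and "finite Z" "r > 0"
    and cover: "\<And>c. (\<Sum>i<n. \<bar>c i\<bar>) \<le> 1 \<Longrightarrow> \<exists>z\<in>Z. norm ((\<Sum>i<n. c i *\<^sub>R g i) - z) \<le> r"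
  shows "(\<Prod>k<n. g k \<bullet> e k) * 2 ^ n / fact n \<le> card Z * unit_ball_vol (real n) * r ^ n"
proof -
  let ?M = "PiM {..<n} (\<lambda>_. lborel :: real measure)"
  define p where "p k = g k \<bullet> e k" for k
  define a where "a i k = g i \<bullet> e k" for i k
  define T where "T z = triangular_map p a (\<lambda>k. - (z \<bullet> e k)) n" for z
  define B where "B z = {c. (\<Sum>k<n. (T z c k)\<^sup>2) \<le> r\<^sup>2} \<inter> space ?M" for z
  have T: "T z c k = ((\<Sum>i<n. c i *\<^sub>R g i) - z) \<bullet> e k" if "k < n" for z c k
  proof -
    have "(\<Sum>i<n. c i * (g i \<bullet> e k)) = (\<Sum>i\<in>insert k {k<..<n}. c i * (g i \<bullet> e k))"
      using that tri by (intro sum.mono_neutral_right) auto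
    then show ?thesis
      using that by (simp add: T_def triangular_map_def p_def a_def inner_diff_left inner_sum_left)
  qed
  have BM: "B z \<in> sets ?M" for z
  proof -
    have "(\<lambda>c. T z c k) \<in> borel_measurable ?M" if "k < n" for k
      using measurable_compose[OF measurable_triangular_map measurable_component_singleton,
          of k n p a "\<lambda>k. - (z \<bullet> e k)"] that by (simp add: T_def)
    then have [measurable]: "(\<lambda>c. \<Sum>k<n. (T z c k)\<^sup>2) \<in> borel_measurable ?M"
      by (intro borel_measurable_sum borel_measurable_power) auto
    show ?thesis unfolding B_def by measurable
  qed
  have sub: "{c. (\<Sum>i<n. \<bar>c i\<bar>) \<le> 1} \<inter> space ?M \<subseteq> (\<Union>z\<in>Z. B z)"
  proof safe
    fix c :: "nat \<Rightarrow> real" assume c: "(\<Sum>i<n. \<bar>c i\<bar>) \<le> 1" "c \<in> space ?M"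
    obtain z where z: "z \<in> Z" "norm ((\<Sum>i<n. c i *\<^sub>R g i) - z) \<le> r" using cover c by blast
    have "(\<Sum>k<n. (T z c k)\<^sup>2) \<le> (norm ((\<Sum>i<n. c i *\<^sub>R g i) - z))\<^sup>2"
      using bessel_sum_le[of "{..<n}" e "(\<Sum>i<n. c i *\<^sub>R g i) - z"] on by (simp add: T)
    also have "\<dots> \<le> r\<^sup>2" using z by (simp add: power_mono)
    finally show "c \<in> (\<Union>z\<in>Z. B z)" using z c by (auto simp: B_def)
  qed
  \<comment> \<open>\<open>z\<close> only shifts the triangular map, so all preimages have the same
    volume: that of the ball divided by the determinant.\<close>
  have B: "(\<Prod>k<n. ennreal (p k)) * emeasure ?M (B z) = ennreal (unit_ball_vol (real n) * r ^ n)" for z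
    unfolding B_def T_def
    by (rule emeasure_triangular_preimage_ball) (use pos assms in \<open>auto simp: p_def\<close>)
  have "ennreal ((\<Prod>k<n. p k) * (2 ^ n / fact n)) = (\<Prod>k<n. ennreal (p k)) * ennreal ((2 * 1) ^ card {..<n} / fact (card {..<n}))"
    using pos by (subst prod_ennreal) (auto simp: p_def less_imp_le ennreal_mult'' simp flip: times_divide_eq_right)
  also have "\<dots> = (\<Prod>k<n. ennreal (p k)) * emeasure ?M ({c. (\<Sum>i<n. \<bar>c i\<bar>) \<le> 1} \<inter> space ?M)"
    by (subst emeasure_crosspolytope) auto
  also have "\<dots> \<le> (\<Prod>k<n. ennreal (p k)) * emeasure ?M (\<Union>z\<in>Z. B z)"
    using sub BM assms by (intro mult_left_mono emeasure_mono) auto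
  also have "\<dots> \<le> (\<Prod>k<n. ennreal (p k)) * (\<Sum>z\<in>Z. emeasure ?M (B z))"
    using BM assms by (intro mult_left_mono emeasure_subadditive_finite) auto
  also have "\<dots> = ennreal (card Z * (unit_ball_vol (real n) * r ^ n))"
    using assms by (simp add: sum_distrib_left B ennreal_mult'' ennreal_of_nat_eq_real_of_nat)
  finally show ?thesis using assms
    by (subst (asm) ennreal_le_iff) (auto simp: p_def mult.assoc)
qed

section \<open>Growth of n! times the volume of the unit ball\<close>

lemma unit_ball_vol_add_2:
  "unit_ball_vol (real (n + 2)) = unit_ball_vol (real n) * (2 * pi / real (n + 2))"
proof -
  have "Gamma (real n / 2 + 1 + 1) = (real n / 2 + 1) * Gamma (real n / 2 + 1)"
    by (rule Gamma_plus1) (auto simp: add_pos_pos dest!: nonpos_Ints_nonpos)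
  moreover have "real (n + 2) / 2 + 1 = real n / 2 + 1 + 1" by simp
  moreover have "pi powr (real (n + 2) / 2) = pi powr (real n / 2) * pi"
    by (simp add: add_divide_distrib powr_add)
  ultimately show ?thesis
    unfolding unit_ball_vol_def by (simp only:) (simp add: divide_simps)
qed

text \<open>Induction in steps of two, each of which multiplies
  \<open>fact n * unit_ball_vol n\<close> by \<open>2 * pi * (n + 1)\<close>. Growth alone would
  allow a constant near \<open>2 * pi / exp 1\<close> in place of 5, but the left side is 4 at
  \<open>n = 1\<close>; the value 5 leaves room for the crude estimate
  \<open>pi < 4\<close>.\<close>

lemma fact_unit_ball_vol_le: "(fact n * unit_ball_vol (real n))\<^sup>2 \<le> (5 * real n) ^ n"
proof (induction n rule: induct_nat_012)
  case 0
  then show ?case by simp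
next
  case 1
  then show ?case by simp
next
  case (ge2 n)
  define N where "N = real n"
  have N: "N \<ge> 0" by (simp add: N_def)
  have step: "(2 * pi * (N + 1))\<^sup>2 * (5 * N) ^ n \<le> (5 * (N + 2)) ^ (n + 2)"
  proof (cases "n = 0")
    case True
    have "pi * pi \<le> 4 * 4" using pi_less_4 pi_gt_zero by (intro mult_mono) auto
    then show ?thesis by (simp add: True N_def power2_eq_square)
  next
    case False
    then have N1: "N > 0" by (simp add: N_def)
    \<comment> \<open>Bernoulli's inequality gains a factor 3 in passing from \<open>N ^ n\<close>
      to \<open>(N + 2) ^ n\<close>, and \<open>64 <= 75 = 25 * 3\<close> is what the step
      requires.\<close>
    have "3 \<le> 1 + real n * (2 / N)" using N1 by (simp add: N_def)
    also have "\<dots> \<le> (1 + 2 / N) ^ n"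
      using N1 by (intro Bernoulli_inequality) (simp add: order_trans[OF _ divide_nonneg_pos])
    finally have "3 * N ^ n \<le> (1 + 2 / N) ^ n * N ^ n" using N1 by simp
    also have "\<dots> = (N + 2) ^ n" using N1 by (simp add: power_mult_distrib[symmetric] field_simps)
    finally have 1: "3 * N ^ n \<le> (N + 2) ^ n" .
    have "pi * pi \<le> 4 * 4" using pi_less_4 pi_gt_zero by (intro mult_mono) auto
    then have "(2 * pi * (N + 1))\<^sup>2 \<le> 64 * (N + 1)\<^sup>2"
      using mult_right_mono[of "pi * pi" 16 "4 * (N + 1)\<^sup>2"] by (simp add: power_mult_distrib power2_eq_square)
    also have "\<dots> \<le> 75 * (N + 2)\<^sup>2"
      using N by (intro mult_mono power_mono) auto
    finally have "(2 * pi * (N + 1))\<^sup>2 * (5 * N) ^ n \<le> 75 * (N + 2)\<^sup>2 * (5 * N) ^ n"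
      using N by (intro mult_right_mono) auto
    also have "\<dots> = 25 * (N + 2)\<^sup>2 * 5 ^ n * (3 * N ^ n)" by (simp add: power_mult_distrib)
    also have "\<dots> \<le> 25 * (N + 2)\<^sup>2 * 5 ^ n * (N + 2) ^ n" using 1 N by (intro mult_left_mono) auto
    also have "\<dots> = (5 * (N + 2)) ^ (n + 2)"
      unfolding power_mult_distrib power_add power2_eq_square by (simp add: algebra_simps)
    finally show ?thesis .
  qed
  have "fact (Suc (Suc n)) * unit_ball_vol (real (Suc (Suc n))) =
        2 * pi * (N + 1) * (fact n * unit_ball_vol (real n))"
  proof -
    have "fact (Suc (Suc n)) = (N + 2) * ((N + 1) * fact n)" by (simp add: N_def algebra_simps)
    moreover have "unit_ball_vol (real (Suc (Suc n))) = unit_ball_vol (real n) * (2 * pi / (N + 2))"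
      using unit_ball_vol_add_2[of n] by (simp add: N_def add.commute)
    ultimately show ?thesis using N by (simp only:) simp
  qed
  then have "(fact (Suc (Suc n)) * unit_ball_vol (real (Suc (Suc n))))\<^sup>2 =
        (2 * pi * (N + 1))\<^sup>2 * (fact n * unit_ball_vol (real n))\<^sup>2"
    by (simp only: power_mult_distrib)
  also have "\<dots> \<le> (2 * pi * (N + 1))\<^sup>2 * (5 * N) ^ n"
    using ge2(1) unfolding N_def by (intro mult_left_mono) auto
  also have "\<dots> \<le> (5 * real (Suc (Suc n))) ^ Suc (Suc n)"
    using step by (simp add: N_def add.commute)
  finally show ?case .
qed

section \<open>Interpolation and the power function\<close>

text \<open>Gram-Schmidt. A vector whose remainder \<open>w\<close> vanishes is dropped, hence only
  an inequality between the cardinalities.\<close>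

lemma ex_orthonormal_basis_span:
  fixes F :: "'h::real_inner set"
  assumes "finite F"
  obtains B where "finite B" "card B \<le> card F" "span B = span F"
    "\<And>b c. b \<in> B \<Longrightarrow> c \<in> B \<Longrightarrow> b \<bullet> c = (if b = c then 1 else 0)"
  using assms
proof (induction F arbitrary: thesis)
  case empty
  show ?case by (rule empty[of "{}"]) auto
next
  case (insert v F)
  obtain B where B: "finite B" "card B \<le> card F" "span B = span F"
    and on: "\<And>b c. b \<in> B \<Longrightarrow> c \<in> B \<Longrightarrow> b \<bullet> c = (if b = c then 1 else 0)"
    by (rule insert.IH) auto
  define w where "w = v - (\<Sum>b\<in>B. (v \<bullet> b) *\<^sub>R b)"
  have w: "w \<bullet> c = 0" if "c \<in> B" for c
  proof -
    have "(\<Sum>b\<in>B. (v \<bullet> b) * (b \<bullet> c)) = (\<Sum>b\<in>B. if b = c then v \<bullet> b else 0)"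
      using on that by (intro sum.cong) auto
    then show ?thesis using B that by (simp add: w_def inner_diff_left inner_sum_left)
  qed
  have sB: "(\<Sum>b\<in>B. (v \<bullet> b) *\<^sub>R b) \<in> span B"
    by (intro span_sum span_scale span_base)
  have wv: "span (insert w B) = span (insert v F)"
  proof -
    have "span (insert w B) = span (insert v B)"
      unfolding w_def using sB by (metis eq_span_insert_eq diff_diff_eq2 add_diff_cancel_left' )
    also have "\<dots> = span (insert v F)" using B(3) by (simp add: span_insert)
    finally show ?thesis .
  qed
  show ?case
  proof (cases "w = 0")
    case True
    show ?thesis
      by (rule insert.prems[of B]) (use B on wv insert.hyps True in \<open>auto simp: span_insert_0\<close>)
  next
    case False
    define u where "u = w /\<^sub>R norm w"
    have u: "u \<bullet> u = 1" "\<And>c. c \<in> B \<Longrightarrow> u \<bullet> c = 0" "\<And>c. c \<in> B \<Longrightarrow> c \<bullet> u = 0"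
      using False w by (auto simp: u_def inner_commute dot_square_norm power2_eq_square)
    have "span (insert u B) = span (insert w B)"
    proof (intro equalityI span_minimal subspace_span subsetI)
      fix x assume "x \<in> insert u B"
      then show "x \<in> span (insert w B)"
        by (auto simp: u_def intro: span_scale span_base)
    next
      fix x assume x: "x \<in> insert w B"
      have "w = norm w *\<^sub>R u" using False by (simp add: u_def)
      then show "x \<in> span (insert u B)"
        using x by (metis insert_iff span_base span_scale)
    qed
    moreover have "u \<notin> B" using u by fastforce
    ultimately show ?thesis
      by (intro insert.prems[of "insert u B"]) (use B on u wv insert.hyps in auto)
  qed
qed

lemma orth_proj_unique:
  assumes "subspace V" "v \<in> V" "\<And>w. w \<in> V \<Longrightarrow> (u - v) \<bullet> w = 0"
  shows "orth_proj V u = v"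
  unfolding orth_proj_def
proof (rule the_equality)
  fix v' assume v': "v' \<in> V \<and> (\<forall>w\<in>V. (u - v') \<bullet> w = 0)"
  then have "v - v' \<in> V" using assms by (simp add: subspace_diff)
  then have "(u - v') \<bullet> (v - v') - (u - v) \<bullet> (v - v') = 0" using assms v' by simp
  then have "(v - v') \<bullet> (v - v') = 0" by (simp add: inner_diff_left)
  then show "v' = v" by simp
qed (use assms in auto)

lemma orth_proj_span_finite:
  assumes "finite F"
  shows "orth_proj (span F) u \<in> span F" "w \<in> span F \<Longrightarrow> (u - orth_proj (span F) u) \<bullet> w = 0"
proof -
  obtain B where B: "finite B" "card B \<le> card F" "span B = span F"
    and on: "\<And>b c. b \<in> B \<Longrightarrow> c \<in> B \<Longrightarrow> b \<bullet> c = (if b = c then 1 else 0)"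
    by (rule ex_orthonormal_basis_span[OF assms]) auto
  define v where "v = (\<Sum>b\<in>B. (u \<bullet> b) *\<^sub>R b)"
  have "(u - v) \<bullet> c = 0" if "c \<in> B" for c
  proof -
    have "(\<Sum>b\<in>B. (u \<bullet> b) * (b \<bullet> c)) = (\<Sum>b\<in>B. if b = c then u \<bullet> b else 0)"
      using on that by (intro sum.cong) auto
    then show ?thesis using B that by (simp add: v_def inner_diff_left inner_sum_left)
  qed
  then have orth: "(u - v) \<bullet> w = 0" if "w \<in> span B" for w
    using that orthogonal_to_span[of w B "u - v"] by (simp add: orthogonal_def)
  have "v \<in> span F" unfolding v_def B(3)[symmetric] by (intro span_sum span_scale span_base)
  moreover have "orth_proj (span F) u = v"
    using orth B(3) \<open>v \<in> span F\<close> by (intro orth_proj_unique) auto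
  ultimately show "orth_proj (span F) u \<in> span F"
    "w \<in> span F \<Longrightarrow> (u - orth_proj (span F) u) \<bullet> w = 0"
    using orth B(3) by auto
qed

section \<open>Orthogonality relations in the reproducing kernel Hilbert space\<close>

locale rkhs_space =
  fixes S :: "'a set" and k :: "'a \<Rightarrow> 'a \<Rightarrow> real"
    and ev :: "'h::{real_inner,complete_space} \<Rightarrow> 'a \<Rightarrow> real"
  assumes rkhs: "rkhs S k ev"
begin

abbreviation "K \<equiv> kernel_at S k ev"
abbreviation "V \<equiv> trial_space S k ev"
abbreviation "P \<equiv> power_fun S k ev"
abbreviation "I \<equiv> interpolant S k ev"

lemma linear_ev: "x \<in> S \<Longrightarrow> linear (\<lambda>f. ev f x)"
  using rkhs unfolding rkhs_def by blast

lemma ev_diff: "x \<in> S \<Longrightarrow> ev (f - g) x = ev f x - ev g x"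
  using linear_diff[OF linear_ev] .

lemma ev_eqI: "(\<And>x. x \<in> S \<Longrightarrow> ev f x = ev g x) \<Longrightarrow> f = g"
  using rkhs ev_diff[of _ f g] unfolding rkhs_def by (metis right_minus_eq)

lemma kernel_at_eqI: "(\<And>y. y \<in> S \<Longrightarrow> ev g y = k y x) \<Longrightarrow> K x = g"
  unfolding kernel_at_def by (rule the_equality) (auto intro: ev_eqI)

lemma ev_kernel_at: "x \<in> S \<Longrightarrow> y \<in> S \<Longrightarrow> ev (K x) y = k y x"
  using rkhs kernel_at_eqI[of _ x] unfolding rkhs_def by metis

lemma ev_eq_inner: "x \<in> S \<Longrightarrow> ev f x = f \<bullet> K x"
  using rkhs kernel_at_eqI[of _ x] unfolding rkhs_def by metis

lemma kernel_at_inner: "x \<in> S \<Longrightarrow> y \<in> S \<Longrightarrow> K x \<bullet> K y = k y x"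
  using ev_kernel_at ev_eq_inner by metis

lemma norm_kernel_at: "x \<in> S \<Longrightarrow> norm (K x) = sqrt (k x x)"
  by (simp add: norm_eq_sqrt_inner kernel_at_inner)

text \<open>By the reproducing property, agreement of \<open>f\<close> and \<open>g\<close> at
  \<open>x\<close> means that \<open>f - g\<close> is orthogonal to \<open>K x\<close>. The
  interpolation conditions are therefore the orthogonality conditions of the projection, which gives
  existence and uniqueness at once.\<close>

lemma interpolant_eq_orth_proj:
  assumes "finite X" "X \<subseteq> S"
  shows "I X f = orth_proj (V X) f"
  unfolding interpolant_def
proof (rule the_equality)
  have V: "V X = span (K ` X)" by (simp add: trial_space_def)
  note o = orth_proj_span_finite[where F = "K ` X" and u = f, folded V]
  have "ev (orth_proj (V X) f) x = ev f x" if "x \<in> X" for x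
    using o(2)[of "K x"] that assms by (auto simp: ev_eq_inner subset_iff inner_diff_left V span_base)
  then show "orth_proj (V X) f \<in> V X \<and> (\<forall>x\<in>X. ev (orth_proj (V X) f) x = ev f x)"
    using o(1) assms by auto
next
  fix g assume g: "g \<in> V X \<and> (\<forall>x\<in>X. ev g x = ev f x)"
  have "(f - g) \<bullet> w = 0" if "w \<in> V X" for w
  proof -
    have "(f - g) \<bullet> K x = 0" if "x \<in> X" for x
      using g that assms ev_diff[of x f g] ev_eq_inner[of x "f - g"] by auto
    then show ?thesis
      using that orthogonal_to_span[of w "K ` X" "f - g"]
      by (auto simp: trial_space_def orthogonal_def)
  qed
  then show "g = orth_proj (V X) f"
    using g orth_proj_unique[of "V X" g f] by (simp add: trial_space_def)
qed

lemma residual_orth: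
  assumes "finite X" "X \<subseteq> S" "w \<in> V X"
  shows "(f - I X f) \<bullet> w = 0"
  using orth_proj_span_finite(2)[of "K ` X" w f] assms
  by (simp add: interpolant_eq_orth_proj trial_space_def)

lemma interpolant_in: "finite X \<Longrightarrow> X \<subseteq> S \<Longrightarrow> I X f \<in> V X"
  using orth_proj_span_finite(1)[of "K ` X" f]
  by (simp add: interpolant_eq_orth_proj trial_space_def)

lemma power_fun_eq: "finite X \<Longrightarrow> X \<subseteq> S \<Longrightarrow> P X x = norm (K x - I X (K x))"
  by (simp add: power_fun_def interpolant_eq_orth_proj)

lemma trial_space_mono: "X \<subseteq> Y \<Longrightarrow> V X \<subseteq> V Y"
  unfolding trial_space_def by (intro span_mono image_mono)

lemma subspace_trial_space: "subspace (V X)"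
  by (simp add: trial_space_def)

lemma kernel_at_in_trial_space: "x \<in> X \<Longrightarrow> K x \<in> V X"
  by (simp add: trial_space_def span_base)

text \<open>The residual of \<open>f\<close> is orthogonal to \<open>V X\<close>, so
  \<open>K x\<close> may be replaced by its own residual. This is how the power function enters
  pointwise estimates.\<close>

lemma ev_residual:
  assumes "finite X" "X \<subseteq> S" "x \<in> S"
  shows "ev (f - I X f) x = (f - I X f) \<bullet> (K x - I X (K x))"
  using ev_eq_inner[OF assms(3)] residual_orth[OF assms(1,2) interpolant_in[OF assms(1,2)]]
  by (simp add: inner_diff_right)

lemma ev_residual_le:
  assumes "finite X" "X \<subseteq> S" "x \<in> S"
  shows "\<bar>ev (f - I X f) x\<bar> \<le> norm (f - I X f) * P X x"
  unfolding ev_residual[OF assms] power_fun_eq[OF assms(1,2)] by (rule Cauchy_Schwarz_ineq2)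

lemma ev_residual_eq_0: "finite X \<Longrightarrow> X \<subseteq> S \<Longrightarrow> x \<in> X \<Longrightarrow> ev (f - I X f) x = 0"
  using residual_orth[of X "K x" f] kernel_at_in_trial_space[of x X] ev_eq_inner[of x "f - I X f"] by auto

lemma norm_residual_le:
  assumes "finite X" "X \<subseteq> S"
  shows "norm (f - I X f) \<le> norm f"
proof -
  have "(norm f)\<^sup>2 = (norm ((f - I X f) + I X f))\<^sup>2" by simp
  also have "\<dots> = (norm (f - I X f))\<^sup>2 + (norm (I X f))\<^sup>2"
    using residual_orth[OF assms interpolant_in[OF assms]] 
    by (subst norm_add_Pythagorean) (auto simp: orthogonal_def)
  finally show ?thesis by (simp add: power2_le_imp_le)
qed

lemma power_fun_le: "finite X \<Longrightarrow> X \<subseteq> S \<Longrightarrow> x \<in> S \<Longrightarrow> P X x \<le> sqrt (k x x)"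
  using norm_residual_le[of X "K x"] kernel_at_inner[of x x] by (simp add: power_fun_eq norm_eq_sqrt_inner)

lemma residual_diff_interpolant:
  assumes "finite Y" "Y \<subseteq> S" "X \<subseteq> Y"
  shows "(norm (f - I X f))\<^sup>2 = (norm (f - I Y f))\<^sup>2 + (norm (I Y f - I X f))\<^sup>2"
proof -
  have X: "finite X" "X \<subseteq> S" using assms by (auto intro: finite_subset)
  have "I Y f - I X f \<in> V Y"
    using interpolant_in[OF assms(1,2)] interpolant_in[OF X] trial_space_mono[OF assms(3)]
    by (intro subspace_diff subspace_trial_space) auto
  then have "(f - I Y f) \<bullet> (I Y f - I X f) = 0" by (rule residual_orth[OF assms(1,2)])
  then have "(norm ((f - I Y f) + (I Y f - I X f)))\<^sup>2 = (norm (f - I Y f))\<^sup>2 + (norm (I Y f - I X f))\<^sup>2"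
    by (subst norm_add_Pythagorean) (auto simp: orthogonal_def)
  then show ?thesis by simp
qed

text \<open>The residual's value at the new point is carried by the increment of the interpolant,
  which is orthogonal to \<open>V X\<close>. Cauchy-Schwarz against the residual of
  \<open>K x\<close> bounds it by the norm of the increment times the power function, and by
  Pythagoras that norm is the drop in energy.\<close>

lemma residual_step:
  assumes "finite X" "X \<subseteq> S" "x \<in> S"
  shows "(ev (f - I X f) x / P X x)\<^sup>2 \<le> (norm (f - I X f))\<^sup>2 - (norm (f - I (insert x X) f))\<^sup>2"
proof -
  let ?Y = "insert x X"
  have Y: "finite ?Y" "?Y \<subseteq> S" using assms by auto
  have "ev (f - I X f) x = ev (I ?Y f - I X f) x"
    using ev_residual_eq_0[OF Y, of x f] assms(3) by (simp add: ev_diff)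
  also have "\<dots> = (I ?Y f - I X f) \<bullet> (K x - I X (K x))"
  proof -
    have "(f - I ?Y f) \<bullet> I X (K x) = 0"
      using residual_orth[OF Y] interpolant_in[OF assms(1,2)] trial_space_mono[of X ?Y] by blast
    then have "(I ?Y f - I X f) \<bullet> I X (K x) = 0"
      using residual_orth[OF assms(1,2) interpolant_in[OF assms(1,2)], of f "K x"]
      by (simp add: inner_diff_left)
    then show ?thesis using ev_eq_inner[OF assms(3)] by (simp add: inner_diff_right)
  qed
  finally have "\<bar>ev (f - I X f) x\<bar> \<le> norm (I ?Y f - I X f) * P X x"
    using Cauchy_Schwarz_ineq2 by (simp add: power_fun_eq[OF assms(1,2)])
  \<comment> \<open>If \<open>P X x = 0\<close>, the quotient is 0 by the convention for
    division.\<close>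
  then have "\<bar>ev (f - I X f) x / P X x\<bar> \<le> norm (I ?Y f - I X f)"
    by (cases "P X x = 0") (auto simp: divide_le_eq power_fun_def)
  then have "(ev (f - I X f) x / P X x)\<^sup>2 \<le> (norm (I ?Y f - I X f))\<^sup>2"
    by (metis abs_ge_zero power2_abs power_mono)
  then show ?thesis using residual_diff_interpolant[OF Y subset_insertI, of f] by linarith
qed

text \<open>If the power function vanished, \<open>K x\<close> would lie in \<open>V X\<close>, and
  moving it to the other side would give a vanishing combination with coefficient -1 at
  \<open>x\<close>. Its squared norm is a quadratic form that strict positive definiteness makes
  positive.\<close>

lemma power_fun_pos:
  assumes "strictly_pd_kernel S k" "finite X" "X \<subseteq> S" "x \<in> S - X"
  shows "P X x > 0"
proof (rule ccontr)
  have pd: "0 < (\<Sum>u\<in>X. \<Sum>v\<in>X. c u * c v * k u v)"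
    if "finite X" "X \<subseteq> S" "x \<in> X" "c x \<noteq> 0" for X c x
    using assms(1) that unfolding strictly_pd_kernel_def by blast
  assume "\<not> P X x > 0"
  then have "K x = I X (K x)" using assms by (simp add: power_fun_eq)
  then have "K x \<in> V X" using interpolant_in assms by metis
  then obtain c where c: "K x = (\<Sum>v\<in>K ` X. c v *\<^sub>R v)"
    using assms by (auto simp: trial_space_def span_finite)
  \<comment> \<open>The span supplies coefficients indexed by the vectors \<open>K y\<close>;
    injectivity turns them into coefficients indexed by the points \<open>y\<close>.\<close>
  have inj: "inj_on K X"
  proof (rule inj_onI, rule ccontr)
    fix y z assume yz: "y \<in> X" "z \<in> X" "K y = K z" "y \<noteq> z"
    define c where "c u = (if u = y then 1 else - 1 :: real)" for u
    have "0 < (\<Sum>u\<in>{y,z}. \<Sum>v\<in>{y,z}. c u * c v * k u v)"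
      by (rule pd[of _ y]) (use assms yz in \<open>auto simp: c_def\<close>)
    also have "\<dots> = (\<Sum>u\<in>{y,z}. \<Sum>v\<in>{y,z}. c u * c v * (K v \<bullet> K u))"
      using yz assms by (intro sum.cong refl arg_cong2[where f = "(*)"] kernel_at_inner[symmetric]) blast+
    also have "\<dots> = 0" using yz by (simp add: c_def)
    finally show False by simp
  qed
  define a where "a y = (if y = x then -1 else c (K y))" for y
  have "(\<Sum>y\<in>insert x X. a y *\<^sub>R K y) = - K x + (\<Sum>y\<in>X. c (K y) *\<^sub>R K y)"
    using assms by (auto simp: a_def intro!: sum.cong)
  also have "(\<Sum>y\<in>X. c (K y) *\<^sub>R K y) = K x" using c inj by (simp add: sum.reindex)
  finally have 0: "(\<Sum>y\<in>insert x X. a y *\<^sub>R K y) = 0" by simp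
  have "0 < (\<Sum>u\<in>insert x X. \<Sum>v\<in>insert x X. a u * a v * k u v)"
    by (rule pd[of _ x]) (use assms in \<open>auto simp: a_def\<close>)
  also have "\<dots> = (\<Sum>u\<in>insert x X. \<Sum>v\<in>insert x X. a u * a v * (K v \<bullet> K u))"
    using assms by (intro sum.cong refl) (auto simp: kernel_at_inner subset_iff)
  also have "\<dots> = (\<Sum>u\<in>insert x X. a u *\<^sub>R K u) \<bullet> (\<Sum>v\<in>insert x X. a v *\<^sub>R K v)"
    unfolding inner_sum_left inner_sum_right by (intro sum.cong refl) (simp add: inner_commute mult_ac)
  finally show False using 0 by simp
qed

end

section \<open>Greedy algorithms\<close>

text \<open>The hull is defined by sums over sets of vectors. For an indexed family with repetitions
  the coefficients of equal vectors are merged, which does not increase the sum of absolute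
  values.\<close>

lemma sum_in_closed_abs_hull:
  assumes "finite A" "g ` A \<subseteq> K" "(\<Sum>i\<in>A. \<bar>c i\<bar>) \<le> 1"
  shows "(\<Sum>i\<in>A. c i *\<^sub>R g i) \<in> closed_abs_hull K"
proof -
  define c' where "c' v = (\<Sum>i\<in>{i\<in>A. g i = v}. c i)" for v
  have "(\<Sum>i\<in>A. c i *\<^sub>R g i) = (\<Sum>v\<in>g ` A. \<Sum>i\<in>{i\<in>A. g i = v}. c i *\<^sub>R g i)"
    using assms(1) by (rule sum.image_gen)
  also have "\<dots> = (\<Sum>v\<in>g ` A. c' v *\<^sub>R v)"
    by (intro sum.cong refl) (auto simp: c'_def scaleR_sum_left intro!: sum.cong)
  finally have "(\<Sum>i\<in>A. c i *\<^sub>R g i) = \<dots>" .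
  moreover have "(\<Sum>v\<in>g ` A. \<bar>c' v\<bar>) \<le> 1"
  proof -
    have "(\<Sum>v\<in>g ` A. \<bar>c' v\<bar>) \<le> (\<Sum>v\<in>g ` A. \<Sum>i\<in>{i\<in>A. g i = v}. \<bar>c i\<bar>)"
      unfolding c'_def by (intro sum_mono sum_abs)
    also have "\<dots> = (\<Sum>i\<in>A. \<bar>c i\<bar>)" using assms(1) by (rule sum.image_gen[symmetric])
    finally show ?thesis using assms(3) by simp
  qed
  ultimately show ?thesis
    unfolding closed_abs_hull_def using assms
    by (intro closure_subset[THEN subsetD] CollectI exI[of _ c'] exI[of _ "g ` A"]) auto
qed

text \<open>The inequality of arithmetic and geometric means, applied to the squares of the
  \<open>a i\<close>.\<close>

lemma prod_le_power_sum_squares: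
  fixes a :: "'i \<Rightarrow> real"
  assumes "finite A" "A \<noteq> {}" "\<And>i. i \<in> A \<Longrightarrow> a i \<ge> 0" "(\<Sum>i\<in>A. (a i)\<^sup>2) \<le> R\<^sup>2" "R \<ge> 0"
  shows "(\<Prod>i\<in>A. a i) \<le> (R / sqrt (card A)) ^ card A"
proof -
  define n where "n = card A"
  have n: "n > 0" using assms by (auto simp: n_def card_gt_0_iff)
  have p: "(\<Prod>i\<in>A. (a i)\<^sup>2) \<ge> 0" by (simp add: prod_nonneg)
  have "(\<Prod>i\<in>A. (a i)\<^sup>2) powr (1 / n) \<le> (\<Sum>i\<in>A. (a i)\<^sup>2 / n)"
    using arith_geom_mean[OF assms(1,2), of "\<lambda>i. (a i)\<^sup>2"] by (simp add: n_def)
  also have "\<dots> \<le> R\<^sup>2 / n" using assms(4) n by (simp add: sum_divide_distrib[symmetric] divide_right_mono)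
  finally have "((\<Prod>i\<in>A. (a i)\<^sup>2) powr (1 / n)) ^ n \<le> (R\<^sup>2 / n) ^ n"
    by (intro power_mono) auto
  also have "((\<Prod>i\<in>A. (a i)\<^sup>2) powr (1 / n)) ^ n = (\<Prod>i\<in>A. (a i)\<^sup>2)"
    using p n by (cases "(\<Prod>i\<in>A. (a i)\<^sup>2) = 0") (auto simp: powr_realpow[symmetric] powr_powr)
  also have "\<dots> = (\<Prod>i\<in>A. a i)\<^sup>2" by (simp add: prod_power_distrib)
  also have "(R\<^sup>2 / n) ^ n = ((R / sqrt n) ^ n)\<^sup>2"
    using n by (simp add: power_divide power_mult[symmetric] mult.commute[of n 2])
      (simp add: power_mult)
  finally show ?thesis
    unfolding n_def by (rule power2_le_imp_le) (use assms(5) in simp)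
qed

lemma ex_le_of_prod_le:
  fixes B :: "'i \<Rightarrow> real"
  assumes "finite A" "A \<noteq> {}" "(\<Prod>i\<in>A. B i) \<le> T ^ card A" "T \<ge> 0"
  shows "\<exists>i\<in>A. B i \<le> T"
proof (rule ccontr)
  assume *: "\<not> ?thesis"
  obtain i0 where "i0 \<in> A" using assms by auto
  then have "(\<Prod>i\<in>A. T) < (\<Prod>i\<in>A. B i)" if "T > 0"
    using * assms that by (intro prod_mono_strict[of i0]) (auto simp: not_le intro: less_imp_le)
  moreover have "0 < (\<Prod>i\<in>A. B i)" if "T = 0"
    using * assms that by (intro prod_pos) (auto simp: not_le)
  moreover have "card A > 0" using assms by (simp add: card_gt_0_iff)
  ultimately show False using assms by (cases "T = 0") (auto simp: zero_power)
qed

lemma rpow_nonneg: "t \<ge> 0 \<Longrightarrow> rpow t a \<ge> 0"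
  by (simp add: rpow_def)

lemma rpow_mult: "s \<ge> 0 \<Longrightarrow> t \<ge> 0 \<Longrightarrow> rpow (s * t) a = rpow s a * rpow t a"
  by (simp add: rpow_def powr_mult)

lemma rpow_mono: "0 \<le> s \<Longrightarrow> s \<le> t \<Longrightarrow> a \<ge> 0 \<Longrightarrow> rpow s a \<le> rpow t a"
  by (simp add: rpow_def powr_mono2)

text \<open>The exponents \<open>a\<close> and \<open>1 - a\<close> are never both 0, so the
  convention for \<open>0 ^ 0\<close> does no harm at \<open>t = 0\<close>.\<close>

lemma rpow_split: "t \<ge> 0 \<Longrightarrow> 0 \<le> a \<Longrightarrow> a \<le> 1 \<Longrightarrow> rpow t a * rpow t (1 - a) = t"
  by (cases "t = 0") (auto simp: rpow_def powr_add[symmetric])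

lemma rpow_prod: "(\<And>i. i \<in> A \<Longrightarrow> B i \<ge> 0) \<Longrightarrow> rpow (\<Prod>i\<in>A. B i) a = (\<Prod>i\<in>A. rpow (B i) a)"
proof (induction A rule: infinite_finite_induct)
  case (insert i A)
  then show ?case by (simp add: rpow_mult prod_nonneg)
qed (simp_all add: rpow_def)

lemma rpow_power: "t \<ge> 0 \<Longrightarrow> rpow (t ^ n) a = rpow t a ^ n"
  using rpow_prod[of "{..<n}" "\<lambda>_. t" a] by simp

text \<open>The selection criterion as a function of two numbers, residual \<open>u\<close> and
  power function \<open>P\<close>. This reduces the case distinction on \<beta> to inequalities
  between reals.\<close>

definition greedy_value :: "ennreal \<Rightarrow> real \<Rightarrow> real \<Rightarrow> real" where
  "greedy_value \<beta> u P = (if \<beta> = \<infinity> then u / P else rpow u (enn2real \<beta>) * rpow P (1 - enn2real \<beta>))"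

section \<open>Products of power function values and the greedy estimate\<close>

context rkhs_space
begin

text \<open>The normalised residuals \<open>e i\<close> of the selected kernel functions
  \<open>g i\<close> form an orthonormal system adapted to the growing trial spaces (the Newton
  basis). In it the \<open>g i\<close> are triangular with the power function values on the
  diagonal. The offset \<open>m\<close> lets the window of \<open>n\<close> points start
  anywhere.\<close>

lemma prod_power_fun_le:
  assumes spd: "strictly_pd_kernel S k"
    and x: "\<And>i. x (i + 1) \<in> S - x ` {1..i}"
    and ent: "entropy_number n (closed_abs_hull (K ` S)) \<le> ennreal \<eta>" and "\<eta> > 0"
  shows "(\<Prod>i<n. P (x ` {1..m + i}) (x (m + i + 1))) \<le> (sqrt (5 * real n) * \<eta>) ^ n"
proof -
  define X where "X i = x ` {1..i}" for i
  have x': "x i \<in> S" if "i \<ge> 1" for i using x[of "i - 1"] that by auto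
  have X: "finite (X i)" "X i \<subseteq> S" for i using x' by (auto simp: X_def)
  have Xmono: "X i \<subseteq> X j" if "i \<le> j" for i j using that by (auto simp: X_def)
  define g where "g i = K (x (m + i + 1))" for i
  define w where "w i = g i - I (X (m + i)) (g i)" for i
  have nw: "norm (w i) = P (X (m + i)) (x (m + i + 1))" for i
    using power_fun_eq[OF X] by (simp add: w_def g_def)
  have nw_pos: "norm (w i) > 0" for i
    unfolding nw using power_fun_pos[OF spd X] x[of "m + i"] by (simp add: X_def)
  define e where "e i = w i /\<^sub>R norm (w i)" for i
  have gV: "g i \<in> V (X (m + k))" if "i < k" for i k
    unfolding g_def by (rule kernel_at_in_trial_space) (use that in \<open>auto simp: X_def\<close>)
  have wV: "w i \<in> V (X (m + k))" if "i < k" for i k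
    unfolding w_def using that trial_space_mono[OF Xmono, of "m + i" "m + k"] interpolant_in[OF X, of "m + i"]
    by (intro subspace_diff subspace_trial_space gV) auto
  have ge: "v \<bullet> e k = 0" if "v \<in> V (X (m + k))" for v k
    using residual_orth[OF X that, of "g k"] by (simp add: e_def w_def inner_commute)
  have tri: "g i \<bullet> e k = 0" if "i < k" for i k using ge gV that by blast
  have ee: "e i \<bullet> e k = 0" if "i < k" for i k
    using ge[OF wV[OF that]] by (simp add: e_def[of i])
  have on: "e i \<bullet> e j = (if i = j then 1 else 0)" for i j
  proof (cases i j rule: linorder_cases)
    case equal
    then show ?thesis using nw_pos[of j] by (simp add: e_def dot_square_norm power2_eq_square)
  qed (use ee inner_commute[of "e i" "e j"] in auto)
  have diag: "g i \<bullet> e i = norm (w i)" for i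
  proof -
    have "g i \<bullet> e i = (w i + I (X (m + i)) (g i)) \<bullet> e i" by (simp add: w_def)
    also have "\<dots> = w i \<bullet> e i" using ge[OF interpolant_in[OF X]] by (simp add: inner_add_left)
    finally show ?thesis using nw_pos[of i] by (simp add: e_def dot_square_norm power2_eq_square)
  qed
  \<comment> \<open>The entropy number is an infimum, so a covering is guaranteed only for radii
    beyond \<eta>; the bound at \<eta> is the limit as \<open>r\<close> decreases to it.\<close>
  have *: "(\<Prod>i<n. norm (w i)) \<le> (sqrt (5 * real n) * r) ^ n" if r: "r > \<eta>" for r
  proof -
    have "entropy_number n (closed_abs_hull (K ` S)) < ennreal r"
      using ent r assms(4) by (meson ennreal_lessI le_less_trans less_trans)
    then obtain \<epsilon> Z where e: "\<epsilon> > 0" "ennreal \<epsilon> < ennreal r" and Z: "finite Z" "card Z \<le> 2 ^ n"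
      "closed_abs_hull (K ` S) \<subseteq> (\<Union>z\<in>Z. cball z \<epsilon>)"
      unfolding entropy_number_def by (auto simp: Inf_less_iff)
    have er: "\<epsilon> \<le> r" using e by (simp add: ennreal_less_iff)
    have "(\<Prod>i<n. g i \<bullet> e i) * 2 ^ n / fact n \<le> card Z * unit_ball_vol (real n) * r ^ n"
    proof (rule prod_inner_le_covering)
      fix c :: "nat \<Rightarrow> real" assume "(\<Sum>i<n. \<bar>c i\<bar>) \<le> 1"
      then have "(\<Sum>i<n. c i *\<^sub>R g i) \<in> closed_abs_hull (K ` S)"
        using x' by (intro sum_in_closed_abs_hull) (auto simp: g_def)
      then show "\<exists>z\<in>Z. norm ((\<Sum>i<n. c i *\<^sub>R g i) - z) \<le> r"
        using Z er by (force simp: dist_norm norm_minus_commute)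
    qed (use on tri diag nw_pos Z r assms(4) in auto)
    \<comment> \<open>There are at most \<open>2 ^ n\<close> balls, and this factor cancels the
      \<open>2 ^ n\<close> from the volume of the crosspolytope.\<close>
    also have "\<dots> \<le> 2 ^ n * unit_ball_vol (real n) * r ^ n"
      using Z(2) r assms(4) of_nat_mono[OF Z(2), where 'a = real] by (intro mult_right_mono) auto
    finally have "(\<Prod>i<n. norm (w i)) \<le> fact n * unit_ball_vol (real n) * r ^ n"
      by (simp add: diag field_simps)
    also have "fact n * unit_ball_vol (real n) \<le> sqrt (5 * real n) ^ n"
    proof (rule power2_le_imp_le)
      show "(fact n * unit_ball_vol (real n))\<^sup>2 \<le> (sqrt (5 * real n) ^ n)\<^sup>2"
        using fact_unit_ball_vol_le[of n] by (simp add: power_mult[symmetric] mult.commute[of n 2])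
          (simp add: power_mult)
    qed simp
    also have "sqrt (5 * real n) ^ n * r ^ n = (sqrt (5 * real n) * r) ^ n" by (simp add: power_mult_distrib)
    finally show ?thesis using r assms(4) by (simp add: mult_right_mono)
  qed
  have "(\<Prod>i<n. norm (w i)) \<le> (sqrt (5 * real n) * \<eta>) ^ n"
  proof (rule tendsto_lowerbound[where F = "at_right \<eta>"])
    show "((\<lambda>r. (sqrt (5 * real n) * r) ^ n) \<longlongrightarrow> (sqrt (5 * real n) * \<eta>) ^ n) (at_right \<eta>)"
      by (intro tendsto_intros)
    show "\<forall>\<^sub>F r in at_right \<eta>. (\<Prod>i<n. norm (w i)) \<le> (sqrt (5 * real n) * r) ^ n"
      using * by (auto simp: eventually_at_filter)
  qed simp
  then show ?thesis by (simp add: nw X_def)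
qed

lemma sup_norm_leI: "(\<And>z. z \<in> S \<Longrightarrow> \<bar>g z\<bar> \<le> B) \<Longrightarrow> sup_norm S g \<le> ennreal B"
  unfolding sup_norm_def by (intro SUP_least ennreal_leI)

text \<open>\<open>ennreal\<close> truncates negative reals to 0; the comparison returns to the
  reals because the value at the selected point is nonnegative.\<close>

lemma weak_greedy_step:
  assumes "weak_greedy S k ev \<beta> \<gamma> f x" "\<gamma> > 0" "z \<in> S - x ` {1..i}"
    and "greedy_eta S k ev \<beta> f (x ` {1..i}) (x (i + 1)) \<ge> 0"
  shows "\<gamma> * greedy_eta S k ev \<beta> f (x ` {1..i}) z \<le> greedy_eta S k ev \<beta> f (x ` {1..i}) (x (i + 1))"
proof -
  let ?X = "x ` {1..i}"
  have "ennreal (\<gamma> * greedy_eta S k ev \<beta> f ?X z) = ennreal \<gamma> * ennreal (greedy_eta S k ev \<beta> f ?X z)"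
    using assms(2) by (simp add: ennreal_mult')
  also have "\<dots> \<le> ennreal \<gamma> * (SUP z\<in>S - ?X. ennreal (greedy_eta S k ev \<beta> f ?X z))"
    using assms(3) by (intro mult_left_mono SUP_upper) auto
  also have "\<dots> \<le> ennreal (greedy_eta S k ev \<beta> f ?X (x (i + 1)))"
    using assms(1) unfolding weak_greedy_def by (metis (mono_tags, lifting))
  finally show ?thesis using assms(4) by simp
qed

text \<open>The part common to all ranges of \<beta>. With \<open>p\<close> the power function at
  the next selected point and \<open>a\<close> the ratio of residual to power function there,
  \<open>F a p\<close> is a bound that the selection rule carries from the selected point to every
  other point. The products of the \<open>a\<close> and of the \<open>p\<close> over the window are
  controlled, so \<open>F\<close> is at most \<open>T\<close> at some index, and this index bounds
  the minimum.\<close>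

lemma weak_greedy_MIN_le:
  fixes F :: "real \<Rightarrow> real \<Rightarrow> real"
  assumes spd: "strictly_pd_kernel S k" and k1: "\<And>z. z \<in> S \<Longrightarrow> k z z \<le> 1"
    and wg: "weak_greedy S k ev \<beta> \<gamma> f x" and g0: "\<gamma> > 0" and n: "n \<ge> 1"
    and q: "(\<Prod>i<n. P (x ` {1..n + 1 + i}) (x (n + 1 + i + 1))) \<le> q ^ n"
    and R: "R = norm (f - I (x ` {1..n + 1}) f)"
    and F0: "\<And>a p. 0 \<le> a \<Longrightarrow> 0 < p \<Longrightarrow> 0 \<le> F a p"
    and F: "\<And>u Q a p. 0 \<le> u \<Longrightarrow> u \<le> R * Q \<Longrightarrow> 0 < Q \<Longrightarrow> Q \<le> 1 \<Longrightarrow> 0 \<le> a \<Longrightarrow> 0 < p \<Longrightarrow>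
            \<gamma> * greedy_value \<beta> u Q \<le> greedy_value \<beta> (a * p) p \<Longrightarrow> u \<le> F a p"
    and T: "\<And>a p. (\<And>i. 0 \<le> a i) \<Longrightarrow> (\<And>i. 0 < p i) \<Longrightarrow> (\<Prod>i<n. a i) \<le> (R / sqrt n) ^ n \<Longrightarrow>
            (\<Prod>i<n. p i) \<le> q ^ n \<Longrightarrow> (\<Prod>i<n. F (a i) (p i)) \<le> T ^ n" and "T \<ge> 0"
  shows "(MIN i\<in>{n + 1..2 * n}. sup_norm S (ev (f - I (x ` {1..i}) f))) \<le> ennreal T"
proof -
  define X where "X i = x ` {1..i}" for i
  have x_in: "x (i + 1) \<in> S - X i" for i
    using wg by (auto simp: weak_greedy_def Let_def X_def)
  have X: "finite (X i)" "X i \<subseteq> S" for i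
  proof -
    have "x j \<in> S" if "j \<ge> 1" for j using x_in[of "j - 1"] that by simp
    then show "finite (X i)" "X i \<subseteq> S" by (auto simp: X_def)
  qed
  have Xmono: "X i \<subseteq> X j" if "i \<le> j" for i j using that by (auto simp: X_def)
  define r where "r i z = \<bar>ev (f - I (X i) f) z\<bar>" for i z
  have P_pos: "P (X i) z > 0" if "z \<in> S - X i" for i z
    using power_fun_pos[OF spd X that] .
  have P_le_1: "P (X i) z \<le> 1" if "z \<in> S" for i z
    using power_fun_le[OF X that, of i] k1[OF that] order_trans real_sqrt_le_1_iff by blast
  define p where "p i = P (X i) (x (i + 1))" for i
  have p_pos: "p i > 0" for i unfolding p_def using P_pos x_in by blast
  define a where "a i = r i (x (i + 1)) / p i" for i
  have a_nonneg: "a i \<ge> 0" for i using p_pos[of i] by (simp add: a_def r_def)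
  have r_eq: "r i (x (i + 1)) = a i * p i" for i using p_pos[of i] by (simp add: a_def)
  have norm_le_R: "norm (f - I (X i) f) \<le> R" if "i \<ge> n + 1" for i
    by (rule power2_le_imp_le)
      (use residual_diff_interpolant[OF X Xmono[OF that], of f] in \<open>simp_all add: R X_def\<close>)
  \<comment> \<open>The energy drops of \<open>residual_step\<close> telescope; the window starts at
    \<open>n + 1\<close>, so the leading term is the square of \<open>R\<close>.\<close>
  have "(\<Sum>i\<in>{n + 1..2 * n}. (a i)\<^sup>2) \<le> R\<^sup>2"
  proof -
    define N where "N i = (norm (f - I (X i) f))\<^sup>2" for i
    have ins: "X (Suc i) = insert (x (i + 1)) (X i)" for i by (auto simp: atLeastAtMostSuc_conv X_def)
    have "(a i)\<^sup>2 \<le> N i - N (Suc i)" for i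
      using residual_step[OF X[of i], of "x (i + 1)" f] x_in[of i] unfolding N_def ins a_def r_def p_def
      by (simp add: power_divide)
    then have "(\<Sum>i\<in>{n + 1..2 * n}. (a i)\<^sup>2) \<le> (\<Sum>i\<in>{n + 1..2 * n}. N i - N (Suc i))" by (rule sum_mono)
    also have "\<dots> = N (n + 1) - N (Suc (2 * n))"
      using sum_Suc_diff[of "n + 1" "2 * n" "\<lambda>i. - N i"] n by simp
    also have "\<dots> \<le> R\<^sup>2" by (simp add: N_def R X_def)
    finally show ?thesis .
  qed
  moreover have bij: "bij_betw (\<lambda>i. n + 1 + i) {..<n} {n + 1..2 * n}"
    by (rule bij_betw_byWitness[where f' = "\<lambda>i. i - (n + 1)"]) auto
  ultimately have "(\<Sum>i<n. (a (n + 1 + i))\<^sup>2) \<le> R\<^sup>2"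
    using sum.reindex_bij_betw[OF bij, of "\<lambda>i. (a i)\<^sup>2"] by simp
  then have prod_a: "(\<Prod>i<n. a (n + 1 + i)) \<le> (R / sqrt n) ^ n"
    using prod_le_power_sum_squares[of "{..<n}" "\<lambda>i. a (n + 1 + i)" R] a_nonneg n
    by (auto simp: lessThan_empty_iff R)
  have prod_p: "(\<Prod>i<n. p (n + 1 + i)) \<le> q ^ n" using q by (simp add: p_def X_def)
  have "(\<Prod>i<n. F (a (n + 1 + i)) (p (n + 1 + i))) \<le> T ^ card {..<n}"
    using T[OF _ _ prod_a prod_p] a_nonneg p_pos by simp
  from ex_le_of_prod_le[OF _ _ this \<open>T \<ge> 0\<close>] obtain j where j: "j < n" "F (a (n + 1 + j)) (p (n + 1 + j)) \<le> T"
    using n by (auto simp: lessThan_empty_iff)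
  define i where "i = n + 1 + j"
  have i: "i \<in> {n + 1..2 * n}" "F (a i) (p i) \<le> T" using j by (auto simp: i_def)
  have eta: "greedy_eta S k ev \<beta> f (X i) z = greedy_value \<beta> (r i z) (P (X i) z)" for z
    by (simp add: greedy_eta_def greedy_value_def Let_def r_def)
  have "greedy_value \<beta> (r i (x (i + 1))) (p i) \<ge> 0"
    using p_pos[of i] by (auto simp: greedy_value_def r_def intro!: mult_nonneg_nonneg rpow_nonneg)
  then have step: "\<gamma> * greedy_value \<beta> (r i z) (P (X i) z) \<le> greedy_value \<beta> (a i * p i) (p i)" if "z \<in> S - X i" for z
    using weak_greedy_step[OF wg g0 that[unfolded X_def], folded X_def] unfolding eta r_eq[symmetric]
    by (simp add: p_def)
  \<comment> \<open>The selection rule says nothing about points already chosen, but the residual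
    vanishes there.\<close>
  have "r i z \<le> T" if "z \<in> S" for z
  proof (cases "z \<in> X i")
    case True
    then show ?thesis using ev_residual_eq_0[OF X True, of f] \<open>T \<ge> 0\<close> by (simp add: r_def)
  next
    case False
    then have z: "z \<in> S - X i" using that by auto
    have "r i z \<le> norm (f - I (X i) f) * P (X i) z"
      using ev_residual_le[OF X that] by (simp add: r_def)
    also have "\<dots> \<le> R * P (X i) z"
      using norm_le_R[of i] i P_pos[OF z] by (intro mult_right_mono) auto
    finally have "r i z \<le> F (a i) (p i)"
      using P_pos[OF z] P_le_1[OF that] p_pos a_nonneg step[OF z]
      by (intro F) (simp_all add: r_def)
    then show ?thesis using i by simp
  qed
  then have "sup_norm S (ev (f - I (X i) f)) \<le> ennreal T"
    by (intro sup_norm_leI) (simp add: r_def)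
  moreover have "(MIN i\<in>{n + 1..2 * n}. sup_norm S (ev (f - I (X i) f))) \<le> sup_norm S (ev (f - I (X i) f))"
    using i by (intro Min_le) auto
  ultimately show ?thesis unfolding X_def by (rule order_trans[rotated])
qed

text \<open>The power function carries the exponent \<open>1 - \<beta>\<close>, whose sign decides
  the argument: for \<open>\<beta> <= 1\<close> it is compensated by \<open>u <= R * Q\<close>, for
  larger \<beta> by \<open>Q <= 1\<close>. In the application \<open>t\<close> is
  \<open>s / d\<close>.\<close>

lemma weak_greedy_min_bound:
  assumes spd: "strictly_pd_kernel S k" and k1: "\<And>z. z \<in> S \<Longrightarrow> k z z \<le> 1"
    and wg: "weak_greedy S k ev \<beta> \<gamma> f x" and g0: "\<gamma> > 0" and g1: "\<gamma> \<le> 1" and n: "n \<ge> 1" and C: "C > 0"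
    and ent: "entropy_number n (closed_abs_hull (K ` S)) \<le> ennreal (C * real n powr (- t - 1 / 2))"
  shows "(MIN i\<in>{n + 1..2 * n}. sup_norm S (ev (f - I (x ` {1..i}) f)))
             \<le> ennreal
                 ((if \<beta> = \<infinity> then 1 else (C * sqrt 5) powr (1 / max 1 (enn2real \<beta>))) *
                  inverse \<gamma> *
                  (if \<beta> = \<infinity> then real n powr (- 1 / 2)
                   else (real n powr (- t - enn2real \<beta> / 2)) powr (1 / max 1 (enn2real \<beta>))) *
                  norm (f - I (x ` {1..n + 1}) f))"
    (is "_ \<le> ennreal ?T")
proof -
  define R where "R = norm (f - I (x ` {1..n + 1}) f)"
  \<comment> \<open>Bound for the geometric mean of the power function values:
    \<open>sqrt (5 * n)\<close> removes the \<open>- 1 / 2\<close> from the exponent of the entropy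
    bound.\<close>
  define q where "q = C * sqrt 5 * real n powr (- t)"
  define b where "b = enn2real \<beta>"
  have R0: "R \<ge> 0" by (simp add: R_def)
  have q0: "q > 0" using C n by (simp add: q_def)
  have sqrt_n: "sqrt n = real n powr (1 / 2)" using n by (simp add: powr_half_sqrt)
  have "real n powr (- 1 / 2) = inverse (real n powr (1 / 2))"
    by (simp add: powr_minus[symmetric])
  then have R_sqrt: "R / sqrt n = R * real n powr (- 1 / 2)"
    by (simp only: divide_inverse sqrt_n)
  have "real n powr (1 / 2) * real n powr (- t - 1 / 2) = real n powr (- t)"
    by (simp flip: powr_add)
  moreover have "sqrt (5 * real n) = sqrt 5 * real n powr (1 / 2)"
    by (simp only: real_sqrt_mult sqrt_n)
  ultimately have q: "sqrt (5 * real n) * (C * real n powr (- t - 1 / 2)) = q"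
    by (simp only: q_def mult.assoc mult.left_commute)
  have xin: "x (i + 1) \<in> S - x ` {1..i}" for i using wg by (auto simp: weak_greedy_def Let_def)
  have prod_le: "(\<Prod>i<n. P (x ` {1..n + 1 + i}) (x (n + 1 + i + 1))) \<le> q ^ n"
    using prod_power_fun_le[OF spd xin ent, of "n + 1"] C n unfolding q by simp
  note MIN_le = weak_greedy_MIN_le[OF spd k1 wg g0 n prod_le R_def]
  consider "\<beta> = \<infinity>" | "\<beta> \<noteq> \<infinity>" "0 \<le> b" "b \<le> 1" | "\<beta> \<noteq> \<infinity>" "b > 1"
    unfolding b_def by (cases "\<beta> = \<infinity>"; cases "enn2real \<beta> \<le> 1") (auto simp: enn2real_nonneg)
  then show ?thesis
  proof cases
    case 1
    define F where "F a (p::real) = inverse \<gamma> * a" for a p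
    have "?T = inverse \<gamma> * (R * real n powr (- 1 / 2))" using 1 by (simp add: R_def)
    then have T: "?T = inverse \<gamma> * (R / sqrt n)" by (simp only: R_sqrt)
    show ?thesis unfolding T
    proof (rule MIN_le[of F])
      fix u Q a p :: real
      assume *: "0 \<le> u" "u \<le> R * Q" "0 < Q" "Q \<le> 1" "0 \<le> a" "0 < p"
        "\<gamma> * greedy_value \<beta> u Q \<le> greedy_value \<beta> (a * p) p"
      then have "\<gamma> * (u / Q) \<le> a" by (simp add: greedy_value_def 1)
      then have "u \<le> inverse \<gamma> * a * Q" using * g0 by (simp add: field_simps)
      also have "\<dots> \<le> inverse \<gamma> * a * 1" using * g0 by (intro mult_left_mono) auto
      finally show "u \<le> F a p" by (simp add: F_def)
    next
      fix a p :: "nat \<Rightarrow> real" assume "(\<Prod>i<n. a i) \<le> (R / sqrt n) ^ n"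
      then show "(\<Prod>i<n. F (a i) (p i)) \<le> (inverse \<gamma> * (R / sqrt n)) ^ n"
        using g0 unfolding F_def prod.distrib prod_constant card_lessThan power_mult_distrib
        by (intro mult_left_mono) auto
    qed (use g0 R0 in \<open>auto simp: F_def\<close>)
  next
    case 2
    \<comment> \<open>Split \<open>u\<close> into its powers with exponents \<open>b\<close> and
      \<open>1 - b\<close> and estimate only the second by \<open>R * Q\<close>: the result is a
      power of \<open>R\<close> times exactly the greedy value. At the selected point the two powers
      of \<open>p\<close> combine to \<open>p\<close> itself.\<close>
    define F where "F a p = inverse \<gamma> * rpow R (1 - b) * (rpow a b * p)" for a p
    have "rpow (R / sqrt n) b = rpow R b * real n powr (- b / 2)"
      unfolding R_sqrt using R0 n by (subst rpow_mult) (auto simp: rpow_def powr_powr)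
    then have "inverse \<gamma> * rpow R (1 - b) * (rpow (R / sqrt n) b * q) =
       C * sqrt 5 * inverse \<gamma> * (rpow R b * rpow R (1 - b)) * (real n powr (- t) * real n powr (- b / 2))"
      by (simp add: q_def mult_ac)
    also have "rpow R b * rpow R (1 - b) = R" using R0 2 by (intro rpow_split)
    also have "real n powr (- t) * real n powr (- b / 2) = real n powr (- t - b / 2)"
      by (simp add: powr_add[symmetric])
    finally have T: "?T = inverse \<gamma> * rpow R (1 - b) * (rpow (R / sqrt n) b * q)"
      unfolding R_def[symmetric] b_def[symmetric] using 2 C n by (auto simp: max_absorb1 mult_ac)
    show ?thesis unfolding T
    proof (rule MIN_le[of F])
      fix u Q a p :: real
      assume *: "0 \<le> u" "u \<le> R * Q" "0 < Q" "Q \<le> 1" "0 \<le> a" "0 < p"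
        "\<gamma> * greedy_value \<beta> u Q \<le> greedy_value \<beta> (a * p) p"
      have "rpow u (1 - b) \<le> rpow (R * Q) (1 - b)" using * 2 by (intro rpow_mono) auto
      also have "\<dots> = rpow R (1 - b) * rpow Q (1 - b)"
        using R0 * by (intro rpow_mult) auto
      finally have "rpow u b * rpow u (1 - b) \<le> rpow u b * (rpow R (1 - b) * rpow Q (1 - b))"
        using * by (intro mult_left_mono rpow_nonneg) auto
      moreover have "rpow u b * rpow u (1 - b) = u" using * 2 by (intro rpow_split)
      ultimately have "u \<le> rpow u b * (rpow R (1 - b) * rpow Q (1 - b))" by simp
      also have "rpow u b * (rpow R (1 - b) * rpow Q (1 - b)) = rpow R (1 - b) * (rpow u b * rpow Q (1 - b))"
        by simp
      also have "rpow u b * rpow Q (1 - b) = greedy_value \<beta> u Q"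
        using 2 by (simp add: greedy_value_def b_def)
      also have "rpow R (1 - b) * greedy_value \<beta> u Q \<le> rpow R (1 - b) * (inverse \<gamma> * greedy_value \<beta> (a * p) p)"
        using *(7) g0 R0 by (intro mult_left_mono rpow_nonneg) (auto simp: field_simps)
      also have "greedy_value \<beta> (a * p) p = rpow a b * (rpow p b * rpow p (1 - b))"
        using 2 * by (simp add: greedy_value_def b_def rpow_mult)
      also have "rpow p b * rpow p (1 - b) = p" using * 2 by (intro rpow_split) auto
      finally show "u \<le> F a p" by (simp add: F_def mult_ac)
    next
      fix a p :: "nat \<Rightarrow> real"
      assume *: "\<And>i. 0 \<le> a i" "\<And>i. 0 < p i" "(\<Prod>i<n. a i) \<le> (R / sqrt n) ^ n" "(\<Prod>i<n. p i) \<le> q ^ n"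
      have "(\<Prod>i<n. rpow (a i) b) = rpow (\<Prod>i<n. a i) b"
        using * by (intro rpow_prod[symmetric]) auto
      also have "\<dots> \<le> rpow ((R / sqrt n) ^ n) b" using * 2 by (intro rpow_mono prod_nonneg) auto
      also have "\<dots> = rpow (R / sqrt n) b ^ n" using R0 by (intro rpow_power) auto
      finally have "(\<Prod>i<n. rpow (a i) b) * (\<Prod>i<n. p i) \<le> rpow (R / sqrt n) b ^ n * q ^ n"
        using * R0 by (intro mult_mono prod_nonneg zero_le_power rpow_nonneg) (auto intro: less_imp_le)
      then show "(\<Prod>i<n. F (a i) (p i)) \<le> (inverse \<gamma> * rpow R (1 - b) * (rpow (R / sqrt n) b * q)) ^ n"
        using g0 R0 unfolding F_def prod.distrib prod_constant card_lessThan power_mult_distrib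
        by (intro mult_left_mono mult_nonneg_nonneg zero_le_power rpow_nonneg) auto
    qed (use g0 R0 q0 in \<open>auto simp: F_def intro!: mult_nonneg_nonneg rpow_nonneg\<close>)
  next
    case 3
    \<comment> \<open>Now \<open>Q powr (1 - b) >= 1\<close>, so \<open>u powr b\<close> is at most
      the greedy value at the competing point, and a \<open>b\<close>-th root is taken. The root of
      \<open>inverse \<gamma>\<close> is enlarged to \<open>inverse \<gamma>\<close> since
      \<open>\<gamma> <= 1\<close>.\<close>
    define F where "F a p = inverse \<gamma> * (a * p powr (1 / b))" for a p
    have gb: "inverse \<gamma> powr (1 / b) \<le> inverse \<gamma>"
      using g0 g1 3 powr_mono[of "1 / b" 1 "inverse \<gamma>"] by (simp add: one_le_inverse)
    have "q powr (1 / b) = (C * sqrt 5) powr (1 / b) * real n powr (- t / b)"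
      using C by (simp add: q_def powr_mult powr_powr)
    then have "inverse \<gamma> * (R / sqrt n * q powr (1 / b)) =
       (C * sqrt 5) powr (1 / b) * inverse \<gamma> * (real n powr (- t / b) * real n powr (- 1 / 2)) * R"
      unfolding R_sqrt by (simp add: mult_ac)
    also have "real n powr (- t / b) * real n powr (- 1 / 2) = (real n powr (- t - b / 2)) powr (1 / b)"
      using 3 by (simp add: powr_add[symmetric] powr_powr field_simps)
    finally have T: "?T = inverse \<gamma> * (R / sqrt n * q powr (1 / b))"
      unfolding R_def[symmetric] b_def[symmetric] using 3 by (simp add: max_absorb2 mult_ac)
    show ?thesis unfolding T
    proof (rule MIN_le[of F])
      fix u Q a p :: real
      assume *: "0 \<le> u" "u \<le> R * Q" "0 < Q" "Q \<le> 1" "0 \<le> a" "0 < p"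
        "\<gamma> * greedy_value \<beta> u Q \<le> greedy_value \<beta> (a * p) p"
      have g: "greedy_value \<beta> u Q = u powr b * Q powr (1 - b)" for u Q
        unfolding greedy_value_def b_def[symmetric] rpow_def using 3 by simp
      have "u powr b = u powr b * (Q powr (1 - b) * Q powr (b - 1))"
        using * by (simp add: powr_add[symmetric])
      also have "\<dots> = greedy_value \<beta> u Q * Q powr (b - 1)" by (simp add: g)
      also have "\<dots> \<le> greedy_value \<beta> u Q * 1"
        using * 3 unfolding g by (intro mult_left_mono powr_le1) auto
      also have "\<dots> \<le> inverse \<gamma> * greedy_value \<beta> (a * p) p"
        using *(7) g0 by (simp add: field_simps)
      also have "greedy_value \<beta> (a * p) p = a powr b * (p powr b * p powr (1 - b))"
        using * by (simp add: g powr_mult)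
      also have "p powr b * p powr (1 - b) = p" using * by (simp add: powr_add[symmetric])
      finally have "(u powr b) powr (1 / b) \<le> (inverse \<gamma> * (a powr b * p)) powr (1 / b)"
        using 3 by (intro powr_mono2) auto
      also have "(u powr b) powr (1 / b) = u" using 3 * by (simp add: powr_powr)
      also have "(inverse \<gamma> * (a powr b * p)) powr (1 / b) = inverse \<gamma> powr (1 / b) * (a * p powr (1 / b))"
        using g0 * 3 by (simp add: powr_mult powr_powr)
      also have "\<dots> \<le> F a p"
        unfolding F_def using gb * by (intro mult_right_mono) auto
      finally show "u \<le> F a p" .
    next
      fix a p :: "nat \<Rightarrow> real"
      assume *: "\<And>i. 0 \<le> a i" "\<And>i. 0 < p i" "(\<Prod>i<n. a i) \<le> (R / sqrt n) ^ n" "(\<Prod>i<n. p i) \<le> q ^ n"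
      have "(\<Prod>i<n. p i powr (1 / b)) = (\<Prod>i<n. p i) powr (1 / b)"
        using *(2) by (simp add: prod_powr_distrib less_imp_le)
      also have "\<dots> \<le> (q ^ n) powr (1 / b)"
        using * 3 by (intro powr_mono2 prod_nonneg) (auto intro: less_imp_le)
      also have "\<dots> = (q powr (1 / b)) ^ n"
        using q0 by (simp add: powr_realpow[symmetric] powr_powr mult.commute)
      finally have "(\<Prod>i<n. a i) * (\<Prod>i<n. p i powr (1 / b)) \<le> (R / sqrt n) ^ n * (q powr (1 / b)) ^ n"
        using * R0 by (intro mult_mono prod_nonneg) auto
      then show "(\<Prod>i<n. F (a i) (p i)) \<le> (inverse \<gamma> * (R / sqrt n * q powr (1 / b))) ^ n"
        using g0 unfolding F_def prod.distrib prod_constant card_lessThan power_mult_distrib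
        by (intro mult_left_mono) auto
    qed (use g0 R0 q0 in \<open>auto simp: F_def\<close>)
  qed
qed

end

section \<open>Entropy numbers of multilevel hulls\<close>

text \<open>The number of balls is arbitrary rather than a power of two: covering numbers multiply
  under addition of sets, and bits are counted only at the end.\<close>

definition coverable :: "'h::metric_space set \<Rightarrow> nat \<Rightarrow> real \<Rightarrow> bool" where
  "coverable A N r \<longleftrightarrow> (\<exists>Z. finite Z \<and> card Z \<le> N \<and> A \<subseteq> (\<Union>z\<in>Z. cball z r))"

lemma coverableI: "finite Z \<Longrightarrow> card Z \<le> N \<Longrightarrow> A \<subseteq> (\<Union>z\<in>Z. cball z r) \<Longrightarrow> coverable A N r"
  unfolding coverable_def by blast

lemma coverableE:
  assumes "coverable A N r"
  obtains Z where "finite Z" "card Z \<le> N" "A \<subseteq> (\<Union>z\<in>Z. cball z r)"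
  using assms unfolding coverable_def by blast

lemma coverable_mono:
  assumes "coverable A N r" "B \<subseteq> A" "N \<le> M" "r \<le> s"
  shows "coverable B M s"
proof -
  obtain Z where Z: "finite Z" "card Z \<le> N" "A \<subseteq> (\<Union>z\<in>Z. cball z r)"
    using assms(1) unfolding coverable_def by blast
  have "B \<subseteq> (\<Union>z\<in>Z. cball z s)"
    using subset_cball[OF assms(4)] by (rule order_trans[OF order_trans[OF assms(2) Z(3)] UN_mono[OF order_refl]])
  then show ?thesis using Z assms(3) by (intro coverableI[of Z]) auto
qed

lemma coverable_closure:
  assumes "coverable A N r" shows "coverable (closure A) N r"
proof -
  obtain Z where Z: "finite Z" "card Z \<le> N" "A \<subseteq> (\<Union>z\<in>Z. cball z r)"
    using assms unfolding coverable_def by blast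
  have "closure A \<subseteq> (\<Union>z\<in>Z. cball z r)"
    using Z by (intro closure_minimal closed_UN) auto
  then show ?thesis using Z unfolding coverable_def by blast
qed

lemma coverable_add:
  fixes A B :: "'h::real_normed_vector set"
  assumes "coverable A N r" "coverable B M s" "\<And>f. f \<in> C \<Longrightarrow> \<exists>a\<in>A. \<exists>b\<in>B. f = a + b"
  shows "coverable C (N * M) (r + s)"
proof -
  obtain Z where Z: "finite Z" "card Z \<le> N" "A \<subseteq> (\<Union>z\<in>Z. cball z r)"
    using assms(1) unfolding coverable_def by blast
  obtain Y where Y: "finite Y" "card Y \<le> M" "B \<subseteq> (\<Union>y\<in>Y. cball y s)"
    using assms(2) unfolding coverable_def by blast
  let ?W = "(\<lambda>(z, y). z + y) ` (Z \<times> Y)"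
  have "card ?W \<le> card (Z \<times> Y)" using Z Y by (intro card_image_le) auto
  also have "\<dots> \<le> N * M" using Z Y by (simp add: card_cartesian_product mult_le_mono)
  finally have 1: "card ?W \<le> N * M" .
  have "C \<subseteq> (\<Union>w\<in>?W. cball w (r + s))"
  proof
    fix f assume "f \<in> C"
    then obtain a b where ab: "a \<in> A" "b \<in> B" "f = a + b" using assms(3) by blast
    obtain z y where zy: "z \<in> Z" "dist z a \<le> r" "y \<in> Y" "dist y b \<le> s"
      using subsetD[OF Z(3) ab(1)] subsetD[OF Y(3) ab(2)] by auto
    have "dist (z + y) f \<le> dist z a + dist y b" unfolding ab(3) by (rule dist_triangle_add)
    then show "f \<in> (\<Union>w\<in>?W. cball w (r + s))"
      using zy by (intro UN_I[of "z + y"]) auto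
  qed
  then show ?thesis using Z Y 1 unfolding coverable_def by (intro exI[of _ ?W]) auto
qed

lemma entropy_number_le:
  assumes "coverable A N r" "N \<le> 2 ^ n" "r > 0"
  shows "entropy_number n A \<le> ennreal r"
proof -
  obtain Z where "finite Z" "card Z \<le> N" "A \<subseteq> (\<Union>z\<in>Z. cball z r)"
    using assms(1) by (rule coverableE)
  then have "finite Z \<and> card Z \<le> 2 ^ n \<and> A \<subseteq> (\<Union>z\<in>Z. cball z r)"
    using assms(2) by linarith
  then show ?thesis using assms(3) unfolding entropy_number_def
    by (intro Inf_lower CollectI exI[of _ r]) blast
qed

text \<open>
  Maurey's lemma, derandomised: appending a vector \<open>w i\<close> with \<open>r \<bullet> (w i - f) \<le> 0\<close>, where \<open>r\<close> is
  the current error, increases the squared error by at most \<open>4\<close>.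
\<close>

lemma maurey_approximation:
  fixes w :: "nat \<Rightarrow> 'h::real_inner"
  assumes w: "\<And>i. i < N \<Longrightarrow> norm (w i) \<le> 1"
    and l: "\<And>i. i < N \<Longrightarrow> 0 \<le> l i" "(\<Sum>i<N. l i) = 1"
    and f: "f = (\<Sum>i<N. l i *\<^sub>R w i)"
  shows "\<exists>t::nat \<Rightarrow> nat. (\<Sum>i<N. t i) = m \<and> (norm ((\<Sum>i<N. real (t i) *\<^sub>R w i) - real m *\<^sub>R f))\<^sup>2 \<le> 4 * m"
proof (induction m)
  case 0
  show ?case by (intro exI[of _ "\<lambda>_. 0"]) auto
next
  case (Suc m)
  then obtain t :: "nat \<Rightarrow> nat" where t: "(\<Sum>i<N. t i) = m"
    "(norm ((\<Sum>i<N. real (t i) *\<^sub>R w i) - real m *\<^sub>R f))\<^sup>2 \<le> 4 * m" by blast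
  define r where "r = (\<Sum>i<N. real (t i) *\<^sub>R w i) - real m *\<^sub>R f"
  have "norm f \<le> (\<Sum>i<N. norm (l i *\<^sub>R w i))" unfolding f by (rule norm_sum)
  also have "\<dots> \<le> (\<Sum>i<N. l i)"
    using w l by (intro sum_mono) (simp add: mult_left_le)
  finally have nf: "norm f \<le> 1" using l by simp
  \<comment> \<open>With the weights \<open>l i\<close> the average of these inner products is 0,
    because \<open>f\<close> is the average of the \<open>w i\<close>; so they cannot all be
    positive.\<close>
  have "\<exists>j<N. r \<bullet> (w j - f) \<le> 0"
  proof (rule ccontr)
    assume "\<not> ?thesis"
    then have pos: "\<And>j. j < N \<Longrightarrow> r \<bullet> (w j - f) > 0" by force
    have "(\<Sum>i<N. l i * (r \<bullet> (w i - f))) = r \<bullet> f - (\<Sum>i<N. l i) * (r \<bullet> f)"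
      by (subst (2) f) (simp add: inner_diff_right inner_sum_right algebra_simps sum_subtractf sum_distrib_left)
    then have "(\<Sum>i<N. l i * (r \<bullet> (w i - f))) = 0" using l by simp
    then have "\<forall>i<N. l i * (r \<bullet> (w i - f)) = 0"
      using l pos by (subst (asm) sum_nonneg_eq_0_iff) (auto intro!: mult_nonneg_nonneg intro: less_imp_le)
    then have "\<forall>i<N. l i = 0" using pos by fastforce
    then show False using l by simp
  qed
  then obtain j where j: "j < N" "r \<bullet> (w j - f) \<le> 0" by blast
  define t' where "t' = t(j := Suc (t j))"
  have "(\<Sum>i<N. t' i) = (\<Sum>i<N. t i + (if i = j then 1 else 0))"
    by (intro sum.cong) (auto simp: t'_def)
  then have 1: "(\<Sum>i<N. t' i) = Suc m" using t j by (simp add: sum.distrib)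
  have "(\<Sum>i<N. real (t' i) *\<^sub>R w i) = (\<Sum>i<N. real (t i) *\<^sub>R w i + (if i = j then w i else 0))"
    by (intro sum.cong) (auto simp: t'_def algebra_simps)
  also have "\<dots> = (\<Sum>i<N. real (t i) *\<^sub>R w i) + w j" using j by (simp add: sum.distrib)
  finally have 2: "(\<Sum>i<N. real (t' i) *\<^sub>R w i) - real (Suc m) *\<^sub>R f = r + (w j - f)"
    by (simp add: r_def algebra_simps)
  have "norm (w j - f) \<le> 2" using norm_triangle_ineq4[of "w j" f] w[OF j(1)] nf by linarith
  then have 4: "(norm (w j - f))\<^sup>2 \<le> 4" using power_mono[of "norm (w j - f)" 2 2] by simp
  have "(norm (r + (w j - f)))\<^sup>2 = (norm r)\<^sup>2 + 2 * (r \<bullet> (w j - f)) + (norm (w j - f))\<^sup>2"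
    by (simp add: power2_norm_eq_inner inner_add_left inner_add_right inner_commute[of "w j - f" r])
  also have "\<dots> \<le> 4 * m + 0 + 4" using t(2) j(2) 4 by (simp add: r_def)
  finally show ?case using 1 2 by (intro exI[of _ t']) auto
qed

text \<open>The centers are averages of \<open>m\<close> of the vectors, repetition allowed.
  Multisets of size \<open>m\<close> from \<open>M + 1\<close> vectors are counted by the binomial
  coefficient, and a squared error \<open>4 * m\<close> of the sum is an error
  \<open>2 / sqrt m\<close> of the average.\<close>

lemma coverable_convex:
  fixes w :: "nat \<Rightarrow> 'h::real_inner"
  assumes w: "\<And>i. i < Suc M \<Longrightarrow> norm (w i) \<le> 1" and m: "m \<ge> 1"
  shows "coverable {(\<Sum>i<Suc M. l i *\<^sub>R w i) |l. (\<forall>i<Suc M. 0 \<le> l i) \<and> (\<Sum>i<Suc M. l i) = 1}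
           ((m + M) choose m) (2 / sqrt m)"
proof -
  let ?L = "{t::nat list. length t = Suc M \<and> sum_list t = m}"
  let ?c = "\<lambda>t::nat list. (1 / m) *\<^sub>R (\<Sum>i<Suc M. real (t ! i) *\<^sub>R w i)"
  have fin: "finite ?L"
  proof (rule finite_subset)
    show "?L \<subseteq> {t. set t \<subseteq> {..m} \<and> length t = Suc M}" using member_le_sum_list by fastforce
  qed (rule finite_lists_length_eq, simp)
  have "card (?c ` ?L) \<le> card ?L" by (rule card_image_le[OF fin])
  then have 1: "card (?c ` ?L) \<le> (m + M) choose m"
    using card_length_sum_list[of "Suc M" m] by simp
  have "\<exists>z\<in>?c ` ?L. dist z f \<le> 2 / sqrt m"
    if l: "\<forall>i<Suc M. 0 \<le> l i" "(\<Sum>i<Suc M. l i) = 1" and f: "f = (\<Sum>i<Suc M. l i *\<^sub>R w i)" for f l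
  proof -
    obtain t :: "nat \<Rightarrow> nat" where t: "(\<Sum>i<Suc M. t i) = m"
      "(norm ((\<Sum>i<Suc M. real (t i) *\<^sub>R w i) - real m *\<^sub>R f))\<^sup>2 \<le> 4 * m"
      using maurey_approximation[OF w _ l(2) f] l(1) by blast
    define t' where "t' = map t [0..<Suc M]"
    have t'i: "t' ! i = t i" if "i < Suc M" for i using that by (simp add: t'_def del: upt_Suc)
    have "sum_list t' = (\<Sum>i<Suc M. t i)"
      unfolding t'_def by (subst interv_sum_list_conv_sum_set_nat) (simp add: atLeast0LessThan)
    then have t'L: "t' \<in> ?L" using t by (simp add: t'_def)
    have c: "?c t' - f = (1 / m) *\<^sub>R ((\<Sum>i<Suc M. real (t i) *\<^sub>R w i) - real m *\<^sub>R f)"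
      using m t'i by (simp add: scaleR_diff_right del: sum.lessThan_Suc)
    have "(norm (?c t' - f))\<^sup>2 = (1 / m)\<^sup>2 * (norm ((\<Sum>i<Suc M. real (t i) *\<^sub>R w i) - real m *\<^sub>R f))\<^sup>2"
      unfolding c by (simp add: power_mult_distrib power_divide)
    also have "\<dots> \<le> (1 / m)\<^sup>2 * (4 * m)" using t(2) by (intro mult_left_mono) auto
    also have "\<dots> = (2 / sqrt m)\<^sup>2" using m by (simp add: power_divide power2_eq_square)
    finally have "norm (?c t' - f) \<le> 2 / sqrt m" by (rule power2_le_imp_le) simp
    then show ?thesis using t'L by (intro bexI[of _ "?c t'"]) (auto simp: dist_norm)
  qed
  then have "{(\<Sum>i<Suc M. l i *\<^sub>R w i) |l. (\<forall>i<Suc M. 0 \<le> l i) \<and> (\<Sum>i<Suc M. l i) = 1}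
               \<subseteq> (\<Union>z\<in>?c ` ?L. cball z (2 / sqrt m))"
    by (simp only: mem_cball subset_iff UN_iff mem_Collect_eq) blast
  then show ?thesis unfolding coverable_def using fin 1 by blast
qed

definition abs_comb :: "nat \<Rightarrow> (nat \<Rightarrow> 'h::real_vector) \<Rightarrow> real \<Rightarrow> 'h set" where
  "abs_comb N e B = {(\<Sum>i<N. c i *\<^sub>R e i) |c. (\<Sum>i<N. \<bar>c i\<bar>) \<le> B}"

text \<open>Signed combinations become convex ones of \<open>2 * N + 1\<close> vectors:
  \<open>e i\<close>, \<open>- e i\<close>, and the zero vector, which takes up the weight that the
  coefficients leave over.\<close>

lemma coverable_abs_comb:
  fixes e :: "nat \<Rightarrow> 'h::real_inner"
  assumes e: "\<And>i. i < N \<Longrightarrow> norm (e i) \<le> 1" and m: "m \<ge> 1" and B: "B > 0"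
  shows "coverable (abs_comb N e B) ((m + 2 * N) choose m) (B * (2 / sqrt m))"
proof -
  define w where "w i = (if i < N then e i else if i < 2 * N then - e (i - N) else 0)" for i
  have w: "norm (w i) \<le> 1" for i using e[of i] e[of "i - N"] by (auto simp: w_def)
  have split: "(\<Sum>i<Suc (2 * N). g i) = (\<Sum>i<N. g i) + (\<Sum>i<N. g (N + i)) + g (2 * N)"
    for g :: "nat \<Rightarrow> 'b::comm_monoid_add"
  proof -
    have "(\<Sum>i<N + M. g i) = (\<Sum>i<N. g i) + (\<Sum>i<M. g (N + i))" for M
      by (induction M) (simp_all add: add.assoc)
    from this[of N] show ?thesis by (simp add: mult_2)
  qed
  obtain Z where Z: "finite Z" "card Z \<le> (m + 2 * N) choose m"
    "{(\<Sum>i<Suc (2*N). l i *\<^sub>R w i) |l. (\<forall>i<Suc (2*N). 0 \<le> l i) \<and> (\<Sum>i<Suc (2*N). l i) = 1}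
       \<subseteq> (\<Union>z\<in>Z. cball z (2 / sqrt m))"
    by (rule coverableE[OF coverable_convex[of "2 * N" w, OF w m]])
  have "\<exists>z\<in>(*\<^sub>R) B ` Z. dist z f \<le> B * (2 / sqrt m)" if f: "f \<in> abs_comb N e B" for f
  proof -
    obtain c where c: "f = (\<Sum>i<N. c i *\<^sub>R e i)" "(\<Sum>i<N. \<bar>c i\<bar>) \<le> B"
      using f unfolding abs_comb_def by blast
    define l where "l i = (if i < N then max (c i) 0 / B else if i < 2 * N then max (- c (i - N)) 0 / B
      else 1 - (\<Sum>i<N. \<bar>c i\<bar>) / B)" for i
    have l0: "0 \<le> l i" for i using c(2) B by (auto simp: l_def)
    have "(\<Sum>i<Suc (2*N). l i) = (\<Sum>i<N. max (c i) 0 / B) + (\<Sum>i<N. max (- c i) 0 / B) + (1 - (\<Sum>i<N. \<bar>c i\<bar>) / B)"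
      unfolding split by (simp add: l_def)
    also have "(\<Sum>i<N. max (c i) 0 / B) + (\<Sum>i<N. max (- c i) 0 / B) = (\<Sum>i<N. \<bar>c i\<bar>) / B"
      unfolding sum.distrib[symmetric] sum_divide_distrib by (intro sum.cong) (auto simp: max_def)
    finally have l1: "(\<Sum>i<Suc (2*N). l i) = 1" by simp
    have "(\<Sum>i<Suc (2*N). l i *\<^sub>R w i) = (\<Sum>i<N. (max (c i) 0 / B) *\<^sub>R e i) + (\<Sum>i<N. (max (- c i) 0 / B) *\<^sub>R (- e i))"
      unfolding split by (simp add: l_def w_def)
    also have "\<dots> = (1 / B) *\<^sub>R f"
      unfolding c(1) scaleR_sum_right sum.distrib[symmetric]
      by (intro sum.cong) (auto simp: max_def)
    finally have l2: "(\<Sum>i<Suc (2*N). l i *\<^sub>R w i) = (1 / B) *\<^sub>R f" .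
    have "(1 / B) *\<^sub>R f \<in> (\<Union>z\<in>Z. cball z (2 / sqrt m))"
      unfolding l2[symmetric] using l0 l1 by (intro subsetD[OF Z(3)]) blast
    then obtain z where z: "z \<in> Z" "dist z ((1 / B) *\<^sub>R f) \<le> 2 / sqrt m" by auto
    have "dist (B *\<^sub>R z) f = dist (B *\<^sub>R z) (B *\<^sub>R ((1 / B) *\<^sub>R f))" using B by simp
    also have "\<dots> = B * dist z ((1 / B) *\<^sub>R f)" using B
      unfolding dist_norm scaleR_diff_right[symmetric] by simp
    also have "\<dots> \<le> B * (2 / sqrt m)" using z B by (intro mult_left_mono) auto
    finally show ?thesis using z by blast
  qed
  moreover have "card ((*\<^sub>R) B ` Z) \<le> (m + 2 * N) choose m"
    using card_image_le[OF Z(1), of "(*\<^sub>R) B"] Z(2) by linarith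
  ultimately show ?thesis unfolding coverable_def using Z(1)
    by (intro exI[of _ "(*\<^sub>R) B ` Z"]) (simp only: finite_imageI mem_cball subset_iff UN_iff, blast)
qed

text \<open>The coefficient is at most \<open>(a + b) ^ b / b!\<close>, and the exponential series
  gives \<open>b ^ b / b! <= exp b\<close>. Enlarging \<open>exp 1\<close> to 4 makes the count a
  power of two, which is the summand 2 next to the logarithm.\<close>

lemma binomial_le_powr:
  assumes "b \<ge> 1"
  shows "real ((a + b) choose b) \<le> 2 powr (real b * (2 + log 2 (1 + real a / real b)))"
proof -
  have "real b ^ b / fact b \<le> exp (real b)"
  proof -
    have *: "(\<lambda>n. real b ^ n /\<^sub>R fact n) sums exp (real b)" by (rule exp_converges)
    have "(\<Sum>n\<in>{b}. real b ^ n /\<^sub>R fact n) \<le> (\<Sum>n. real b ^ n /\<^sub>R fact n)"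
      by (rule sum_le_suminf[OF sums_summable[OF *]]) auto
    also have "\<dots> = exp (real b)" using sums_unique[OF *] by simp
    finally have "(\<Sum>n\<in>{b}. real b ^ n /\<^sub>R fact n) \<le> exp (real b)" .
    then show ?thesis by (simp add: divide_inverse mult.commute)
  qed
  also have "exp (real b) = exp 1 ^ b" by (simp add: exp_of_nat_mult[symmetric])
  also have "\<dots> \<le> (4::real) ^ b"
    using exp_le by (intro power_mono) auto
  finally have 1: "real b ^ b \<le> 4 ^ b * fact b" by (simp add: field_simps)
  have "real ((a + b) choose b) * fact b \<le> real (a + b) ^ b"
    using binomial_fact_pow[of "a + b" b] by (metis of_nat_le_iff of_nat_mult of_nat_fact of_nat_power)
  also have "\<dots> = (1 + real a / real b) ^ b * real b ^ b"
    using assms by (simp add: power_mult_distrib[symmetric] field_simps)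
  also have "\<dots> \<le> (1 + real a / real b) ^ b * (4 ^ b * fact b)"
    using 1 by (intro mult_left_mono) auto
  finally have "real ((a + b) choose b) \<le> (1 + real a / real b) ^ b * 4 ^ b"
    by (simp add: mult.assoc[symmetric])
  also have "\<dots> = (2 powr (2 + log 2 (1 + real a / real b))) ^ b"
  proof -
    have "1 + real a / real b > 0" by (simp add: add_pos_nonneg)
    then have "2 powr (2 + log 2 (1 + real a / real b)) = (1 + real a / real b) * 4"
      by (simp add: powr_add)
    then show ?thesis by (simp only: power_mult_distrib)
  qed
  also have "\<dots> = 2 powr (real b * (2 + log 2 (1 + real a / real b)))"
    by (simp add: powr_realpow[symmetric] powr_powr mult.commute)
  finally show ?thesis .
qed

lemma coverable_sum_abs_comb:
  fixes e :: "nat \<Rightarrow> nat \<Rightarrow> 'h::real_inner"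
  assumes e: "\<And>j i. i < N j \<Longrightarrow> norm (e j i) \<le> 1" and m: "\<And>j. j \<le> J \<Longrightarrow> m j \<ge> 1" and B: "\<And>j. B j > 0"
    and C: "\<And>f. f \<in> C \<Longrightarrow> \<exists>v. (\<forall>j\<le>J. v j \<in> abs_comb (N j) (e j) (B j)) \<and> f = (\<Sum>j\<le>J. v j)"
  shows "coverable C (\<Prod>j\<le>J. (m j + 2 * N j) choose m j) (\<Sum>j\<le>J. B j * (2 / sqrt (m j)))"
  using m C
proof (induction J arbitrary: C)
  case 0
  have "coverable (abs_comb (N 0) (e 0) (B 0)) ((m 0 + 2 * N 0) choose m 0) (B 0 * (2 / sqrt (m 0)))"
    using e 0 B by (intro coverable_abs_comb) auto
  moreover have "C \<subseteq> abs_comb (N 0) (e 0) (B 0)" using 0(2) by fastforce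
  ultimately show ?case using coverable_mono by fastforce
next
  case (Suc J)
  let ?A = "{(\<Sum>j\<le>J. v j) |v. \<forall>j\<le>J. v j \<in> abs_comb (N j) (e j) (B j)}"
  have 1: "coverable ?A (\<Prod>j\<le>J. (m j + 2 * N j) choose m j) (\<Sum>j\<le>J. B j * (2 / sqrt (m j)))"
    by (rule Suc.IH) (use Suc.prems in auto)
  have 2: "coverable (abs_comb (N (Suc J)) (e (Suc J)) (B (Suc J))) ((m (Suc J) + 2 * N (Suc J)) choose m (Suc J))
      (B (Suc J) * (2 / sqrt (m (Suc J))))"
    using e Suc.prems B by (intro coverable_abs_comb) auto
  have "coverable C ((\<Prod>j\<le>J. (m j + 2 * N j) choose m j) * ((m (Suc J) + 2 * N (Suc J)) choose m (Suc J)))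
    ((\<Sum>j\<le>J. B j * (2 / sqrt (m j))) + B (Suc J) * (2 / sqrt (m (Suc J))))"
  proof (rule coverable_add[OF 1 2])
    fix f assume "f \<in> C"
    then obtain v where v: "\<forall>j\<le>Suc J. v j \<in> abs_comb (N j) (e j) (B j)" "f = (\<Sum>j\<le>Suc J. v j)"
      using Suc.prems(2) by blast
    then show "\<exists>a\<in>?A. \<exists>b\<in>abs_comb (N (Suc J)) (e (Suc J)) (B (Suc J)). f = a + b"
      by (intro bexI[of _ "\<Sum>j\<le>J. v j"] bexI[of _ "v (Suc J)"]) auto
  qed
  then show ?case by simp
qed

lemma coverable_singleton_add:
  fixes A :: "'h::real_normed_vector set"
  assumes "coverable A N r" "\<And>f. f \<in> C \<Longrightarrow> \<exists>a\<in>A. norm (f - a) \<le> s"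
  shows "coverable C N (r + s)"
proof -
  have "coverable {f. norm f \<le> s} 1 s"
    by (rule coverableI[of "{0}"]) auto
  from coverable_add[OF assms(1) this] show ?thesis
    using assms(2) by (metis (no_types, lifting) add.commute diff_add_cancel mem_Collect_eq mult.right_neutral)
qed

section \<open>Distribution of bits over the levels\<close>

lemma two_powr_minus: "2 powr (- real i) = (1 / 2) ^ i"
proof -
  have "2 powr (- real i) = inverse (2 ^ i)" by (simp add: powr_minus powr_realpow)
  then show ?thesis by (simp add: power_one_over inverse_eq_divide)
qed

text \<open>
  The hypothesis on \<open>K\<close> is a multilevel expansion: level \<open>j\<close> uses \<open>A 2\<^sup>j\<^sup>D\<close> vectors
  and contributes an amount of order \<open>2\<^sup>-\<^sup>j\<^sup>s\<close>.
\<close>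

locale multilevel =
  fixes K :: "'h::real_inner set" and e :: "nat \<Rightarrow> nat \<Rightarrow> 'h" and A D :: nat and B s :: real
  assumes A: "A \<ge> 1" and D: "D \<ge> 1" and B: "B > 0" and s: "s > 0"
    and e: "\<And>j i. norm (e j i) \<le> 1"
    and expansion: "\<And>g. g \<in> K \<Longrightarrow> \<exists>a::nat \<Rightarrow> nat \<Rightarrow> real.
          (\<forall>j. (\<Sum>i<A * 2 ^ (j * D). \<bar>a j i\<bar>) \<le> B * 2 powr (- (real j * s))) \<and>
          (\<forall>J. norm (g - (\<Sum>j\<le>J. \<Sum>i<A * 2 ^ (j * D). a j i *\<^sub>R e j i)) \<le> B * 2 powr (- (real J * s)))"
begin

definition N :: "nat \<Rightarrow> nat" where "N j = A * 2 ^ (j * D)"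

text \<open>The coefficient and tail bounds are uniform over \<open>K\<close> and survive absolutely
  convex combinations, so every point of the hull has an expansion with the same bounds. The closure
  costs nothing because finitely many closed balls form a closed set.\<close>

lemma coverable_hull:
  fixes m :: "nat \<Rightarrow> nat"
  assumes m: "\<And>j. j \<le> J \<Longrightarrow> m j \<ge> 1"
  shows "coverable (closed_abs_hull K) (\<Prod>j\<le>J. (m j + 2 * N j) choose m j)
     ((\<Sum>j\<le>J. B * 2 powr (- (real j * s)) * (2 / sqrt (m j))) + B * 2 powr (- (real J * s)))"
  unfolding closed_abs_hull_def
proof (rule coverable_closure, rule coverable_singleton_add[OF coverable_sum_abs_comb])
  fix f assume "f \<in> {\<Sum>g\<in>F. c g *\<^sub>R g |F c. finite F \<and> F \<subseteq> K \<and> (\<Sum>g\<in>F. \<bar>c g\<bar>) \<le> 1}"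
  then obtain F c where F: "finite F" "F \<subseteq> K" "(\<Sum>g\<in>F. \<bar>c g\<bar>) \<le> 1" "f = (\<Sum>g\<in>F. c g *\<^sub>R g)" by blast
  have "\<forall>g\<in>F. \<exists>a::nat \<Rightarrow> nat \<Rightarrow> real.
          (\<forall>j. (\<Sum>i<N j. \<bar>a j i\<bar>) \<le> B * 2 powr (- (real j * s))) \<and>
          (\<forall>J. norm (g - (\<Sum>j\<le>J. \<Sum>i<N j. a j i *\<^sub>R e j i)) \<le> B * 2 powr (- (real J * s)))"
    using expansion F(2) unfolding N_def by blast
  from bchoice[OF this] obtain a :: "'h \<Rightarrow> nat \<Rightarrow> nat \<Rightarrow> real" where
    a: "\<And>g j. g \<in> F \<Longrightarrow> (\<Sum>i<N j. \<bar>a g j i\<bar>) \<le> B * 2 powr (- (real j * s))"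
    and tail: "\<And>g J. g \<in> F \<Longrightarrow> norm (g - (\<Sum>j\<le>J. \<Sum>i<N j. a g j i *\<^sub>R e j i)) \<le> B * 2 powr (- (real J * s))"
    by blast
  define b where "b j i = (\<Sum>g\<in>F. c g * a g j i)" for j i
  define v where "v j = (\<Sum>i<N j. b j i *\<^sub>R e j i)" for j
  have v: "v j = (\<Sum>g\<in>F. c g *\<^sub>R (\<Sum>i<N j. a g j i *\<^sub>R e j i))" for j
    unfolding v_def b_def scaleR_sum_left scaleR_sum_right
    by (subst sum.swap) simp
  have "(\<Sum>i<N j. \<bar>b j i\<bar>) \<le> B * 2 powr (- (real j * s))" for j
  proof -
    have "(\<Sum>i<N j. \<bar>b j i\<bar>) \<le> (\<Sum>i<N j. \<Sum>g\<in>F. \<bar>c g\<bar> * \<bar>a g j i\<bar>)"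
      unfolding b_def by (intro sum_mono order_trans[OF sum_abs]) (simp add: abs_mult)
    also have "\<dots> = (\<Sum>g\<in>F. \<bar>c g\<bar> * (\<Sum>i<N j. \<bar>a g j i\<bar>))"
      unfolding sum_distrib_left by (rule sum.swap)
    also have "\<dots> \<le> (\<Sum>g\<in>F. \<bar>c g\<bar> * (B * 2 powr (- (real j * s))))"
      using a by (intro sum_mono mult_left_mono) auto
    also have "\<dots> = (\<Sum>g\<in>F. \<bar>c g\<bar>) * (B * 2 powr (- (real j * s)))" by (simp add: sum_distrib_right)
    also have "\<dots> \<le> 1 * (B * 2 powr (- (real j * s)))" using F B by (intro mult_right_mono) auto
    finally show ?thesis by simp
  qed
  then have vj: "v j \<in> abs_comb (N j) (e j) (B * 2 powr (- (real j * s)))" for j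
    unfolding abs_comb_def v_def by blast
  have "f - (\<Sum>j\<le>J. v j) = (\<Sum>g\<in>F. c g *\<^sub>R (g - (\<Sum>j\<le>J. \<Sum>i<N j. a g j i *\<^sub>R e j i)))"
    unfolding v F(4) scaleR_diff_right sum_subtractf
    by (subst sum.swap) (simp add: scaleR_sum_right)
  also have "norm \<dots> \<le> (\<Sum>g\<in>F. \<bar>c g\<bar> * (B * 2 powr (- (real J * s))))"
    by (intro order_trans[OF norm_sum] sum_mono) (auto intro!: mult_left_mono tail)
  also have "\<dots> = (\<Sum>g\<in>F. \<bar>c g\<bar>) * (B * 2 powr (- (real J * s)))" by (simp add: sum_distrib_right)
  also have "\<dots> \<le> 1 * (B * 2 powr (- (real J * s)))" using F B by (intro mult_right_mono) auto
  finally have "norm (f - (\<Sum>j\<le>J. v j)) \<le> B * 2 powr (- (real J * s))" by simp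
  then show "\<exists>a\<in>{(\<Sum>j\<le>J. v j) |v. \<forall>j\<le>J. v j \<in> abs_comb (N j) (e j) (B * 2 powr (- (real j * s)))}.
       norm (f - a) \<le> B * 2 powr (- (real J * s))"
    using vj by (intro bexI[of _ "\<Sum>j\<le>J. v j"]) auto
qed (use e m B in auto)

text \<open>With truncated subtraction \<open>(j - L) + (L - j)\<close> is the distance from
  \<open>j\<close> to \<open>L\<close>, and every distance is attained on each side of
  \<open>L\<close> at most once.\<close>

lemma sum_le_two_suminf:
  fixes w :: "nat \<Rightarrow> real"
  assumes "summable w" "\<And>i. w i \<ge> 0"
  shows "(\<Sum>j\<le>J. w ((j - L) + (L - j))) \<le> 2 * suminf w"
proof -
  have "(\<Sum>j\<le>J. w ((j - L) + (L - j))) \<le> (\<Sum>j\<in>{..L} \<union> {L<..J}. w ((j - L) + (L - j)))"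
    using assms(2) by (intro sum_mono2) auto
  also have "\<dots> = (\<Sum>j\<in>{..L}. w ((j - L) + (L - j))) + (\<Sum>j\<in>{L<..J}. w ((j - L) + (L - j)))"
    by (rule sum.union_disjoint) auto
  also have "(\<Sum>j\<in>{..L}. w ((j - L) + (L - j))) = sum w ((\<lambda>j. L - j) ` {..L})"
    by (subst sum.reindex) (auto intro!: sum.cong inj_onI)
  also have "\<dots> \<le> suminf w" using assms by (intro sum_le_suminf) auto
  also have "(\<Sum>j\<in>{L<..J}. w ((j - L) + (L - j))) = sum w ((\<lambda>j. j - L) ` {L<..J})"
    by (subst sum.reindex) (auto intro!: sum.cong inj_onI)
  also have "\<dots> \<le> suminf w" using assms by (intro sum_le_suminf) auto
  finally show ?thesis by simp
qed

text \<open>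
  With about \<open>2\<^sup>L\<^sup>D\<close> bits available, level \<open>j\<close> is approximated by averages of \<open>m L j\<close> vectors. The
  exponents are chosen so that both the bits spent and the errors made decay geometrically in
  \<open>\<bar>j - L\<bar>\<close>.
\<close>

definition mu :: "nat \<Rightarrow> nat \<Rightarrow> real" where
  "mu L j = (if j \<le> L then 2 powr (real L * D + 2 * real (L - j) * (s + 1))
             else 2 powr (real L * D - real (j - L) * s))"

definition m :: "nat \<Rightarrow> nat \<Rightarrow> nat" where "m L j = nat \<lceil>mu L j\<rceil>"

text \<open>The tail beyond this level is of the target size
  \<open>2 powr (- L * (s + D / 2))\<close>, up to a constant, while \<open>mu\<close> is still at
  least 1 on all levels up to it.\<close>

definition top_level :: "nat \<Rightarrow> nat" where "top_level L = L + nat \<lfloor>real L * D / (2 * s)\<rfloor>"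

lemma mu_ge_1: "j \<le> top_level L \<Longrightarrow> mu L j \<ge> 1"
proof -
  assume j: "j \<le> top_level L"
  have "real (j - L) * s \<le> real L * D / 2" if "j > L"
  proof -
    have "real (j - L) \<le> real (nat \<lfloor>real L * D / (2 * s)\<rfloor>)"
      using j that unfolding top_level_def by linarith
    also have "\<dots> \<le> real L * D / (2 * s)" using s by simp
    finally show ?thesis using s by (simp add: field_simps)
  qed
  then have "real (j - L) * s \<le> real L * D" if "j > L"
    using that mult_nonneg_nonneg[of "real L" "real D"] by (smt (verit) field_sum_of_halves of_nat_0_le_iff)
  then show ?thesis unfolding mu_def using s by (auto intro!: ge_one_powr_ge_zero add_nonneg_nonneg)
qed

lemma m_bounds: 
  assumes "j \<le> top_level L" 
  shows "mu L j \<le> m L j" "m L j \<le> 2 * mu L j" "m L j \<ge> 1"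
proof -
  have "mu L j \<ge> 1" using assms by (rule mu_ge_1)
  then show "mu L j \<le> m L j" "m L j \<le> 2 * mu L j" "m L j \<ge> 1"
    unfolding m_def by linarith+
qed

lemma N_eq: "real (N j) = real A * 2 powr (real j * D)"
  unfolding N_def by (simp add: powr_realpow[symmetric])

text \<open>Below \<open>L\<close> the exponent \<open>2 * (L - j) * (s + 1)\<close> in
  \<open>mu\<close>, halved by the square root, makes up for the larger size of coarse levels and
  leaves \<open>(1 / 2) ^ i\<close>. Above \<open>L\<close> fine levels are smaller by
  \<open>2 powr (- i * s)\<close>, and half of this exponent is given back in exchange for fewer
  bits. The sum of both rates serves both cases.\<close>

lemma level_error_le:
  assumes j: "j \<le> top_level L" and i: "i = (j - L) + (L - j)"
  shows "B * 2 powr (- (real j * s)) * (2 / sqrt (m L j)) \<le>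
         2 * B * 2 powr (- (real L * (s + D / 2))) * ((1 / 2) ^ i + (2 powr (- s / 2)) ^ i)"
proof -
  have mu: "mu L j > 0" using mu_ge_1[OF j] by simp
  have "sqrt (m L j) \<ge> mu L j powr (1 / 2)"
    using m_bounds(1)[OF j] mu by (simp add: powr_half_sqrt)
  then have "2 / sqrt (m L j) \<le> 2 / mu L j powr (1 / 2)"
    using mu by (intro divide_left_mono mult_pos_pos) (use m_bounds(3)[OF j] in auto)
  also have "\<dots> = 2 * mu L j powr (- 1 / 2)"
  proof -
    have "mu L j powr (- 1 / 2) = inverse (mu L j powr (1 / 2))" by (simp flip: powr_minus)
    then show ?thesis by (simp only: divide_inverse)
  qed
  finally have *: "2 / sqrt (m L j) \<le> 2 * mu L j powr (- 1 / 2)" .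
  have "B * 2 powr (- (real j * s)) * (2 / sqrt (m L j)) \<le>
      2 * B * (2 powr (- (real j * s)) * mu L j powr (- 1 / 2))"
  proof -
    have "B * 2 powr (- (real j * s)) * (2 / sqrt (m L j)) \<le> B * 2 powr (- (real j * s)) * (2 * mu L j powr (- 1 / 2))"
      using * B by (intro mult_left_mono) auto
    then show ?thesis by (simp only: mult_ac)
  qed
  moreover have "2 powr (- (real j * s)) * mu L j powr (- 1 / 2) \<le>
      2 powr (- (real L * (s + D / 2))) * ((1 / 2) ^ i + (2 powr (- s / 2)) ^ i)"
  proof (cases "j \<le> L")
    case True
    have "real L = real j + real i" using True i by simp
    then have "2 powr (- (real j * s)) * mu L j powr (- 1 / 2) = 2 powr (- (real L * (s + D / 2)) + - real i)"
      unfolding mu_def using True i by (simp add: powr_powr powr_add[symmetric] algebra_simps add_divide_distrib)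
    also have "\<dots> = 2 powr (- (real L * (s + D / 2))) * (1 / 2) ^ i"
      unfolding powr_add two_powr_minus ..
    finally show ?thesis by (simp add: distrib_left)
  next
    case False
    have "real j = real L + real i" using False i by simp
    then have exponent: "- (real j * s) + (real L * D - real i * s) * (- 1 / 2) = - (real L * (s + D / 2)) + - s / 2 * real i"
      by (simp add: field_simps)
    have "2 powr (- (real j * s)) * mu L j powr (- 1 / 2) = 2 powr (- (real j * s) + (real L * D - real i * s) * (- 1 / 2))"
      unfolding mu_def powr_add using False i by (simp add: powr_powr)
    also have "\<dots> = 2 powr (- (real L * (s + D / 2)) + - s / 2 * real i)" by (simp only: exponent)
    also have "\<dots> = 2 powr (- (real L * (s + D / 2))) * (2 powr (- s / 2)) ^ i"
      unfolding powr_add by (simp add: powr_realpow[symmetric] powr_powr)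
    finally show ?thesis by (simp add: distrib_left)
  qed
  from mult_left_mono[OF this, of "2 * B"] B
  have "2 * B * (2 powr (- (real j * s)) * mu L j powr (- 1 / 2)) \<le>
      2 * B * (2 powr (- (real L * (s + D / 2))) * ((1 / 2) ^ i + (2 powr (- s / 2)) ^ i))" by simp
  ultimately show ?thesis by (simp only: mult.assoc)
qed

text \<open>Bits spent on a level at distance \<open>i\<close> from \<open>L\<close>, in units of
  \<open>2 ^ (L * D)\<close>. The rate \<open>1 / 2\<close> is for levels up to \<open>L\<close>,
  where the number of vectors decays, the rate \<open>2 powr (- s)\<close> for levels above, where
  the length of the averages decays; \<open>Suc i\<close> comes from the logarithm in the binomial
  bound.\<close>

definition bits :: "nat \<Rightarrow> real" where
  "bits i = (2 * real A * (D + 2 * s + 5) + 2 * (2 + log 2 (3 * real A) + D + s)) *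
     (real (Suc i) * (1 / 2) ^ i + real (Suc i) * (2 powr (- s)) ^ i)"

lemma log_A: "log 2 (3 * real A) \<ge> 0"
  using A by (intro zero_le_log_cancel_iff[THEN iffD2]) auto

lemma bits_nonneg: "bits i \<ge> 0"
  unfolding bits_def using s log_A by (intro mult_nonneg_nonneg add_nonneg_nonneg) auto

lemma summable_bits: "summable bits"
proof -
  have "2 powr (- s) < 1" using s by (simp add: powr_less_one)
  then show ?thesis unfolding bits_def
    by (intro summable_mult summable_add sums_summable[OF geometric_deriv_sums]) auto
qed

text \<open>The binomial bound is applied with whichever argument decays away from \<open>L\<close>
  in the exponent: \<open>2 * N j\<close> up to level \<open>L\<close>, by symmetry of the
  coefficient, and \<open>m L j\<close> above. The logarithm of the ratio grows only linearly in
  \<open>i\<close>.\<close>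

lemma level_count_le:
  assumes j: "j \<le> top_level L" and i: "i = (j - L) + (L - j)"
  shows "real ((m L j + 2 * N j) choose m L j) \<le> 2 powr (2 ^ (L * D) * bits i)"
proof -
  have N1: "N j \<ge> 1" using A by (simp add: N_def)
  have m1: "m L j \<ge> 1" by (rule m_bounds[OF j])
  have LD: "2 ^ (L * D) = 2 powr (real L * D)" by (simp add: powr_realpow[symmetric])
  have A0: "real A \<ge> 1" using A by simp
  note logA = log_A
  show ?thesis
  proof (cases "j \<le> L")
    case True
    have ji: "real j = real L - real i" using True i by simp
    have le: "m L j \<le> m L j + 2 * N j" by simp
    have "(m L j + 2 * N j) choose m L j = (m L j + 2 * N j) choose (2 * N j)"
      using binomial_symmetric[OF le] by simp
    then have "real ((m L j + 2 * N j) choose m L j) \<le> 2 powr (real (2 * N j) * (2 + log 2 (1 + real (m L j) / real (2 * N j))))"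
      using binomial_le_powr[of "2 * N j" "m L j"] N1 by simp
    also have "\<dots> \<le> 2 powr (2 ^ (L * D) * bits i)"
    proof (intro powr_mono)
      have "real (m L j) / real (2 * N j) \<le> 2 * mu L j / real (2 * N j)"
        using m_bounds[OF j] by (intro divide_right_mono) auto
      also have "\<dots> \<le> mu L j / 2 powr (real j * D)"
        unfolding N_eq of_nat_mult using A0 mu_ge_1[OF j] by (simp add: divide_simps) 
      also have "\<dots> = 2 powr (real i * (D + 2 * s + 2))"
        unfolding mu_def powr_diff[symmetric] ji using True i by (simp add: powr_diff[symmetric] algebra_simps)
      finally have "1 + real (m L j) / real (2 * N j) \<le> 2 powr 0 + 2 powr (real i * (D + 2 * s + 2))" by simp
      also have "\<dots> \<le> 2 powr (real i * (D + 2 * s + 2)) + 2 powr (real i * (D + 2 * s + 2))"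
        using s by (intro add_mono powr_mono) auto
      also have "\<dots> = 2 powr (1 + real i * (D + 2 * s + 2))" by (simp add: powr_add)
      finally have "log 2 (1 + real (m L j) / real (2 * N j)) \<le> log 2 (2 powr (1 + real i * (D + 2 * s + 2)))"
        by (subst log_le_cancel_iff) (auto intro: add_pos_nonneg)
      then have lg: "2 + log 2 (1 + real (m L j) / real (2 * N j)) \<le> 3 + real i * (D + 2 * s + 2)" by simp
      also have "\<dots> \<le> (D + 2 * s + 5) * real (Suc i)" using s by (simp add: algebra_simps)
      finally have 1: "2 + log 2 (1 + real (m L j) / real (2 * N j)) \<le> (D + 2 * s + 5) * real (Suc i)" .
      have "real (2 * N j) = 2 * real A * (2 powr (real L * D) * 2 powr (- (real i * D)))"
        unfolding of_nat_mult N_eq ji powr_add[symmetric] by (simp add: algebra_simps)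
      also have "\<dots> \<le> 2 * real A * (2 powr (real L * D) * 2 powr (- real i))"
        using D by (intro mult_left_mono powr_mono) (auto simp: mult_le_cancel_left1)
      also have "2 powr (- real i) = (1 / 2) ^ i" by (rule two_powr_minus)
      finally have 2: "real (2 * N j) \<le> 2 * real A * (2 powr (real L * D) * (1 / 2) ^ i)" .
      have "real (2 * N j) * (2 + log 2 (1 + real (m L j) / real (2 * N j))) \<le>
         (2 * real A * (2 powr (real L * D) * (1 / 2) ^ i)) * ((D + 2 * s + 5) * real (Suc i))"
      proof (intro mult_mono 1 2)
        show "0 \<le> 2 + log 2 (1 + real (m L j) / real (2 * N j))"
          by (intro add_nonneg_nonneg zero_le_log_cancel_iff[THEN iffD2]) (auto intro: add_pos_nonneg)
      qed auto
      also have "\<dots> = 2 ^ (L * D) * (2 * real A * (D + 2 * s + 5) * (real (Suc i) * (1 / 2) ^ i))"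
        unfolding LD by (simp only: mult_ac)
      also have "\<dots> \<le> 2 ^ (L * D) * bits i"
        unfolding bits_def using s logA A0
        by (intro mult_left_mono mult_mono) auto
      finally show "real (2 * N j) * (2 + log 2 (1 + real (m L j) / real (2 * N j))) \<le> 2 ^ (L * D) * bits i" .
    qed auto
    finally show ?thesis .
  next
    case False
    have ji: "real j = real L + real i" using False i by simp
    have "real ((m L j + 2 * N j) choose m L j) \<le> 2 powr (real (m L j) * (2 + log 2 (1 + real (2 * N j) / real (m L j))))"
      using binomial_le_powr[OF m1, of "2 * N j"] by (simp add: add.commute)
    also have "\<dots> \<le> 2 powr (2 ^ (L * D) * bits i)"
    proof (intro powr_mono)
      have mu: "mu L j = 2 powr (real L * D - real i * s)" using False i by (simp add: mu_def)
      have "real (2 * N j) / real (m L j) \<le> real (2 * N j) / mu L j"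
        using m_bounds[OF j] mu_ge_1[OF j] by (intro divide_left_mono mult_pos_pos) auto
      also have "\<dots> = 2 * real A * 2 powr (real i * (D + s))"
        unfolding N_eq of_nat_mult mu ji using powr_diff[of 2 "(real L + real i) * D" "real L * D - real i * s"]
        by (simp add: algebra_simps)
      finally have "1 + real (2 * N j) / real (m L j) \<le> 1 * 1 + 2 * real A * 2 powr (real i * (D + s))" by simp
      also have "\<dots> \<le> real A * 2 powr (real i * (D + s)) + 2 * real A * 2 powr (real i * (D + s))"
        using s A0 by (intro add_mono mult_mono ge_one_powr_ge_zero) auto
      also have "\<dots> = 3 * real A * 2 powr (real i * (D + s))" by simp
      finally have "log 2 (1 + real (2 * N j) / real (m L j)) \<le> log 2 (3 * real A * 2 powr (real i * (D + s)))"
        using A0 by (subst log_le_cancel_iff) (auto intro: add_pos_nonneg)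
      also have "\<dots> = log 2 (3 * real A) + real i * (D + s)" using A0 by (subst log_mult) auto
      finally have "2 + log 2 (1 + real (2 * N j) / real (m L j)) \<le> 2 + log 2 (3 * real A) + real i * (D + s)" by simp
      also have "\<dots> \<le> (2 + log 2 (3 * real A) + D + s) * real (Suc i)"
        using s mult_nonneg_nonneg[OF logA of_nat_0_le_iff[of i]] by (simp add: algebra_simps)
      finally have 1: "2 + log 2 (1 + real (2 * N j) / real (m L j)) \<le> (2 + log 2 (3 * real A) + D + s) * real (Suc i)" .
      have "real (m L j) \<le> 2 * mu L j" by (rule m_bounds[OF j])
      also have "\<dots> = 2 * (2 powr (real L * D) * 2 powr (- s * real i))"
        unfolding mu powr_add[symmetric] by (simp add: mult.commute)
      also have "2 powr (- s * real i) = (2 powr (- s)) ^ i"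
        unfolding powr_powr[symmetric] by (simp add: powr_realpow)
      finally have 2: "real (m L j) \<le> 2 * (2 powr (real L * D) * (2 powr (- s)) ^ i)" .
      have l0: "0 \<le> log 2 (1 + real (2 * N j) / real (m L j))"
        by (intro zero_le_log_cancel_iff[THEN iffD2]) (auto intro: add_pos_nonneg)
      have "real (m L j) * (2 + log 2 (1 + real (2 * N j) / real (m L j))) \<le>
         (2 * (2 powr (real L * D) * (2 powr (- s)) ^ i)) * ((2 + log 2 (3 * real A) + D + s) * real (Suc i))"
        using 1 2 l0 by (intro mult_mono) auto
      also have "\<dots> = 2 ^ (L * D) * (2 * (2 + log 2 (3 * real A) + D + s) * (real (Suc i) * (2 powr (- s)) ^ i))"
        unfolding LD by (simp only: mult_ac)
      also have "\<dots> \<le> 2 ^ (L * D) * bits i"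
        unfolding bits_def using s logA A0
        by (intro mult_left_mono mult_mono) auto
      finally show "real (m L j) * (2 + log 2 (1 + real (2 * N j) / real (m L j))) \<le> 2 ^ (L * D) * bits i" .
    qed auto
    finally show ?thesis .
  qed
qed

text \<open>Both the bits and the errors are summable in the distance to \<open>L\<close>, with
  bounds independent of \<open>L\<close>; this is why neither sum produces a factor
  \<open>L\<close>.\<close>

lemma coverable_hull_level:
  "\<exists>(c1::nat) c2. c1 \<ge> 1 \<and> c2 > 0 \<and>
     (\<forall>L. coverable (closed_abs_hull K) (2 ^ (c1 * 2 ^ (L * D))) (c2 * 2 powr (- (real L * (s + D / 2)))))"
proof -
  define w where "w i = (1 / 2) ^ i + (2 powr (- s / 2)) ^ i" for i
  have w: "summable w" "w i \<ge> 0" for i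
  proof -
    have "2 powr (- s / 2) < 1" using s by (simp add: powr_less_one)
    then show "summable w" unfolding w_def by (intro summable_add summable_geometric) auto
    show "w i \<ge> 0" unfolding w_def by simp
  qed
  define c1 where "c1 = nat \<lceil>2 * suminf bits\<rceil> + 1"
  define c2 where "c2 = 4 * B * suminf w + B * 2 powr s"
  have c2: "c2 > 0" unfolding c2_def using B w
    by (intro add_nonneg_pos mult_nonneg_nonneg suminf_nonneg) auto
  have "coverable (closed_abs_hull K) (2 ^ (c1 * 2 ^ (L * D))) (c2 * 2 powr (- (real L * (s + D / 2))))" for L
  proof (rule coverable_mono[OF coverable_hull[of "top_level L" "m L"] order_refl])
    let ?i = "\<lambda>j. (j - L) + (L - j)"
    let ?q = "2 powr (- (real L * (s + D / 2)))"
    have "real (\<Prod>j\<le>top_level L. (m L j + 2 * N j) choose m L j) \<le>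
        (\<Prod>j\<le>top_level L. 2 powr (2 ^ (L * D) * bits (?i j)))"
      unfolding of_nat_prod by (intro prod_mono conjI level_count_le) auto
    also have "\<dots> = 2 powr (\<Sum>j\<le>top_level L. 2 ^ (L * D) * bits (?i j))"
      by (subst powr_sum) auto
    also have "\<dots> \<le> 2 powr (2 ^ (L * D) * (2 * suminf bits))"
      unfolding sum_distrib_left[symmetric]
      by (intro powr_mono mult_left_mono sum_le_two_suminf summable_bits bits_nonneg) auto
    also have "\<dots> \<le> 2 powr (2 ^ (L * D) * real c1)"
      unfolding c1_def by (intro powr_mono mult_left_mono) (auto; linarith)+
    also have "\<dots> = real (2 ^ (c1 * 2 ^ (L * D)))"
    proof -
      have "2 ^ (L * D) * real c1 = real (c1 * 2 ^ (L * D))" by simp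
      then show ?thesis by (simp only: powr_realpow of_nat_power of_nat_numeral zero_less_numeral)
    qed
    finally show "(\<Prod>j\<le>top_level L. (m L j + 2 * N j) choose m L j) \<le> 2 ^ (c1 * 2 ^ (L * D))"
      by (simp only: of_nat_le_iff)
    have "(\<Sum>j\<le>top_level L. B * 2 powr (- (real j * s)) * (2 / sqrt (m L j))) \<le>
      (\<Sum>j\<le>top_level L. 2 * B * ?q * w (?i j))"
      unfolding w_def by (intro sum_mono level_error_le) auto
    also have "\<dots> \<le> 2 * B * ?q * (2 * suminf w)"
      unfolding sum_distrib_left[symmetric] using B
      by (intro mult_left_mono sum_le_two_suminf w) auto
    finally have 1: "(\<Sum>j\<le>top_level L. B * 2 powr (- (real j * s)) * (2 / sqrt (m L j))) \<le> 4 * B * suminf w * ?q"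
      by (simp add: mult_ac)
    \<comment> \<open>Rounding in \<open>top_level\<close> loses at most one level, which is the
      factor \<open>2 powr s\<close> in \<open>c2\<close>.\<close>
    have "real L * D / (2 * s) - 1 \<le> real (nat \<lfloor>real L * D / (2 * s)\<rfloor>)" by linarith
    then have "real L + real L * D / (2 * s) - 1 \<le> real (top_level L)" by (simp add: top_level_def)
    then have "(real L + real L * D / (2 * s) - 1) * s \<le> real (top_level L) * s"
      using s by (intro mult_right_mono) auto
    moreover have "(real L + real L * D / (2 * s) - 1) * s = real L * (s + D / 2) - s"
      using s by (simp add: field_simps)
    ultimately have "- (real (top_level L) * s) \<le> s + - (real L * (s + D / 2))" by linarith
    then have "2 powr (- (real (top_level L) * s)) \<le> 2 powr (s + - (real L * (s + D / 2)))"
      by (intro powr_mono) auto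
    also have "\<dots> = 2 powr s * ?q" by (simp only: powr_add)
    finally have "B * 2 powr (- (real (top_level L) * s)) \<le> B * (2 powr s * ?q)"
      using B by (intro mult_left_mono) auto
    then show "(\<Sum>j\<le>top_level L. B * 2 powr (- (real j * s)) * (2 / sqrt (real (m L j)))) +
        B * 2 powr (- (real (top_level L) * s)) \<le> c2 * ?q"
      using 1 unfolding c2_def distrib_right by (simp only: mult.assoc)
  qed (use m_bounds in auto)
  then show ?thesis using c2 by (intro exI[of _ c1] exI[of _ c2]) (auto simp: c1_def)
qed

text \<open>Level 0 and the tail after it have norm at most \<open>B\<close> each. The bound serves
  those \<open>n\<close> that are too small for any level to be affordable.\<close>

lemma hull_bounded: "closed_abs_hull K \<subseteq> cball 0 (2 * B)"
  unfolding closed_abs_hull_def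
proof (rule closure_minimal)
  have K: "norm g \<le> 2 * B" if g: "g \<in> K" for g
  proof -
    obtain a :: "nat \<Rightarrow> nat \<Rightarrow> real" where a: "\<And>j. (\<Sum>i<A * 2 ^ (j * D). \<bar>a j i\<bar>) \<le> B * 2 powr (- (real j * s))"
      "\<And>J. norm (g - (\<Sum>j\<le>J. \<Sum>i<A * 2 ^ (j * D). a j i *\<^sub>R e j i)) \<le> B * 2 powr (- (real J * s))"
      using expansion[OF g] by blast
    have "norm (\<Sum>i<A * 2 ^ (0 * D). a 0 i *\<^sub>R e 0 i) \<le> (\<Sum>i<A * 2 ^ (0 * D). \<bar>a 0 i\<bar>)"
      using e by (intro order_trans[OF norm_sum] sum_mono) (simp add: mult_left_le)
    then have "norm (\<Sum>i<A. a 0 i *\<^sub>R e 0 i) \<le> B" using a(1)[of 0] by simp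
    moreover have "norm (g - (\<Sum>i<A. a 0 i *\<^sub>R e 0 i)) \<le> B" using a(2)[of 0] by simp
    ultimately show ?thesis using norm_triangle_sub[of g "\<Sum>i<A. a 0 i *\<^sub>R e 0 i"] by linarith
  qed
  show "{\<Sum>g\<in>F. c g *\<^sub>R g |F c. finite F \<and> F \<subseteq> K \<and> (\<Sum>g\<in>F. \<bar>c g\<bar>) \<le> 1} \<subseteq> cball 0 (2 * B)"
  proof safe
    fix F :: "'h set" and c :: "'h \<Rightarrow> real" assume F: "finite F" "F \<subseteq> K" "(\<Sum>g\<in>F. \<bar>c g\<bar>) \<le> 1"
    have "norm (\<Sum>g\<in>F. c g *\<^sub>R g) \<le> (\<Sum>g\<in>F. \<bar>c g\<bar> * (2 * B))"
      using F(2) by (intro order_trans[OF norm_sum] sum_mono) (auto intro!: mult_left_mono K)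
    also have "\<dots> = (\<Sum>g\<in>F. \<bar>c g\<bar>) * (2 * B)" by (simp add: sum_distrib_right)
    also have "\<dots> \<le> 1 * (2 * B)" using F B by (intro mult_right_mono) auto
    finally show "(\<Sum>g\<in>F. c g *\<^sub>R g) \<in> cball 0 (2 * B)" by simp
  qed
qed auto

text \<open>Given \<open>n\<close>, take the largest \<open>L\<close> with
  \<open>c1 * 2 ^ (L * D) <= n\<close>. Then \<open>2 ^ (L * D)\<close> is comparable to
  \<open>n\<close>, and \<open>s + D / 2 = D * q\<close> turns the error into
  \<open>n powr (- q)\<close>.\<close>

theorem entropy_number_hull_le:
  "\<exists>C>0. \<forall>n\<ge>1. entropy_number n (closed_abs_hull K) \<le> ennreal (C * real n powr (- (s / D) - 1 / 2))"
proof -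
  obtain c1 :: nat and c2 where c: "c1 \<ge> 1" "c2 > 0" and
    cov: "\<And>L. coverable (closed_abs_hull K) (2 ^ (c1 * 2 ^ (L * D))) (c2 * 2 powr (- (real L * (s + D / 2))))"
    using coverable_hull_level by blast
  define q where "q = s / D + 1 / 2"
  have q: "q > 0" using s by (simp add: q_def add_nonneg_pos)
  define C1 where "C1 = 2 * B * real c1 powr q"
  define C2 where "C2 = c2 * (real c1 * 2 ^ D) powr q"
  have C: "C1 > 0" "C2 > 0" using c B by (auto simp: C1_def C2_def)
  have "entropy_number n (closed_abs_hull K) \<le> ennreal ((C1 + C2) * real n powr (- q))" if n: "n \<ge> 1" for n
  proof (cases "n < c1")
    case True
    have "coverable (closed_abs_hull K) 1 (2 * B)" using hull_bounded by (intro coverableI[of "{0}"]) auto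
    then have "entropy_number n (closed_abs_hull K) \<le> ennreal (2 * B)"
      using B by (intro entropy_number_le) auto
    also have "2 * B = C1 * real c1 powr (- q)" using c by (simp add: C1_def powr_minus)
    also have "\<dots> \<le> C1 * real n powr (- q)"
      using True n q C by (intro mult_left_mono powr_mono2') auto
    also have "\<dots> \<le> (C1 + C2) * real n powr (- q)" using C by (intro mult_right_mono) auto
    finally show ?thesis by (simp add: ennreal_leI)
  next
    case False
    have "n < 2 ^ n" by (rule less_exp)
    also have "(2::nat) ^ n \<le> 2 ^ (n * D)" using D by (intro power_increasing) auto
    also have "\<dots> \<le> c1 * 2 ^ (n * D)" using c by simp
    finally have "n < c1 * 2 ^ (n * D)" .
    \<comment> \<open>The least unaffordable level \<open>k\<close> is positive here, so
      \<open>L = k - 1\<close> is affordable, and the step from \<open>L\<close> to \<open>k\<close>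
      costs only the factor \<open>2 ^ D\<close> in \<open>C2\<close>.\<close>
    from ex_least_nat_le[of "\<lambda>k. n < c1 * 2 ^ (k * D)", OF this]
    obtain k where k: "n < c1 * 2 ^ (k * D)" "\<And>i. i < k \<Longrightarrow> \<not> n < c1 * 2 ^ (i * D)" by blast
    have "k \<noteq> 0" using k(1) False by (intro notI) simp
    then obtain L where L: "k = Suc L" using not0_implies_Suc by blast
    have "2 ^ (c1 * 2 ^ (L * D)) \<le> (2::nat) ^ n"
      using k(2)[of L] L by (intro power_increasing) auto
    then have "entropy_number n (closed_abs_hull K) \<le> ennreal (c2 * 2 powr (- (real L * (s + D / 2))))"
      using c by (intro entropy_number_le[OF cov]) auto
    also have "c2 * 2 powr (- (real L * (s + D / 2))) \<le> (C1 + C2) * real n powr (- q)"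
    proof -
      have "real n < real (c1 * 2 ^ (k * D))" using k(1) by (simp only: of_nat_less_iff)
      also have "\<dots> = (real c1 * 2 ^ D) * 2 ^ (L * D)" by (simp add: L power_add)
      finally have le: "real n / (real c1 * 2 ^ D) \<le> 2 ^ (L * D)"
        using c by (simp add: divide_simps mult_ac)
      have "real L * (s + D / 2) = real L * D * q"
        using D by (simp add: q_def distrib_left)
      then have "2 powr (- (real L * (s + D / 2))) = (2 powr (real L * D)) powr (- q)"
        by (simp only: powr_powr mult_minus_right)
      also have "2 powr (real L * D) = 2 ^ (L * D)" by (simp add: powr_realpow[symmetric])
      also have "(2 ^ (L * D)) powr (- q) \<le> (real n / (real c1 * 2 ^ D)) powr (- q)"
        using le q n c by (intro powr_mono2') auto
      also have "\<dots> = real n powr (- q) * (real c1 * 2 ^ D) powr q"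
      proof -
        define X where "X = real c1 * 2 ^ D"
        have "(real n / X) powr (- q) = real n powr (- q) / X powr (- q)"
          by (rule powr_divide)
        also have "\<dots> = real n powr (- q) * X powr q"
          unfolding powr_minus[of X] by (simp add: divide_inverse)
        finally show ?thesis by (simp only: X_def)
      qed
      finally have "c2 * 2 powr (- (real L * (s + D / 2))) \<le> c2 * (real n powr (- q) * (real c1 * 2 ^ D) powr q)"
        using c by (intro mult_left_mono) auto
      also have "\<dots> = C2 * real n powr (- q)" unfolding C2_def by (simp only: mult_ac)
      also have "\<dots> \<le> (C1 + C2) * real n powr (- q)" using C by (intro mult_right_mono) auto
      finally show ?thesis .
    qed
    finally show ?thesis by (simp add: ennreal_leI)
  qed
  moreover have "- q = - (s / D) - 1 / 2" by (simp add: q_def)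
  ultimately show ?thesis using C by (intro exI[of _ "C1 + C2"]) auto
qed

end

section \<open>Approximation from finitely many functionals\<close>

lemma subspace_closure:
  fixes S :: "'h::real_normed_vector set"
  assumes "subspace S" shows "subspace (closure S)"
proof (rule subspaceI)
  show "0 \<in> closure S" using subspace_0[OF assms] closure_subset by blast
  fix x y c assume "x \<in> closure S"
  then obtain f where f: "\<And>n. f n \<in> S" "f \<longlonglongrightarrow> x" unfolding closure_sequential by blast
  have "(\<lambda>n. c *\<^sub>R f n) \<longlonglongrightarrow> c *\<^sub>R x" by (intro tendsto_intros f)
  then show "c *\<^sub>R x \<in> closure S"
    unfolding closure_sequential using f subspace_scale[OF assms] by (intro exI[of _ "\<lambda>n. c *\<^sub>R f n"]) auto
  assume "y \<in> closure S"
  then obtain g where g: "\<And>n. g n \<in> S" "g \<longlonglongrightarrow> y" unfolding closure_sequential by blast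
  have "(\<lambda>n. f n + g n) \<longlonglongrightarrow> x + y" by (intro tendsto_intros f g)
  then show "x + y \<in> closure S"
    unfolding closure_sequential using f g subspace_add[OF assms] by (intro exI[of _ "\<lambda>n. f n + g n"]) auto
qed

text \<open>The projection theorem: by the parallelogram identity a minimising sequence is Cauchy,
  and minimality of its limit along each line in \<open>S\<close> forces orthogonality.\<close>

lemma ex_orth_proj_closed:
  fixes S :: "'h::{real_inner,complete_space} set"
  assumes S: "subspace S" "closed S"
  shows "\<exists>v\<in>S. \<forall>w\<in>S. (u - v) \<bullet> w = 0"
proof -
  define \<delta> where "\<delta> = Inf ((\<lambda>v. (norm (u - v))\<^sup>2) ` S)"
  have S0: "0 \<in> S" using S subspace_0 by blast
  have bdd: "bdd_below ((\<lambda>v. (norm (u - v))\<^sup>2) ` S)" by (intro bdd_belowI[of _ 0]) auto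
  have \<delta>_le: "\<delta> \<le> (norm (u - v))\<^sup>2" if "v \<in> S" for v
    unfolding \<delta>_def using bdd that by (intro cInf_lower) auto
  have "\<exists>v\<in>S. (norm (u - v))\<^sup>2 < \<delta> + 1 / real (Suc n)" for n
  proof -
    have "\<exists>x\<in>(\<lambda>v. (norm (u - v))\<^sup>2) ` S. x < \<delta> + 1 / real (Suc n)"
      unfolding \<delta>_def by (intro cInf_lessD) (use S0 in auto)
    then show ?thesis by auto
  qed
  then obtain v where v: "\<And>n. v n \<in> S" "\<And>n. (norm (u - v n))\<^sup>2 < \<delta> + 1 / real (Suc n)" by metis
  have close: "(norm (v n - v m))\<^sup>2 \<le> 2 / real (Suc n) + 2 / real (Suc m)" for n m
  proof -
    \<comment> \<open>The midpoint cannot be closer to \<open>u\<close> than the infimum allows,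
      which bounds the distance of the two approximants.\<close>
    have "(1 / 2) *\<^sub>R (v n + v m) \<in> S" using S v by (intro subspace_scale subspace_add) auto
    then have "4 * \<delta> \<le> 4 * (norm (u - (1 / 2) *\<^sub>R (v n + v m)))\<^sup>2" using \<delta>_le by simp
    also have "\<dots> = 2 * (norm (u - v n))\<^sup>2 + 2 * (norm (u - v m))\<^sup>2 - (norm (v n - v m))\<^sup>2"
      by (simp add: power2_norm_eq_inner inner_diff_left inner_diff_right inner_add_left inner_add_right
          inner_commute algebra_simps)
    finally show ?thesis using v(2)[of n] v(2)[of m] by linarith
  qed
  have "Cauchy v"
  proof (rule metric_CauchyI)
    fix \<epsilon> :: real assume \<epsilon>: "\<epsilon> > 0"
    obtain M where M: "4 / \<epsilon>\<^sup>2 < real M" using reals_Archimedean2 by blast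
    have "dist (v m) (v n) < \<epsilon>" if "m \<ge> M" "n \<ge> M" for m n
    proof -
      have M0: "real M > 0" using M \<epsilon> by (smt (verit) divide_pos_pos zero_less_power)
      have "(norm (v m - v n))\<^sup>2 \<le> 2 / real (Suc m) + 2 / real (Suc n)" by (rule close)
      also have "\<dots> \<le> 2 / real M + 2 / real M"
        using that M0 by (intro add_mono divide_left_mono) auto
      also have "\<dots> < \<epsilon>\<^sup>2" using M M0 \<epsilon> by (simp add: field_simps)
      finally show ?thesis using \<epsilon> by (simp add: dist_norm power2_less_imp_less)
    qed
    then show "\<exists>M. \<forall>m\<ge>M. \<forall>n\<ge>M. dist (v m) (v n) < \<epsilon>" by blast
  qed
  then obtain l where l: "v \<longlonglongrightarrow> l" using Cauchy_convergent convergent_def by blast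
  have lS: "l \<in> S" using S(2) v(1) l closed_sequentially by blast
  have "(norm (u - l))\<^sup>2 \<le> \<delta>"
  proof (rule LIMSEQ_le)
    show "(\<lambda>n. (norm (u - v n))\<^sup>2) \<longlonglongrightarrow> (norm (u - l))\<^sup>2" by (intro tendsto_intros l)
    have "(\<lambda>n. \<delta> + 1 / real (Suc n)) \<longlonglongrightarrow> \<delta> + 0"
      by (intro tendsto_intros lim_1_over_n[THEN LIMSEQ_Suc])
    then show "(\<lambda>n. \<delta> + 1 / real (Suc n)) \<longlonglongrightarrow> \<delta>" by simp
  qed (use v(2) in \<open>auto intro: less_imp_le\<close>)
  then have min: "(norm (u - l))\<^sup>2 \<le> (norm (u - w))\<^sup>2" if "w \<in> S" for w
    using \<delta>_le[OF that] by linarith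
  have "(u - l) \<bullet> w = 0" if w: "w \<in> S" for w
  proof (cases "w = 0")
    case False
    \<comment> \<open>This \<open>t\<close> minimises the quadratic distance from \<open>u\<close>
      along the line through \<open>l\<close> in direction \<open>w\<close>.\<close>
    define t where "t = ((u - l) \<bullet> w) / (w \<bullet> w)"
    have ww: "w \<bullet> w > 0" using False by simp
    have "l + t *\<^sub>R w \<in> S" using S lS w by (intro subspace_add subspace_scale) auto
    from min[OF this] have "(norm (u - l))\<^sup>2 \<le> (norm ((u - l) - t *\<^sub>R w))\<^sup>2" by (simp add: diff_diff_eq)
    also have "\<dots> = (norm (u - l))\<^sup>2 - 2 * t * ((u - l) \<bullet> w) + t\<^sup>2 * (w \<bullet> w)"
      unfolding power2_norm_eq_inner inner_diff_left[of "u - l"] inner_diff_right[of _ "u - l"]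
      by (simp add: power2_eq_square inner_commute[of w "u - l"])
    also have "\<dots> = (norm (u - l))\<^sup>2 - ((u - l) \<bullet> w)\<^sup>2 / (w \<bullet> w)"
      using ww by (simp add: t_def power2_eq_square field_simps)
    finally have "((u - l) \<bullet> w)\<^sup>2 / (w \<bullet> w) \<le> 0" by simp
    then show ?thesis using ww by (simp add: divide_le_0_iff)
  qed simp
  then show ?thesis using lS by blast
qed

text \<open>Induction over the functionals. A new functional either vanishes on the common kernel of
  the earlier ones, and \<open>F\<close> is kept, or some \<open>b\<close> in that kernel is not
  annihilated by it, and a multiple of \<open>b\<close> corrects \<open>f\<close> without disturbing
  the earlier conditions.\<close>

lemma finite_codimension:
  fixes l :: "'i \<Rightarrow> 'h::real_vector \<Rightarrow> real"
  assumes "finite I" "\<And>i. i \<in> I \<Longrightarrow> linear (l i)"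
  shows "\<exists>F. finite F \<and> card F \<le> card I \<and> (\<forall>u. \<exists>f\<in>span F. \<forall>i\<in>I. l i (u - f) = 0)"
  using assms
proof (induction I)
  case empty
  show ?case by (intro exI[of _ "{}"]) auto
next
  case (insert a I)
  obtain F where F: "finite F" "card F \<le> card I" "\<forall>u. \<exists>f\<in>span F. \<forall>i\<in>I. l i (u - f) = 0"
    using insert.IH insert.prems by auto
  have lin: "linear (l i)" if "i \<in> insert a I" for i using insert.prems that by blast
  show ?case
  proof (cases "\<exists>b. (\<forall>i\<in>I. l i b = 0) \<and> l a b \<noteq> 0")
    case True
    then obtain b where b: "\<And>i. i \<in> I \<Longrightarrow> l i b = 0" "l a b \<noteq> 0" by blast
    have "\<exists>f\<in>span (insert b F). \<forall>i\<in>insert a I. l i (u - f) = 0" for u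
    proof -
      obtain f where f: "f \<in> span F" "\<forall>i\<in>I. l i (u - f) = 0" using F by blast
      define c where "c = l a (u - f) / l a b"
      have l: "l i (u - (f + c *\<^sub>R b)) = l i (u - f) - c * l i b" if "i \<in> insert a I" for i
        using lin[OF that] by (simp add: diff_diff_eq[symmetric] linear_diff linear_scale)
      have "f + c *\<^sub>R b \<in> span (insert b F)"
        using f(1) by (intro span_add span_scale) (auto intro: span_base span_mono[THEN subsetD, rotated])
      moreover have "\<forall>i\<in>insert a I. l i (u - (f + c *\<^sub>R b)) = 0"
        using l f(2) b by (auto simp: c_def)
      ultimately show ?thesis by blast
    qed
    moreover have "card (insert b F) \<le> card (insert a I)"
      using F insert.hyps by (simp add: card_insert_if)
    ultimately show ?thesis using F(1) by (intro exI[of _ "insert b F"]) auto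
  next
    case False
    have "\<exists>f\<in>span F. \<forall>i\<in>insert a I. l i (u - f) = 0" for u
    proof -
      obtain f where "f \<in> span F" "\<forall>i\<in>I. l i (u - f) = 0" using F(3) by blast
      then show ?thesis using False by (intro bexI[of _ f]) auto
    qed
    then show ?thesis using F insert.hyps by (intro exI[of _ F]) auto
  qed
qed

text \<open>
  The functionals need not be bounded: the estimate passes to the closure of their common kernel,
  whose orthogonal complement is spanned by at most \<^term>\<open>card I\<close> vectors.
\<close>

lemma finite_width:
  fixes l :: "'i \<Rightarrow> 'h::{real_inner,complete_space} \<Rightarrow> real"
  assumes "finite I" and lin: "\<And>i. i \<in> I \<Longrightarrow> linear (l i)"
  shows "\<exists>F. finite F \<and> card F \<le> card I \<and>
     (\<forall>k. \<forall>\<epsilon>\<ge>0. (\<forall>u. (\<forall>i\<in>I. l i u = 0) \<longrightarrow> \<bar>u \<bullet> k\<bar> \<le> \<epsilon> * norm u) \<longrightarrow> (\<exists>z\<in>span F. norm (k - z) \<le> \<epsilon>))"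
proof -
  define N where "N = {u. \<forall>i\<in>I. l i u = 0}"
  have N: "subspace N"
    unfolding N_def using lin by (intro subspaceI) (auto simp: linear_0 linear_add linear_scale)
  define S where "S = closure N"
  have S: "subspace S" "closed S" unfolding S_def using N by (auto intro: subspace_closure)
  have NS: "N \<subseteq> S" unfolding S_def by (rule closure_subset)
  obtain p where p: "\<And>u. p u \<in> S" "\<And>u w. w \<in> S \<Longrightarrow> (u - p u) \<bullet> w = 0"
    using ex_orth_proj_closed[OF S] by metis
  obtain F' where F': "finite F'" "card F' \<le> card I" "\<And>u. \<exists>f\<in>span F'. u - f \<in> N"
    using finite_codimension[OF assms(1), of l, OF lin] unfolding N_def by auto
  \<comment> \<open>Removing the projections onto \<open>S\<close> leaves vectors orthogonal to
    \<open>S\<close> which, together with \<open>S\<close>, still reach all of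
    \<open>span F'\<close>.\<close>
  define F where "F = (\<lambda>f. f - p f) ` F'"
  have F: "finite F" "card F \<le> card I"
    using F' card_image_le[OF F'(1), of "\<lambda>f. f - p f"] by (auto simp: F_def)
  have F_orth: "z \<bullet> w = 0" if "z \<in> span F" "w \<in> S" for z w
  proof -
    have "orthogonal w z"
      by (rule orthogonal_to_span[OF that(1)]) (use p that in \<open>auto simp: F_def orthogonal_def inner_commute\<close>)
    then show ?thesis by (simp add: orthogonal_def inner_commute)
  qed
  have split: "\<exists>f1\<in>S. f - f1 \<in> span F" if "f \<in> span F'" for f
  proof -
    let ?T = "{f. \<exists>f1\<in>S. f - f1 \<in> span F}"
    have "subspace ?T"
    proof (rule subspaceI)
      show "0 \<in> ?T" using S(1) subspace_0 by (auto intro!: bexI[of _ 0] span_zero)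
      fix x y c assume "x \<in> ?T"
      then obtain x1 where x: "x1 \<in> S" "x - x1 \<in> span F" by blast
      have "c *\<^sub>R x - c *\<^sub>R x1 \<in> span F" using span_scale[OF x(2), of c] by (simp add: scaleR_diff_right)
      then show "c *\<^sub>R x \<in> ?T" using subspace_scale[OF S(1) x(1)] by blast
      assume "y \<in> ?T"
      then obtain y1 where y: "y1 \<in> S" "y - y1 \<in> span F" by blast
      have "(x + y) - (x1 + y1) \<in> span F" using span_add[OF x(2) y(2)] by (simp add: algebra_simps)
      then show "x + y \<in> ?T" using subspace_add[OF S(1) x(1) y(1)] by blast
    qed
    moreover have "F' \<subseteq> ?T" using p(1) by (auto simp: F_def intro!: span_base)
    ultimately show ?thesis using span_minimal that by blast
  qed
  have width: "\<exists>z\<in>span F. norm (k - z) \<le> \<epsilon>"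
    if bound: "\<forall>u. (\<forall>i\<in>I. l i u = 0) \<longrightarrow> \<bar>u \<bullet> k\<bar> \<le> \<epsilon> * norm u" and \<epsilon>: "\<epsilon> \<ge> 0" for k \<epsilon>
  proof -
    obtain f where f: "f \<in> span F'" "k - f \<in> N" using F'(3) by blast
    obtain f1 where f1: "f1 \<in> S" "f - f1 \<in> span F" using split f by blast
    \<comment> \<open>\<open>v\<close> is the component of \<open>k\<close> in \<open>S\<close> and
      \<open>f - f1\<close> the component in \<open>span F\<close>. Testing the bound with
      \<open>u = v\<close> yields the square of the norm of \<open>v\<close> on the left, hence
      \<open>norm v <= \<epsilon>\<close>.\<close>
    define v where "v = (k - f) + f1"
    have v: "v \<in> S" unfolding v_def using S NS f f1 by (intro subspace_add) auto
    have kv: "k - v = f - f1" by (simp add: v_def)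
    have "\<bar>u \<bullet> k\<bar> \<le> \<epsilon> * norm u" if u: "u \<in> S" for u
    proof -
      have cl: "closed {u. \<bar>u \<bullet> k\<bar> \<le> \<epsilon> * norm u}"
        by (intro closed_Collect_le continuous_intros)
      have "N \<subseteq> {u. \<bar>u \<bullet> k\<bar> \<le> \<epsilon> * norm u}" using bound by (auto simp: N_def)
      then have "S \<subseteq> {u. \<bar>u \<bullet> k\<bar> \<le> \<epsilon> * norm u}"
        unfolding S_def using cl by (rule closure_minimal)
      then show ?thesis using u by blast
    qed
    from this[OF v] have 1: "\<bar>v \<bullet> k\<bar> \<le> \<epsilon> * norm v" .
    have "(k - v) \<bullet> v = 0" unfolding kv using F_orth f1 v by blast
    then have "v \<bullet> k = (norm v)\<^sup>2"
      using inner_commute[of v k] by (simp add: inner_diff_left power2_norm_eq_inner)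
    with 1 have 2: "norm v * norm v \<le> \<epsilon> * norm v" by (simp add: power2_eq_square)
    have "norm v \<le> \<epsilon>" using 2 \<epsilon> by (cases "v = 0") auto
    moreover have "k - (f - f1) = v" by (simp add: v_def)
    ultimately have "norm (k - (f - f1)) \<le> \<epsilon>" by simp
    then show ?thesis using f1 by blast
  qed
  show ?thesis using F width by (intro exI[of _ F]) auto
qed

section \<open>From nested cells to a multilevel expansion\<close>

lemma orth_proj_span_best:
  assumes "finite F" "z \<in> span F"
  shows "norm (u - orth_proj (span F) u) \<le> norm (u - z)"
proof -
  let ?p = "orth_proj (span F) u"
  have "?p - z \<in> span F" using orth_proj_span_finite(1)[OF assms(1)] assms(2) by (intro span_diff)
  then have "(u - ?p) \<bullet> (?p - z) = 0" by (rule orth_proj_span_finite(2)[OF assms(1)])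
  then have "(norm ((u - ?p) + (?p - z)))\<^sup>2 = (norm (u - ?p))\<^sup>2 + (norm (?p - z))\<^sup>2"
    by (subst norm_add_Pythagorean) (auto simp: orthogonal_def)
  then have "(norm (u - ?p))\<^sup>2 \<le> (norm (u - z))\<^sup>2" by simp
  then show ?thesis by (rule power2_le_imp_le) simp
qed

lemma orthonormal_expansion:
  assumes "finite B" "\<And>b c. b \<in> B \<Longrightarrow> c \<in> B \<Longrightarrow> b \<bullet> c = (if b = c then 1 else 0)" "v \<in> span B"
  shows "(\<Sum>b\<in>B. (v \<bullet> b) *\<^sub>R b) = v"
proof -
  define w where "w = v - (\<Sum>b\<in>B. (v \<bullet> b) *\<^sub>R b)"
  have "w \<bullet> c = 0" if "c \<in> B" for c
  proof -
    have "(\<Sum>b\<in>B. (v \<bullet> b) * (b \<bullet> c)) = (\<Sum>b\<in>B. if b = c then v \<bullet> b else 0)"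
      using assms(2) that by (intro sum.cong) auto
    then show ?thesis using assms(1) that by (simp add: w_def inner_diff_left inner_sum_left)
  qed
  moreover have "w \<in> span B"
    unfolding w_def using assms(3) by (intro span_diff span_sum span_scale) (auto intro: span_base)
  ultimately have "w \<bullet> w = 0" using orthogonal_to_span[of w B w] by (simp add: orthogonal_def)
  then show ?thesis by (simp add: w_def)
qed

text \<open>Returns from the numbering of all vectors of a level, padded beyond \<open>n\<close>, to
  a sum over the few vectors that belong to one cell.\<close>

lemma sum_reindex_subset:
  fixes n m :: nat
  assumes h: "bij_betw h {..<n} E" and "n \<le> m" "Q \<subseteq> E"
  shows "(\<Sum>i<m. if i < n \<and> h i \<in> Q then \<phi> (h i) else 0) = (\<Sum>b\<in>Q. \<phi> b)"
proof -
  let ?I = "{i \<in> {..<m}. i < n \<and> h i \<in> Q}"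
  have "h ` ?I = Q"
  proof safe
    fix b assume b: "b \<in> Q"
    then obtain i where "i < n" "b = h i" using h assms(3) by (auto simp: bij_betw_def)
    then show "b \<in> h ` ?I" using b assms(2) by (intro image_eqI[of b h i]) auto
  qed
  moreover have "inj_on h ?I" using h unfolding bij_betw_def by (rule inj_on_subset[OF conjunct1]) auto
  ultimately have "bij_betw h ?I Q" by (simp add: bij_betw_def)
  then have "(\<Sum>i\<in>?I. \<phi> (h i)) = (\<Sum>b\<in>Q. \<phi> b)" by (rule sum.reindex_bij_betw)
  then show ?thesis by (simp only: sum.inter_filter finite_lessThan)
qed

text \<open>The difference of two consecutive projections of the same vector lies in the sum of the
  spaces of a cell and of its parent. Nestedness makes the parent a function of the cell, so one
  orthonormal basis of at most \<open>2 * M\<close> vectors serves all points of a cell, and each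
  coefficient is at most the norm of the difference.\<close>

lemma multilevel_of_cells:
  fixes \<kappa> :: "'x \<Rightarrow> 'h::real_inner" and c :: "nat \<Rightarrow> 'x \<Rightarrow> 'c" and F :: "nat \<Rightarrow> 'c \<Rightarrow> 'h set"
  assumes A0: "A0 \<ge> 1" and M: "M \<ge> 1" and D: "D \<ge> 1" and s: "s > 0" and B0: "B0 > 0"
    and cells: "\<And>j. finite (c j ` T)" "\<And>j. card (c j ` T) \<le> A0 * 2 ^ (j * D)"
    and nested: "\<And>j x y. x \<in> T \<Longrightarrow> y \<in> T \<Longrightarrow> c (Suc j) x = c (Suc j) y \<Longrightarrow> c j x = c j y"
    and F: "\<And>j x. x \<in> T \<Longrightarrow> finite (F j (c j x))" "\<And>j x. x \<in> T \<Longrightarrow> card (F j (c j x)) \<le> M"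
    and width: "\<And>j x. x \<in> T \<Longrightarrow> \<exists>z\<in>span (F j (c j x)). norm (\<kappa> x - z) \<le> B0 * 2 powr (- (real j * s))"
    and \<kappa>: "\<And>x. x \<in> T \<Longrightarrow> norm (\<kappa> x) \<le> 1"
  shows "\<exists>e A B. multilevel (\<kappa> ` T) e A D B s"
proof -
  define S where "S j x = orth_proj (span (F j (c j x))) (\<kappa> x)" for j x
  have S: "norm (\<kappa> x - S j x) \<le> B0 * 2 powr (- (real j * s))" if "x \<in> T" for j x
    using width[OF that, of j] orth_proj_span_best[OF F(1)[OF that, of j]]
    unfolding S_def by (meson order_trans)
  have S_in: "S j x \<in> span (F j (c j x))" if "x \<in> T" for j x
    unfolding S_def using orth_proj_span_finite(1)[OF F(1)[OF that]] .
  define d where "d j x = (case j of 0 \<Rightarrow> S 0 x | Suc i \<Rightarrow> S (Suc i) x - S i x)" for j x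
  have sum_d: "(\<Sum>j\<le>J. d j x) = S J x" for J x
    by (induction J) (auto simp: d_def)
  \<comment> \<open>\<open>1 + B0\<close> is for the projection at level 0,
    \<open>B0 + B0 * 2 powr s\<close> for a difference of two consecutive levels.\<close>
  define B1 where "B1 = 1 + B0 + B0 * 2 powr s"
  have B1: "B1 > 0" "B0 \<le> B1" using B0 by (auto simp: B1_def intro!: add_pos_nonneg)
  have d_le: "norm (d j x) \<le> B1 * 2 powr (- (real j * s))" if x: "x \<in> T" for j x
  proof (cases j)
    case 0
    have "norm (S 0 x) \<le> norm (\<kappa> x) + norm (\<kappa> x - S 0 x)"
      using norm_triangle_ineq4[of "\<kappa> x" "\<kappa> x - S 0 x"] by simp
    also have "\<dots> \<le> 1 + B0" using S[OF x, of 0] \<kappa>[OF x] by simp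
    also have "\<dots> \<le> B1" using B0 by (simp add: B1_def)
    finally show ?thesis using 0 by (simp add: d_def)
  next
    case (Suc i)
    have "norm (d j x) \<le> norm (\<kappa> x - S j x) + norm (\<kappa> x - S i x)"
      using norm_triangle_ineq4[of "\<kappa> x - S i x" "\<kappa> x - S j x"] Suc by (simp add: d_def)
    also have "\<dots> \<le> B0 * 2 powr (- (real j * s)) + B0 * 2 powr (- (real i * s))"
      using S[OF x] by (intro add_mono)
    also have "\<dots> = (B0 + B0 * 2 powr s) * 2 powr (- (real j * s))"
    proof -
      have "- (real i * s) = s + - (real j * s)" using Suc by (simp add: algebra_simps)
      then show ?thesis by (simp only: powr_add distrib_right mult.assoc)
    qed
    also have "\<dots> \<le> B1 * 2 powr (- (real j * s))" by (intro mult_right_mono) (auto simp: B1_def)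
    finally show ?thesis .
  qed
  \<comment> \<open>The parent is found from an arbitrary point of the cell; by
    \<open>nested\<close> the choice does not matter. Level 0 has no parent.\<close>
  define G where "G j \<gamma> = F j \<gamma> \<union> (case j of 0 \<Rightarrow> {} | Suc i \<Rightarrow> F i (c i (SOME y. y \<in> T \<and> c j y = \<gamma>)))" for j \<gamma>
  have parent: "c i (SOME y. y \<in> T \<and> c (Suc i) y = c (Suc i) x) = c i x" if "x \<in> T" for i x
  proof -
    have "(SOME y. y \<in> T \<and> c (Suc i) y = c (Suc i) x) \<in> T \<and>
        c (Suc i) (SOME y. y \<in> T \<and> c (Suc i) y = c (Suc i) x) = c (Suc i) x"
      by (rule someI[of _ x]) (use that in auto)
    then show ?thesis using nested that by blast
  qed
  have G: "finite (G j (c j x))" "card (G j (c j x)) \<le> 2 * M" "d j x \<in> span (G j (c j x))" if x: "x \<in> T" for j x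
  proof -
    have "finite (G j (c j x)) \<and> card (G j (c j x)) \<le> 2 * M \<and> d j x \<in> span (G j (c j x))"
    proof (cases j)
      case 0
      then show ?thesis using F[OF x, of 0] S_in[OF x, of 0] by (simp add: G_def d_def)
    next
      case (Suc i)
      have G: "G j (c j x) = F j (c j x) \<union> F i (c i x)" using parent[OF x] Suc by (simp add: G_def)
      have "S j x \<in> span (G j (c j x))" "S i x \<in> span (G j (c j x))"
        using S_in[OF x] span_mono[of _ "G j (c j x)"] unfolding G by blast+
      then have "d j x \<in> span (G j (c j x))" using Suc by (simp add: d_def span_diff)
      moreover have "card (G j (c j x)) \<le> 2 * M"
        using card_Un_le[of "F j (c j x)" "F i (c i x)"] F(2)[OF x, of j] F(2)[OF x, of i] unfolding G by linarith
      ultimately show ?thesis using F(1)[OF x] unfolding G by blast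
    qed
    then show "finite (G j (c j x))" "card (G j (c j x)) \<le> 2 * M" "d j x \<in> span (G j (c j x))" by auto
  qed
  have "\<exists>Bs. finite Bs \<and> card Bs \<le> card (G j \<gamma>) \<and> span Bs = span (G j \<gamma>) \<and>
     (\<forall>b\<in>Bs. \<forall>c\<in>Bs. b \<bullet> c = (if b = c then 1 else 0))" if "finite (G j \<gamma>)" for j \<gamma>
    by (rule ex_orthonormal_basis_span[OF that]) blast
  then obtain Bs where Bs: "\<And>j \<gamma>. finite (G j \<gamma>) \<Longrightarrow> finite (Bs j \<gamma>) \<and> card (Bs j \<gamma>) \<le> card (G j \<gamma>) \<and>
     span (Bs j \<gamma>) = span (G j \<gamma>) \<and> (\<forall>b\<in>Bs j \<gamma>. \<forall>c\<in>Bs j \<gamma>. b \<bullet> c = (if b = c then 1 else 0))"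
    by metis
  define E where "E j = (\<Union>\<gamma>\<in>c j ` T. Bs j \<gamma>)" for j
  have finE: "finite (E j)" for j unfolding E_def using cells(1) G(1) Bs by blast
  define A where "A = A0 * (2 * M)"
  have cardE: "card (E j) \<le> A * 2 ^ (j * D)" for j
  proof -
    have "card (E j) \<le> (\<Sum>\<gamma>\<in>c j ` T. card (Bs j \<gamma>))" unfolding E_def by (rule card_UN_le[OF cells(1)])
    also have "\<dots> \<le> (\<Sum>\<gamma>\<in>c j ` T. 2 * M)" using Bs G by (intro sum_mono) (blast intro: order_trans)
    also have "\<dots> = card (c j ` T) * (2 * M)" by simp
    also have "\<dots> \<le> (A0 * 2 ^ (j * D)) * (2 * M)" using cells(2) by (rule mult_le_mono1)
    finally show ?thesis by (simp add: A_def mult_ac)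
  qed
  have "\<exists>h. bij_betw h {..<card (E j)} (E j)" for j
    using ex_bij_betw_nat_finite[OF finE] by (simp add: lessThan_atLeast0)
  then obtain h where h: "\<And>j. bij_betw (h j) {..<card (E j)} (E j)" by metis
  \<comment> \<open>The expansion format fixes the number of vectors per level; positions beyond the
    actual ones are filled with 0.\<close>
  define e where "e j i = (if i < card (E j) then h j i else 0)" for j i
  have normE: "norm b = 1" if "b \<in> E j" for b j
    using that Bs G unfolding E_def norm_eq_sqrt_inner by fastforce
  have e: "norm (e j i) \<le> 1" for j i
  proof (cases "i < card (E j)")
    case True
    then have "h j i \<in> E j" using bij_betwE[OF h[of j]] by blast
    then show ?thesis using normE[of "h j i" j] True by (simp add: e_def)
  qed (simp add: e_def)
  define B where "B = 2 * M * B1"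
  have "multilevel (\<kappa> ` T) e A D B s"
  proof
    show "1 \<le> A" "0 < B" using A0 M B1 by (auto simp: A_def B_def)
    fix g assume "g \<in> \<kappa> ` T"
    then obtain x where x: "x \<in> T" "g = \<kappa> x" by blast
    define Q where "Q j = Bs j (c j x)" for j
    have Q: "finite (Q j)" "card (Q j) \<le> 2 * M" "d j x \<in> span (Q j)" "Q j \<subseteq> E j"
      "\<And>b c. b \<in> Q j \<Longrightarrow> c \<in> Q j \<Longrightarrow> b \<bullet> c = (if b = c then 1 else 0)" for j
      using Bs[OF G(1)[OF x(1), of j]] G(2,3)[OF x(1), of j] x(1) unfolding Q_def E_def by auto
    define a where "a j i = (if i < card (E j) \<and> h j i \<in> Q j then d j x \<bullet> h j i else 0)" for j i
    have "(\<Sum>i<A * 2 ^ (j * D). a j i *\<^sub>R e j i) = d j x" for j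
    proof -
      have "(\<Sum>i<A * 2 ^ (j * D). a j i *\<^sub>R e j i) =
        (\<Sum>i<A * 2 ^ (j * D). if i < card (E j) \<and> h j i \<in> Q j then (d j x \<bullet> h j i) *\<^sub>R h j i else 0)"
        by (intro sum.cong) (auto simp: a_def e_def)
      also have "\<dots> = (\<Sum>b\<in>Q j. (d j x \<bullet> b) *\<^sub>R b)" by (rule sum_reindex_subset[OF h cardE Q(4)])
      also have "\<dots> = d j x" by (rule orthonormal_expansion[OF Q(1) Q(5) Q(3)])
      finally show ?thesis .
    qed
    then have "norm (g - (\<Sum>j\<le>J. \<Sum>i<A * 2 ^ (j * D). a j i *\<^sub>R e j i)) \<le> B * 2 powr (- (real J * s))" for J
    proof -
      have "norm (g - (\<Sum>j\<le>J. \<Sum>i<A * 2 ^ (j * D). a j i *\<^sub>R e j i)) = norm (\<kappa> x - S J x)"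
        using \<open>\<And>j. (\<Sum>i<A * 2 ^ (j * D). a j i *\<^sub>R e j i) = d j x\<close> by (simp add: x(2) sum_d)
      also have "\<dots> \<le> B0 * 2 powr (- (real J * s))" by (rule S[OF x(1)])
      also have "\<dots> \<le> B * 2 powr (- (real J * s))"
      proof (intro mult_right_mono)
        have "1 * B1 \<le> 2 * M * B1" using M B1 by (intro mult_right_mono) auto
        then show "B0 \<le> B" unfolding B_def using B1 by linarith
      qed auto
      finally show ?thesis .
    qed
    moreover have "(\<Sum>i<A * 2 ^ (j * D). \<bar>a j i\<bar>) \<le> B * 2 powr (- (real j * s))" for j
    proof -
      have "(\<Sum>i<A * 2 ^ (j * D). \<bar>a j i\<bar>) =
        (\<Sum>i<A * 2 ^ (j * D). if i < card (E j) \<and> h j i \<in> Q j then \<bar>d j x \<bullet> h j i\<bar> else 0)"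
        by (intro sum.cong) (auto simp: a_def)
      also have "\<dots> = (\<Sum>b\<in>Q j. \<bar>d j x \<bullet> b\<bar>)" by (rule sum_reindex_subset[OF h cardE Q(4)])
      also have "\<dots> \<le> (\<Sum>b\<in>Q j. norm (d j x))"
      proof (intro sum_mono)
        fix b assume "b \<in> Q j"
        then have "norm b = 1" using Q(4) normE by blast
        then show "\<bar>d j x \<bullet> b\<bar> \<le> norm (d j x)" using Cauchy_Schwarz_ineq2[of "d j x" b] by simp
      qed
      also have "\<dots> = card (Q j) * norm (d j x)" by simp
      also have "\<dots> \<le> (2 * M) * (B1 * 2 powr (- (real j * s)))"
        using Q(2)[of j] d_le[OF x(1), of j] by (intro mult_mono of_nat_mono) auto
      also have "\<dots> = B * 2 powr (- (real j * s))" by (simp add: B_def)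
      finally show ?thesis .
    qed
    ultimately show "\<exists>a::nat \<Rightarrow> nat \<Rightarrow> real.
          (\<forall>j. (\<Sum>i<A * 2 ^ (j * D). \<bar>a j i\<bar>) \<le> B * 2 powr (- (real j * s))) \<and>
          (\<forall>J. norm (g - (\<Sum>j\<le>J. \<Sum>i<A * 2 ^ (j * D). a j i *\<^sub>R e j i)) \<le> B * 2 powr (- (real J * s)))"
      by blast
  qed (use D s e in auto)
  then show ?thesis by blast
qed

section \<open>Taylor bounds\<close>

lemma partial_deriv_has_derivative:
  assumes td: "times_differentiable_on m f S" and bs: "set bs \<subseteq> Basis" "length bs < m" and x: "x \<in> interior S"
  shows "(partial_deriv S bs f has_derivative frechet_derivative (partial_deriv S bs f) (at x within S)) (at x)"
proof -
  have "partial_deriv S bs f differentiable (at x within S)"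
    using td bs x interior_subset unfolding times_differentiable_on_def differentiable_on_def by blast
  then show ?thesis using frechet_derivative_works at_within_interior[OF x] by metis
qed

lemma partial_deriv_has_derivative_sum:
  assumes "times_differentiable_on m f S" "set bs \<subseteq> Basis" "length bs < m" "x \<in> interior S"
  shows "(partial_deriv S bs f has_derivative (\<lambda>h. \<Sum>b\<in>Basis. (h \<bullet> b) * partial_deriv S (b # bs) f x)) (at x)"
proof -
  let ?D = "frechet_derivative (partial_deriv S bs f) (at x within S)"
  note D = partial_deriv_has_derivative[OF assms]
  have lin: "linear ?D" using D by (rule has_derivative_linear)
  have "?D = (\<lambda>h. \<Sum>b\<in>Basis. (h \<bullet> b) * partial_deriv S (b # bs) f x)"
  proof
    fix h
    have "?D h = ?D (\<Sum>b\<in>Basis. (h \<bullet> b) *\<^sub>R b)" by (simp add: euclidean_representation)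
    also have "\<dots> = (\<Sum>b\<in>Basis. (h \<bullet> b) * ?D b)"
      using lin by (simp add: linear_sum linear_scale)
    finally show "?D h = (\<Sum>b\<in>Basis. (h \<bullet> b) * partial_deriv S (b # bs) f x)" by simp
  qed
  then show ?thesis using D by (simp only:)
qed

text \<open>Linearity passes to the derivative through its uniqueness, which holds at interior
  points. Differentiating once more requires linearity of the lower derivative in a neighbourhood,
  so the point is arbitrary in the induction.\<close>

lemma linear_partial_deriv:
  fixes g :: "'h::real_vector \<Rightarrow> 'a::euclidean_space \<Rightarrow> real"
  assumes lin: "\<And>x. x \<in> S \<Longrightarrow> linear (\<lambda>u. g u x)" and td: "\<And>u. times_differentiable_on m (g u) S"
  shows "set bs \<subseteq> Basis \<Longrightarrow> length bs \<le> m \<Longrightarrow> y \<in> interior S \<Longrightarrow> linear (\<lambda>u. partial_deriv S bs (g u) y)"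
proof (induction bs arbitrary: y)
  case Nil
  then show ?case using lin interior_subset by auto
next
  case (Cons b bs)
  then have bs: "set bs \<subseteq> Basis" "length bs < m" by auto
  let ?p = "\<lambda>u. partial_deriv S bs (g u)"
  let ?D = "\<lambda>u. frechet_derivative (?p u) (at y within S)"
  have D: "(?p u has_derivative ?D u) (at y)" for u
    by (rule partial_deriv_has_derivative[OF td bs Cons.prems(3)])
  have lin_p: "linear (\<lambda>u. ?p u x)" if "x \<in> interior S" for x
    using Cons.IH bs that by simp
  show ?case unfolding partial_deriv.simps
  proof (rule linearI)
    fix u v
    have "((\<lambda>x. ?p u x + ?p v x) has_derivative (\<lambda>h. ?D u h + ?D v h)) (at y)"
      by (intro has_derivative_add D)
    then have "(?p (u + v) has_derivative (\<lambda>h. ?D u h + ?D v h)) (at y)"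
      by (rule has_derivative_transform_within_open[OF _ open_interior Cons.prems(3)])
        (simp add: linear_add[OF lin_p])
    then show "?D (u + v) b = ?D u b + ?D v b"
      using has_derivative_unique[OF D] by metis
  next
    fix c u
    have "((\<lambda>x. c * ?p u x) has_derivative (\<lambda>h. c * ?D u h)) (at y)"
      by (intro has_derivative_mult_right D)
    then have "(?p (c *\<^sub>R u) has_derivative (\<lambda>h. c * ?D u h)) (at y)"
      by (rule has_derivative_transform_within_open[OF _ open_interior Cons.prems(3)])
        (simp add: linear_scale[OF lin_p])
    then show "?D (c *\<^sub>R u) b = c *\<^sub>R ?D u b"
      using has_derivative_unique[OF D] by (metis real_scaleR_def)
  qed
qed

text \<open>Induction downwards from the derivatives of order \<open>m\<close>, where the Lipschitz
  condition applies; \<open>l\<close> is the distance from that order. Each step is the mean value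
  inequality along the segment from \<open>y\<close>, where the derivative vanishes, and costs a
  factor \<open>DIM('a) * norm (x - y)\<close>.\<close>

lemma partial_deriv_taylor_bound:
  fixes f :: "'a::euclidean_space \<Rightarrow> real"
  assumes td: "times_differentiable_on m f S" and "\<Lambda> \<ge> 0" and "\<alpha> > 0"
    and lip: "\<And>bs y z. set bs \<subseteq> Basis \<Longrightarrow> length bs = m \<Longrightarrow> y \<in> S \<Longrightarrow> z \<in> S \<Longrightarrow>
        \<bar>partial_deriv S bs f y - partial_deriv S bs f z\<bar> \<le> \<Lambda> * norm (y - z) powr \<alpha>"
    and zero: "\<And>bs. set bs \<subseteq> Basis \<Longrightarrow> length bs \<le> m \<Longrightarrow> partial_deriv S bs f y = 0"
  shows "l \<le> m \<Longrightarrow> set bs \<subseteq> Basis \<Longrightarrow> length bs = m - l \<Longrightarrow> closed_segment y x \<subseteq> interior S \<Longrightarrow>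
    \<bar>partial_deriv S bs f x\<bar> \<le> \<Lambda> * DIM('a) ^ l * norm (x - y) powr \<alpha> * norm (x - y) ^ l"
proof (induction l arbitrary: bs x)
  case 0
  then have "x \<in> S" "y \<in> S" using interior_subset[of S] ends_in_segment[of x y] ends_in_segment[of y x] by blast+
  then show ?case using lip[of bs x y] zero[of bs] 0 by simp
next
  case (Suc l)
  define W where "W = \<Lambda> * DIM('a) ^ l * norm (x - y) powr \<alpha> * norm (x - y) ^ l"
  have W: "W \<ge> 0" using assms(2) by (simp add: W_def)
  let ?D = "\<lambda>z h. \<Sum>b\<in>Basis. (h \<bullet> b) * partial_deriv S (b # bs) f z"
  have bs: "length bs < m" using Suc.prems by simp
  have "norm (partial_deriv S bs f x - partial_deriv S bs f y) \<le> (DIM('a) * W) * norm (x - y)"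
  proof (rule differentiable_bound[OF convex_closed_segment[of y x]])
    fix z assume z: "z \<in> closed_segment y x"
    then have zi: "z \<in> interior S" using Suc.prems by auto
    show "(partial_deriv S bs f has_derivative ?D z) (at z within closed_segment y x)"
      by (rule has_derivative_at_withinI[OF partial_deriv_has_derivative_sum[OF td Suc.prems(2) bs zi]])
    have seg: "closed_segment y z \<subseteq> interior S"
      using z Suc.prems(4) by (meson ends_in_segment(1) order_trans subset_closed_segment)
    have nz: "norm (z - y) \<le> norm (x - y)"
      using z segment_bound1[of z y x] by (simp add: norm_minus_commute)
    have pb: "\<bar>partial_deriv S (b # bs) f z\<bar> \<le> W" if "b \<in> Basis" for b
    proof -
      have "\<bar>partial_deriv S (b # bs) f z\<bar> \<le> \<Lambda> * DIM('a) ^ l * norm (z - y) powr \<alpha> * norm (z - y) ^ l"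
        using Suc.prems that seg by (intro Suc.IH) auto
      also have "\<dots> \<le> W" unfolding W_def using nz assms(2,3)
        by (intro mult_mono power_mono powr_mono2) auto
      finally show ?thesis .
    qed
    show "onorm (?D z) \<le> DIM('a) * W"
    proof (rule onorm_bound)
      fix h :: 'a
      have "norm (?D z h) \<le> (\<Sum>b\<in>(Basis::'a set). norm h * W)"
        using pb W by (intro order_trans[OF norm_sum] sum_mono) (auto simp: abs_mult Basis_le_norm intro!: mult_mono)
      then show "norm (?D z h) \<le> DIM('a) * W * norm h" by (simp add: mult_ac)
    qed (use W in simp)
  qed auto
  also have "partial_deriv S bs f y = 0" using zero[of bs] Suc.prems by simp
  finally show ?case by (simp add: W_def mult_ac)
qed

lemma embedding_lipschitz:
  fixes S :: "'a::euclidean_space set" and ev :: "'h::{real_inner,complete_space} \<Rightarrow> 'a \<Rightarrow> real"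
  assumes "continuously_embedded_lip s S ev"
  shows "\<exists>c>0. \<forall>u bs y z. set bs \<subseteq> Basis \<longrightarrow> length bs = lip_order s \<longrightarrow> y \<in> S \<longrightarrow> z \<in> S \<longrightarrow>
     \<bar>partial_deriv S bs (ev u) y - partial_deriv S bs (ev u) z\<bar> \<le> c * norm u * norm (y - z) powr (s - lip_order s)"
proof -
  obtain c where c: "c > 0" "\<And>u. lip_seminorm s S (ev u) \<le> ennreal (c * norm u)"
    using assms unfolding continuously_embedded_lip_def by blast
  have "\<bar>partial_deriv S bs (ev u) y - partial_deriv S bs (ev u) z\<bar> \<le> c * norm u * norm (y - z) powr (s - lip_order s)"
    if "set bs \<subseteq> Basis" "length bs = lip_order s" "y \<in> S" "z \<in> S" for u bs y z
  proof (cases "y = z")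
    case False
    let ?q = "\<bar>partial_deriv S bs (ev u) y - partial_deriv S bs (ev u) z\<bar> / norm (y - z) powr (s - lip_order s)"
    have "ennreal ?q \<le> (SUP (y, z)\<in>{(y, z). y \<in> S \<and> z \<in> S \<and> y \<noteq> z}.
          ennreal (\<bar>partial_deriv S bs (ev u) y - partial_deriv S bs (ev u) z\<bar> / norm (y - z) powr (s - lip_order s)))"
      using that False by (intro SUP_upper2[of "(y, z)"]) auto
    also have "\<dots> \<le> lip_seminorm s S (ev u)"
      unfolding lip_seminorm_def Let_def using that by (intro SUP_upper) auto
    also have "\<dots> \<le> ennreal (c * norm u)" by (rule c)
    finally have "?q \<le> c * norm u" using c(1) by (simp add: ennreal_le_iff)
    then show ?thesis using False by (simp add: divide_le_eq)
  qed simp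
  then show ?thesis using c(1) by blast
qed

text \<open>The functionals are all partial derivatives of order at most \<open>m\<close> at
  \<open>y\<close>. If they annihilate \<open>u\<close>, Taylor's bound controls the value of
  \<open>u\<close> at \<open>x\<close>, which is the inner product with \<open>K x\<close>, so
  \<open>finite_width\<close> applies. Their number does not depend on \<open>y\<close>.\<close>

lemma local_width:
  fixes S :: "'a::euclidean_space set" and ev :: "'h::{real_inner,complete_space} \<Rightarrow> 'a \<Rightarrow> real"
  assumes rkhs: "rkhs S k ev" and emb: "continuously_embedded_lip s S ev" and s: "s > 0"
  shows "\<exists>C>0. \<exists>M\<ge>1. \<forall>y\<in>interior S. \<exists>F. finite F \<and> card F \<le> M \<and>
     (\<forall>x. closed_segment y x \<subseteq> interior S \<longrightarrow> (\<exists>z\<in>span F. norm (kernel_at S k ev x - z) \<le> C * norm (x - y) powr s))"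
proof -
  interpret rkhs_space S k ev by standard (rule rkhs)
  define m where "m = lip_order s"
  define \<alpha> where "\<alpha> = s - m"
  have \<alpha>: "\<alpha> > 0"
  proof -
    have "real m = of_int (\<lceil>s\<rceil> - 1)" unfolding m_def lip_order_def using s by simp
    then show ?thesis unfolding \<alpha>_def by linarith
  qed
  obtain c where c: "c > 0" "\<And>u bs y z. set bs \<subseteq> Basis \<Longrightarrow> length bs = m \<Longrightarrow> y \<in> S \<Longrightarrow> z \<in> S \<Longrightarrow>
     \<bar>partial_deriv S bs (ev u) y - partial_deriv S bs (ev u) z\<bar> \<le> c * norm u * norm (y - z) powr \<alpha>"
    using embedding_lipschitz[OF emb] unfolding m_def \<alpha>_def by blast
  have td: "times_differentiable_on m (ev u) S" for u
    using emb unfolding continuously_embedded_lip_def lip_class_def m_def by blast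
  define I where "I = {bs :: 'a list. set bs \<subseteq> Basis \<and> length bs \<le> m}"
  have I: "finite I" unfolding I_def by (rule finite_lists_length_le) (rule finite_Basis)
  have "[] \<in> I" by (simp add: I_def)
  then have M: "card I \<ge> 1" using I by (metis One_nat_def Suc_leI card_gt_0_iff empty_iff)
  define C where "C = c * DIM('a) ^ m"
  have C: "C > 0" using c by (simp add: C_def)
  have "\<exists>F. finite F \<and> card F \<le> card I \<and>
     (\<forall>x. closed_segment y x \<subseteq> interior S \<longrightarrow> (\<exists>z\<in>span F. norm (K x - z) \<le> C * norm (x - y) powr s))"
    if y: "y \<in> interior S" for y
  proof -
    have lin: "linear (\<lambda>u. partial_deriv S bs (ev u) y)" if "bs \<in> I" for bs
      using that y by (intro linear_partial_deriv[OF linear_ev td]) (auto simp: I_def)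
    obtain F where F: "finite F" "card F \<le> card I"
      "\<forall>k. \<forall>\<epsilon>\<ge>0. (\<forall>u. (\<forall>bs\<in>I. partial_deriv S bs (ev u) y = 0) \<longrightarrow> \<bar>u \<bullet> k\<bar> \<le> \<epsilon> * norm u) \<longrightarrow>
         (\<exists>z\<in>span F. norm (k - z) \<le> \<epsilon>)"
      using finite_width[OF I, of "\<lambda>bs u. partial_deriv S bs (ev u) y", OF lin] by blast
    have "\<exists>z\<in>span F. norm (K x - z) \<le> C * norm (x - y) powr s" if seg: "closed_segment y x \<subseteq> interior S" for x
    proof -
      have x: "x \<in> S" using seg interior_subset by (meson ends_in_segment(2) subsetD)
      have "\<bar>u \<bullet> K x\<bar> \<le> C * norm (x - y) powr s * norm u" if u: "\<forall>bs\<in>I. partial_deriv S bs (ev u) y = 0" for u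
      proof -
        have "\<bar>partial_deriv S [] (ev u) x\<bar> \<le>
          (c * norm u) * DIM('a) ^ m * norm (x - y) powr \<alpha> * norm (x - y) ^ m"
          using td c \<alpha> seg u by (intro partial_deriv_taylor_bound) (auto simp: I_def)
        also have "\<dots> = C * (norm (x - y) powr \<alpha> * norm (x - y) ^ m) * norm u" by (simp add: C_def)
        also have "norm (x - y) powr \<alpha> * norm (x - y) ^ m = norm (x - y) powr s"
          by (cases "x = y") (auto simp: \<alpha>_def powr_realpow[symmetric] powr_add[symmetric])
        finally show ?thesis using ev_eq_inner[OF x] by simp
      qed
      then show ?thesis using F(3) C by (simp add: mult_nonneg_nonneg)
    qed
    then show ?thesis using F by blast
  qed
  then show ?thesis using C M by (intro exI[of _ C] conjI exI[of _ "card I"]) auto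
qed

section \<open>Domains with smooth boundary\<close>

text \<open>Second order differentiability makes the first partial derivatives continuous, hence
  bounded on the compact ball, and the mean value inequality applies on its convex interior and
  boundary alike.\<close>

lemma smooth_imp_lipschitz_on_cball:
  fixes g :: "'a::euclidean_space \<Rightarrow> real"
  assumes td: "\<And>m. times_differentiable_on m g UNIV"
  shows "\<exists>L\<ge>0. \<forall>x\<in>cball p r. \<forall>y\<in>cball p r. \<bar>g x - g y\<bar> \<le> L * norm (x - y)"
proof -
  have "\<exists>W\<ge>0. \<forall>x\<in>cball p r. \<bar>partial_deriv UNIV [b] g x\<bar> \<le> W" if b: "b \<in> Basis" for b
  proof -
    have "partial_deriv UNIV [b] g differentiable_on UNIV"
      using td[of 2, unfolded times_differentiable_on_def, rule_format, of "[b]"] b by simp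
    then have "continuous_on (cball p r) (partial_deriv UNIV [b] g)"
      by (meson differentiable_imp_continuous_on continuous_on_subset subset_UNIV)
    then have "bounded (partial_deriv UNIV [b] g ` cball p r)"
      by (intro compact_imp_bounded compact_continuous_image) auto
    then obtain W where W: "\<forall>x\<in>cball p r. norm (partial_deriv UNIV [b] g x) \<le> W"
      unfolding bounded_iff by blast
    then have "\<forall>x\<in>cball p r. \<bar>partial_deriv UNIV [b] g x\<bar> \<le> max W 0" by fastforce
    then show ?thesis by (intro exI[of _ "max W 0"]) simp
  qed
  then obtain W where W: "\<And>b. b \<in> Basis \<Longrightarrow> W b \<ge> 0"
    "\<And>b x. b \<in> Basis \<Longrightarrow> x \<in> cball p r \<Longrightarrow> \<bar>partial_deriv UNIV [b] g x\<bar> \<le> W b" by metis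
  define L where "L = (\<Sum>b\<in>Basis. W b)"
  have L: "L \<ge> 0" unfolding L_def using W(1) by (rule sum_nonneg)
  have "norm (g x - g y) \<le> L * norm (x - y)" if "x \<in> cball p r" "y \<in> cball p r" for x y
  proof (rule differentiable_bound[OF convex_cball])
    fix z assume z: "z \<in> cball p r"
    let ?D = "\<lambda>h. \<Sum>b\<in>Basis. (h \<bullet> b) * partial_deriv UNIV [b] g z"
    show "(g has_derivative ?D) (at z within cball p r)"
      using partial_deriv_has_derivative_sum[OF td[of 1], of "[]" z] by (auto intro: has_derivative_at_withinI)
    show "onorm ?D \<le> L"
    proof (rule onorm_bound)
      fix h :: 'a
      have "norm (?D h) \<le> (\<Sum>b\<in>Basis. norm h * W b)"
        using W z by (intro order_trans[OF norm_sum] sum_mono) (auto simp: abs_mult Basis_le_norm intro!: mult_mono)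
      also have "\<dots> = L * norm h" by (simp add: L_def sum_distrib_left mult.commute)
      finally show "norm (?D h) \<le> L * norm h" .
    qed (rule L)
  qed (use that in auto)
  then show ?thesis using L by auto
qed

text \<open>
  Moving up by \<open>(L + 1) h\<close> outweighs what a horizontal displacement of at most \<open>h\<close> can change in the
  height above the graph.
\<close>

lemma graph_domain_segments:
  fixes S :: "'a::euclidean_space set"
  assumes r: "r > 0" and b: "norm b = 1" and g: "\<And>x t. g (x + t *\<^sub>R b) = g x"
    and lip: "\<And>x y. x \<in> cball p r \<Longrightarrow> y \<in> cball p r \<Longrightarrow> \<bar>g x - g y\<bar> \<le> L * norm (x - y)" and L: "L \<ge> 0"
    and graph: "\<And>x. x \<in> ball p r \<Longrightarrow> x \<in> interior S \<longleftrightarrow> g x < x \<bullet> b"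
    and h: "0 < h" "(L + 1) * h < r / 2" and z: "z \<in> ball p (r / 2)" and x: "x \<in> ball p (r / 2)" "x \<in> interior S"
    and xz: "norm (x - z) \<le> h"
  shows "closed_segment x (z + h *\<^sub>R ((L + 1) *\<^sub>R b)) \<subseteq> interior S"
proof
  fix u assume "u \<in> closed_segment x (z + h *\<^sub>R ((L + 1) *\<^sub>R b))"
  then obtain t where t: "0 \<le> t" "t \<le> 1" "u = (1 - t) *\<^sub>R x + t *\<^sub>R (z + h *\<^sub>R ((L + 1) *\<^sub>R b))"
    by (auto simp: closed_segment_def)
  define w where "w = (1 - t) *\<^sub>R x + t *\<^sub>R z"
  have u: "u = w + (t * h * (L + 1)) *\<^sub>R b" by (simp add: t(3) w_def algebra_simps)
  have w: "w \<in> ball p (r / 2)"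
    unfolding w_def using convex_ball[of p "r / 2"] x(1) z t by (intro convexD) auto
  have wx: "w - x = t *\<^sub>R (z - x)" by (simp add: w_def algebra_simps)
  have nwx: "norm (w - x) \<le> t * h"
    unfolding wx using t xz by (simp add: norm_minus_commute mult_left_mono)
  have th: "t * h * (L + 1) \<le> h * (L + 1)" using t h L by (intro mult_right_mono) (auto simp: mult_left_le_one_le)
  have "dist p u \<le> dist p w + dist w u" by (rule dist_triangle)
  also have "dist w u = t * h * (L + 1)" unfolding u using b t h L by (simp add: dist_norm)
  also have "dist p w + t * h * (L + 1) < r" using w th h by (simp add: mult.commute)
  finally have ub: "u \<in> ball p r" by simp
  have "g u = g w" unfolding u by (rule g)
  also have "\<bar>g w - g x\<bar> \<le> L * norm (w - x)" using w x r by (intro lip) auto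
  then have "g w \<le> g x + L * (t * h)"
    using mult_left_mono[OF nwx L] by linarith
  finally have 1: "g u \<le> g x + L * (t * h)" .
  have "x \<in> ball p r" using x(1) r by auto
  then have 2: "g x < x \<bullet> b" using graph x(2) by blast
  have "\<bar>(w - x) \<bullet> b\<bar> \<le> t * h" using Cauchy_Schwarz_ineq2[of "w - x" b] nwx b by simp
  then have "x \<bullet> b - t * h \<le> w \<bullet> b" by (simp add: inner_diff_left)
  moreover have "u \<bullet> b = w \<bullet> b + t * h * (L + 1)"
    unfolding u using b by (simp add: inner_add_left dot_square_norm)
  ultimately have "x \<bullet> b + L * (t * h) \<le> u \<bullet> b" by (simp add: algebra_simps)
  then have "g u < u \<bullet> b" using 1 2 by linarith
  then show "u \<in> interior S" using graph[OF ub] by simp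
qed

text \<open>The segments from all \<open>x\<close> within \<open>h\<close> of \<open>z\<close> end
  in the same point \<open>z + h v\<close>, with \<open>v\<close> depending on \<open>p\<close>
  only. This gives a whole cell a common base point: \<open>v\<close> is 0 near interior points and
  points into the domain near the boundary.\<close>

lemma local_segments:
  fixes S :: "'a::euclidean_space set"
  assumes sb: "smooth_boundary S" and p: "p \<in> closure S"
  shows "\<exists>r>0. \<exists>h0>0. \<exists>v. \<forall>h z x. 0 < h \<longrightarrow> h \<le> h0 \<longrightarrow> z \<in> ball p r \<longrightarrow> x \<in> ball p r \<longrightarrow> x \<in> interior S \<longrightarrow>
     norm (x - z) \<le> h \<longrightarrow> closed_segment x (z + h *\<^sub>R v) \<subseteq> interior S"
proof (cases "p \<in> interior S")
  case True
  then obtain r where r: "r > 0" "ball p r \<subseteq> interior S"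
    using open_contains_ball[of "interior S"] by auto
  have "closed_segment x (z + h *\<^sub>R 0) \<subseteq> interior S" if "x \<in> ball p r" "z \<in> ball p r" for x z and h :: real
    using closed_segment_subset[OF that(1) that(2) convex_ball] r(2) by auto
  then show ?thesis using r(1) by (intro exI[of _ r] exI[of _ 1] exI[of _ 0] conjI) auto
next
  case False
  then have "p \<in> frontier S" using p by (simp add: frontier_def)
  then obtain r b g where r: "r > 0" and b: "b \<in> Basis \<or> - b \<in> Basis"
    and g: "\<And>m. times_differentiable_on m g UNIV" "\<And>x t. g (x + t *\<^sub>R b) = g x"
    and graph: "\<And>x. x \<in> ball p r \<Longrightarrow> x \<in> interior S \<longleftrightarrow> g x < x \<bullet> b"
    using sb unfolding smooth_boundary_def by metis
  have nb: "norm b = 1" using b norm_Basis norm_minus_cancel[of b] by metis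
  obtain L where L: "L \<ge> 0" "\<And>x y. x \<in> cball p r \<Longrightarrow> y \<in> cball p r \<Longrightarrow> \<bar>g x - g y\<bar> \<le> L * norm (x - y)"
    using smooth_imp_lipschitz_on_cball[OF g(1)] by blast
  \<comment> \<open>The shift has length \<open>(L + 1) * h\<close>, here at most
    \<open>r / 4\<close>, so a segment starting in the ball of radius \<open>r / 2\<close> stays
    where the graph description holds.\<close>
  define h0 where "h0 = (r / 4) / (L + 1)"
  have h0: "h0 > 0" using r L by (simp add: h0_def)
  have h: "(L + 1) * h < r / 2" if "h \<le> h0" for h
  proof -
    have "(L + 1) * h \<le> (L + 1) * h0" using that L by (intro mult_left_mono) auto
    also have "\<dots> = r / 4"
    proof -
      have "L + 1 \<noteq> 0" using L(1) by linarith
      then have "h0 * (L + 1) = r / 4" using nonzero_eq_divide_eq h0_def by blast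
      then show ?thesis by (simp only: mult.commute)
    qed
    finally show ?thesis using r by linarith
  qed
  have "closed_segment x (z + h *\<^sub>R ((L + 1) *\<^sub>R b)) \<subseteq> interior S"
    if "0 < h" "h \<le> h0" "z \<in> ball p (r / 2)" "x \<in> ball p (r / 2)" "x \<in> interior S" "norm (x - z) \<le> h" for h z x
    by (rule graph_domain_segments[OF r nb g(2) L(2,1) graph that(1) h[OF that(2)] that(3-6)])
  then show ?thesis using r h0
    by (intro exI[of _ "r / 2"] exI[of _ h0] exI[of _ "(L + 1) *\<^sub>R b"] conjI) auto
qed

text \<open>Compactness of the closure leaves finitely many directions and one common scale
  \<open>h0\<close>.\<close>

lemma finite_segment_cover:
  fixes S :: "'a::euclidean_space set"
  assumes "bounded S" "smooth_boundary S"
  shows "\<exists>P (\<rho>::'a \<Rightarrow> real) v h0. finite P \<and> h0 > 0 \<and> closure S \<subseteq> (\<Union>p\<in>P. ball p (\<rho> p)) \<and>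
    (\<forall>p\<in>P. \<forall>h z x. 0 < h \<longrightarrow> h \<le> h0 \<longrightarrow> z \<in> ball p (\<rho> p) \<longrightarrow> x \<in> ball p (\<rho> p) \<longrightarrow> x \<in> interior S \<longrightarrow>
     norm (x - z) \<le> h \<longrightarrow> closed_segment x (z + h *\<^sub>R v p) \<subseteq> interior S)"
proof -
  obtain \<rho> h0 v where \<rho>: "\<And>p. p \<in> closure S \<Longrightarrow> \<rho> p > (0::real)" and h0: "\<And>p. p \<in> closure S \<Longrightarrow> h0 p > (0::real)"
    and seg: "\<And>p h z x. p \<in> closure S \<Longrightarrow> 0 < h \<Longrightarrow> h \<le> h0 p \<Longrightarrow> z \<in> ball p (\<rho> p) \<Longrightarrow> x \<in> ball p (\<rho> p) \<Longrightarrow>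
     x \<in> interior S \<Longrightarrow> norm (x - z) \<le> h \<Longrightarrow> closed_segment x (z + h *\<^sub>R v p) \<subseteq> interior S"
    using local_segments[OF assms(2)] by metis
  have "compact (closure S)" using assms(1) by simp
  then obtain P where P: "P \<subseteq> closure S" "finite P" "closure S \<subseteq> (\<Union>p\<in>P. ball p (\<rho> p))"
    by (rule compactE_image[of _ "closure S" "\<lambda>p. ball p (\<rho> p)"]) (use \<rho> in auto)
  define H where "H = Min (insert 1 (h0 ` P))"
  have H: "H > 0" unfolding H_def using P h0 by (subst Min_gr_iff) auto
  have Hle: "H \<le> h0 p" if "p \<in> P" for p unfolding H_def using P that by (intro Min_le) auto
  show ?thesis
    using P H by (intro exI[of _ P] exI[of _ \<rho>] exI[of _ v] exI[of _ H] conjI ballI allI impI seg)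
      (auto dest: order_trans[OF _ Hle] simp del: mem_ball)
qed

text \<open>A boundary point lies on the graph, and any small step in direction \<open>b\<close>
  leads strictly above it, that is, into the interior.\<close>

lemma subset_closure_interior:
  fixes S :: "'a::euclidean_space set"
  assumes "smooth_boundary S" shows "S \<subseteq> closure (interior S)"
proof
  fix p assume p: "p \<in> S"
  show "p \<in> closure (interior S)"
  proof (cases "p \<in> interior S")
    case False
    then have fr: "p \<in> frontier S" using p closure_subset by (auto simp: frontier_def)
    then obtain r b g where r: "r > 0" and b: "b \<in> Basis \<or> - b \<in> Basis"
      and g: "\<And>x t. g (x + t *\<^sub>R b) = g x"
      and graph: "\<And>x. x \<in> ball p r \<Longrightarrow> (x \<in> interior S \<longleftrightarrow> g x < x \<bullet> b) \<and> (x \<in> frontier S \<longleftrightarrow> x \<bullet> b = g x)"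
      using assms unfolding smooth_boundary_def by metis
    have nb: "norm b = 1" using b norm_Basis norm_minus_cancel[of b] by metis
    have pb: "p \<bullet> b = g p" using graph[of p] r fr by simp
    show ?thesis unfolding closure_approachable
    proof (intro allI impI)
      fix e :: real assume e: "e > 0"
      define t where "t = min r e / 2"
      have t: "t > 0" "t < r" "t < e" using r e by (auto simp: t_def)
      have "p + t *\<^sub>R b \<in> ball p r" using t nb by (simp add: dist_norm)
      moreover have "g (p + t *\<^sub>R b) < (p + t *\<^sub>R b) \<bullet> b"
        using t pb nb by (simp add: g inner_add_left dot_square_norm)
      ultimately have "p + t *\<^sub>R b \<in> interior S" using graph by blast
      moreover have "dist (p + t *\<^sub>R b) p < e" using t nb by (simp add: dist_norm)
      ultimately show "\<exists>y\<in>interior S. dist y p < e" by blast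
    qed
  qed (use closure_subset in blast)
qed

text \<open>Approximate the finitely many vectors of a combination by elements of \<open>K2\<close>
  and keep the coefficients. This later replaces the domain by its interior.\<close>

lemma closed_abs_hull_mono_closure:
  fixes K1 K2 :: "'h::real_normed_vector set"
  assumes "K1 \<subseteq> closure K2" shows "closed_abs_hull K1 \<subseteq> closed_abs_hull K2"
  unfolding closed_abs_hull_def[of K1]
proof (rule closure_minimal)
  show "closed (closed_abs_hull K2)" by (simp add: closed_abs_hull_def)
  show "{\<Sum>g\<in>F. c g *\<^sub>R g |F c. finite F \<and> F \<subseteq> K1 \<and> (\<Sum>g\<in>F. \<bar>c g\<bar>) \<le> 1} \<subseteq> closed_abs_hull K2"
  proof safe
    fix F :: "'h set" and c :: "'h \<Rightarrow> real" assume F: "finite F" "F \<subseteq> K1" "(\<Sum>g\<in>F. \<bar>c g\<bar>) \<le> 1"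
    have "\<forall>g\<in>F. \<exists>f. (\<forall>n. f n \<in> K2) \<and> f \<longlonglongrightarrow> g"
      using F(2) assms unfolding closure_sequential[symmetric] by blast
    then obtain f where f: "\<And>g n. g \<in> F \<Longrightarrow> f g n \<in> K2" "\<And>g. g \<in> F \<Longrightarrow> f g \<longlonglongrightarrow> g" by metis
    have lim: "(\<lambda>n. \<Sum>g\<in>F. c g *\<^sub>R f g n) \<longlonglongrightarrow> (\<Sum>g\<in>F. c g *\<^sub>R g)"
      by (intro tendsto_sum tendsto_scaleR tendsto_const f)
    have "(\<Sum>g\<in>F. c g *\<^sub>R f g n) \<in> closed_abs_hull K2" for n
      using F f(1) by (intro sum_in_closed_abs_hull) auto
    then show "(\<Sum>g\<in>F. c g *\<^sub>R g) \<in> closed_abs_hull K2"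
      using closed_sequentially[OF _ _ lim] by (simp add: closed_abs_hull_def)
  qed
qed

lemma entropy_number_mono: "A \<subseteq> B \<Longrightarrow> entropy_number n A \<le> entropy_number n B"
  unfolding entropy_number_def by (intro Inf_superset_mono) blast

section \<open>Dyadic cells, continuity of the kernel map and the entropy bound\<close>

lemma floor_mult_two_div: "\<lfloor>t::real\<rfloor> = \<lfloor>2 * t\<rfloor> div 2"
  using floor_divide_real_eq_div[of 2 "2 * t"] by simp

lemma abs_diff_le_of_floor_eq:
  fixes a b c :: real
  assumes "\<lfloor>c * a\<rfloor> = \<lfloor>c * b\<rfloor>" "c > 0" shows "\<bar>a - b\<bar> \<le> 1 / c"
proof -
  have "\<bar>c * a - c * b\<bar> \<le> 1" using assms(1) by linarith
  then have "c * \<bar>a - b\<bar> \<le> 1" using assms(2) by (simp add: abs_mult right_diff_distrib[symmetric])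
  then show ?thesis using assms(2) by (simp add: field_simps)
qed

text \<open>The squared distance of two kernel functions expands into three kernel values, which
  cancel in the limit.\<close>

lemma kernel_at_tendsto:
  fixes S :: "'a::metric_space set" and ev :: "'h::{real_inner,complete_space} \<Rightarrow> 'a \<Rightarrow> real"
  assumes rkhs: "rkhs S k ev" and cont: "continuous_on (S \<times> S) (\<lambda>(x, y). k x y)"
    and f: "\<And>n. f n \<in> S" "f \<longlonglongrightarrow> x" and x: "x \<in> S"
  shows "(\<lambda>n. kernel_at S k ev (f n)) \<longlonglongrightarrow> kernel_at S k ev x"
proof -
  interpret rkhs_space S k ev by standard (rule rkhs)
  have lim: "(\<lambda>n. k (a n) (b n)) \<longlonglongrightarrow> k x x"
    if "\<And>n. a n \<in> S" "\<And>n. b n \<in> S" "a \<longlonglongrightarrow> x" "b \<longlonglongrightarrow> x" for a b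
  proof -
    have "(\<lambda>n. (a n, b n)) \<longlonglongrightarrow> (x, x)" by (intro tendsto_Pair that)
    then show ?thesis
      using continuous_on_tendsto_compose[OF cont, of "\<lambda>n. (a n, b n)" "(x, x)" sequentially] that x by simp
  qed
  have "(norm (K (f n) - K x))\<^sup>2 = k (f n) (f n) - 2 * k x (f n) + k x x" for n
  proof -
    have "(norm (K (f n) - K x))\<^sup>2 = K (f n) \<bullet> K (f n) - 2 * (K (f n) \<bullet> K x) + K x \<bullet> K x"
      by (simp add: power2_norm_eq_inner inner_diff_left inner_diff_right inner_commute[of "K x" "K (f n)"])
    then show ?thesis using kernel_at_inner f(1) x by simp
  qed
  moreover have "(\<lambda>n. k (f n) (f n) - 2 * k x (f n) + k x x) \<longlonglongrightarrow> k x x - 2 * k x x + k x x"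
    using f x by (intro tendsto_intros lim) auto
  ultimately have "(\<lambda>n. (norm (K (f n) - K x))\<^sup>2) \<longlonglongrightarrow> 0" by simp
  then have "(\<lambda>n. sqrt ((norm (K (f n) - K x))\<^sup>2)) \<longlonglongrightarrow> sqrt 0" by (rule tendsto_real_sqrt)
  then have "(\<lambda>n. K (f n) - K x) \<longlonglongrightarrow> 0" by (simp add: tendsto_norm_zero_iff)
  then show ?thesis by (simp add: LIM_zero_iff)
qed

text \<open>On a cell of level \<open>j\<close> all points see one base point at distance
  \<open>O(2^-j)\<close> along interior segments, so \<open>local_width\<close> provides one finite
  set per cell with error \<open>O(2^(-j s))\<close>.\<close>

lemma kernel_multilevel:
  fixes S :: "'a::euclidean_space set" and ev :: "'h::{real_inner,complete_space} \<Rightarrow> 'a \<Rightarrow> real"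
  assumes rkhs: "rkhs S k ev" and k1: "\<And>x. x \<in> S \<Longrightarrow> k x x \<le> 1" and bdd: "bounded S" and sb: "smooth_boundary S"
    and s: "s > 0" and emb: "continuously_embedded_lip s S ev"
  shows "\<exists>e A B. multilevel (kernel_at S k ev ` interior S) e A DIM('a) B s"
proof -
  interpret rkhs_space S k ev by standard (rule rkhs)
  from finite_segment_cover[OF bdd sb] obtain P and \<rho> :: "'a \<Rightarrow> real" and v h0 where
    P: "finite P" and h0: "h0 > 0" and cover: "closure S \<subseteq> (\<Union>p\<in>P. ball p (\<rho> p))"
    and seg: "\<forall>p\<in>P. \<forall>h z x. 0 < h \<longrightarrow> h \<le> h0 \<longrightarrow> z \<in> ball p (\<rho> p) \<longrightarrow> x \<in> ball p (\<rho> p) \<longrightarrow>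
      x \<in> interior S \<longrightarrow> norm (x - z) \<le> h \<longrightarrow> closed_segment x (z + h *\<^sub>R v p) \<subseteq> interior S"
    by (elim exE conjE) (rule that)
  obtain C M where C: "C > 0" and M: "M \<ge> 1" and "\<forall>y\<in>interior S. \<exists>F. finite F \<and> card F \<le> M \<and>
     (\<forall>x. closed_segment y x \<subseteq> interior S \<longrightarrow> (\<exists>z\<in>span F. norm (K x - z) \<le> C * norm (x - y) powr s))"
    using local_width[OF rkhs emb s] by blast
  then obtain Fl where Fl: "\<And>y. y \<in> interior S \<Longrightarrow> finite (Fl y)" "\<And>y. y \<in> interior S \<Longrightarrow> card (Fl y) \<le> M"
    "\<And>y x. y \<in> interior S \<Longrightarrow> closed_segment y x \<subseteq> interior S \<Longrightarrow> \<exists>z\<in>span (Fl y). norm (K x - z) \<le> C * norm (x - y) powr s"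
    by metis
  obtain R where R: "R > 0" "\<And>x. x \<in> S \<Longrightarrow> norm x \<le> R" using bdd bounded_pos by metis
  define T where "T = interior S"
  have TS: "T \<subseteq> S" unfolding T_def by (rule interior_subset)
  \<comment> \<open>The norm is at most the sum of the coordinates, so cubes of side
    \<open>\<delta> / 2 ^ j\<close> have diameter at most \<open>h0 / 2 ^ j\<close>.\<close>
  define \<delta> where "\<delta> = h0 / DIM('a)"
  have \<delta>: "\<delta> > 0" using h0 by (simp add: \<delta>_def)
  define piece where "piece x = (SOME p. p \<in> P \<and> x \<in> ball p (\<rho> p))" for x
  have piece: "piece x \<in> P" "x \<in> ball (piece x) (\<rho> (piece x))" if "x \<in> T" for x
  proof -
    have "\<exists>p. p \<in> P \<and> x \<in> ball p (\<rho> p)" using cover that TS closure_subset by blast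
    from someI_ex[OF this] show "piece x \<in> P" "x \<in> ball (piece x) (\<rho> (piece x))" by (auto simp: piece_def)
  qed
  \<comment> \<open>A cell is a dyadic cube cut by a piece of the cover, so that its points share a
    direction \<open>v\<close>. The piece does not depend on \<open>j\<close>, which keeps the cells
    nested.\<close>
  define c where "c j x = (piece x, \<lambda>b\<in>(Basis::'a set). \<lfloor>2 ^ j / \<delta> * (x \<bullet> b)\<rfloor>)" for j x
  have c_eq: "c j x = c j y \<longleftrightarrow> piece x = piece y \<and> (\<forall>b\<in>Basis. \<lfloor>2 ^ j / \<delta> * (x \<bullet> b)\<rfloor> = \<lfloor>2 ^ j / \<delta> * (y \<bullet> b)\<rfloor>)" for j x y
    unfolding c_def by (auto simp: restrict_def fun_eq_iff)
  have nested: "c j x = c j y" if "c (Suc j) x = c (Suc j) y" for j x y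
  proof -
    have "\<lfloor>2 ^ j / \<delta> * t\<rfloor> = \<lfloor>2 ^ Suc j / \<delta> * t\<rfloor> div 2" for t
      by (subst floor_mult_two_div) (simp add: mult_ac)
    then show ?thesis using that unfolding c_eq by metis
  qed
  have close: "norm (x - y) \<le> h0 / 2 ^ j" if "c j x = c j y" for j x y
  proof -
    have "\<bar>(x - y) \<bullet> b\<bar> \<le> \<delta> / 2 ^ j" if "b \<in> Basis" for b
      using abs_diff_le_of_floor_eq[of "2 ^ j / \<delta>" "x \<bullet> b" "y \<bullet> b"] \<open>c j x = c j y\<close> that \<delta>
      unfolding c_eq by (simp add: inner_diff_left)
    then have "(\<Sum>b\<in>Basis. \<bar>(x - y) \<bullet> b\<bar>) \<le> (\<Sum>b\<in>(Basis::'a set). \<delta> / 2 ^ j)" by (rule sum_mono)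
    also have "\<dots> = h0 / 2 ^ j" by (simp add: \<delta>_def)
    finally show ?thesis using norm_le_l1[of "x - y"] by linarith
  qed
  \<comment> \<open>A coordinate takes at most \<open>2 * q + 1\<close> integer values, where
    \<open>q\<close> is \<open>2 ^ j * R / \<delta>\<close> rounded up; rounding costs 2 and the
    value 0 counts once, hence the 3.\<close>
  define Q where "Q = nat \<lceil>2 * R / \<delta> + 3\<rceil>"
  \<comment> \<open>The summand 1 ensures \<open>A0 >= 1\<close> even for empty
    \<open>P\<close>.\<close>
  define A0 where "A0 = card P * Q ^ DIM('a) + 1"
  have cells: "finite (c j ` T)" "card (c j ` T) \<le> A0 * 2 ^ (j * DIM('a))" for j
  proof -
    define q where "q = \<lceil>2 ^ j * R / \<delta>\<rceil>"
    let ?X = "P \<times> (\<Pi>\<^sub>E b\<in>(Basis::'a set). {- q..q})"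
    have sub: "c j ` T \<subseteq> ?X"
    proof (rule image_subsetI)
      fix x assume x: "x \<in> T"
      have "\<lfloor>2 ^ j / \<delta> * (x \<bullet> b)\<rfloor> \<in> {- q..q}" if "b \<in> Basis" for b
      proof -
        have "\<bar>x \<bullet> b\<bar> \<le> R" using Basis_le_norm[OF that, of x] R(2)[of x] x TS by force
        then have "2 ^ j / \<delta> * \<bar>x \<bullet> b\<bar> \<le> 2 ^ j / \<delta> * R" using \<delta> by (intro mult_left_mono) auto
        then have "\<bar>2 ^ j / \<delta> * (x \<bullet> b)\<bar> \<le> of_int q" using \<delta> unfolding q_def by (simp add: abs_mult) linarith
        then have "- q \<le> \<lfloor>2 ^ j / \<delta> * (x \<bullet> b)\<rfloor>" "\<lfloor>2 ^ j / \<delta> * (x \<bullet> b)\<rfloor> \<le> q" by linarith+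
        then show ?thesis by simp
      qed
      then show "c j x \<in> ?X" using piece[OF x] by (auto simp: c_def)
    qed
    have finX: "finite ?X" using P by (intro finite_cartesian_product finite_PiE) auto
    then show "finite (c j ` T)" using sub finite_subset by blast
    have "card (c j ` T) \<le> card ?X" by (rule card_mono[OF finX sub])
    also have "\<dots> = card P * nat (2 * q + 1) ^ DIM('a)"
      by (simp add: card_cartesian_product card_PiE)
    also have "\<dots> \<le> card P * (Q * 2 ^ j) ^ DIM('a)"
    proof (intro mult_left_mono power_mono)
      have "real_of_int (2 * q + 1) \<le> 2 * (2 ^ j * R / \<delta>) + 3" unfolding q_def by linarith
      also have "\<dots> \<le> 2 * (2 ^ j * R / \<delta>) + 3 * 2 ^ j" by simp
      also have "\<dots> = (2 * R / \<delta> + 3) * 2 ^ j" by (simp add: algebra_simps)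
      also have "\<dots> \<le> real Q * 2 ^ j" unfolding Q_def by (intro mult_right_mono real_nat_ceiling_ge) auto
      also have "\<dots> = real_of_int (int (Q * 2 ^ j))" by simp
      finally have "2 * q + 1 \<le> int (Q * 2 ^ j)" by (simp only: of_int_le_iff)
      then show "nat (2 * q + 1) \<le> Q * 2 ^ j" by linarith
    qed auto
    also have "\<dots> = card P * Q ^ DIM('a) * 2 ^ (j * DIM('a))" by (simp add: power_mult_distrib power_mult)
    also have "\<dots> \<le> A0 * 2 ^ (j * DIM('a))" unfolding A0_def by (intro mult_right_mono) auto
    finally show "card (c j ` T) \<le> A0 * 2 ^ (j * DIM('a))" .
  qed
  define rep where "rep j \<gamma> = (SOME z. z \<in> T \<and> c j z = \<gamma>)" for j \<gamma>
  have rep: "rep j (c j x) \<in> T" "c j (rep j (c j x)) = c j x" if "x \<in> T" for j x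
    using someI[of "\<lambda>z. z \<in> T \<and> c j z = c j x" x] that by (auto simp: rep_def)
  \<comment> \<open>A representative of the cell, moved along the direction of its piece. It depends
    on the cell alone, so \<open>Fl\<close> at this point serves every \<open>x\<close> in the
    cell.\<close>
  define y where "y j \<gamma> = rep j \<gamma> + (h0 / 2 ^ j) *\<^sub>R v (fst \<gamma>)" for j and \<gamma> :: "'a \<times> ('a \<Rightarrow> int)"
  have segxy: "closed_segment x (y j (c j x)) \<subseteq> interior S" if x: "x \<in> T" for x j
  proof -
    have "piece (rep j (c j x)) = piece x" using rep(2)[OF x, of j] unfolding c_eq by blast
    then have "rep j (c j x) \<in> ball (piece x) (\<rho> (piece x))" using piece(2)[OF rep(1)[OF x, of j]] by simp
    moreover have "h0 / 2 ^ j \<le> h0" using h0 by (simp add: divide_le_eq mult_le_cancel_left1)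
    moreover have "norm (x - rep j (c j x)) \<le> h0 / 2 ^ j" using close rep(2)[OF x] by simp
    ultimately have "closed_segment x (rep j (c j x) + (h0 / 2 ^ j) *\<^sub>R v (piece x)) \<subseteq> interior S"
      using seg piece[OF x] h0 x by (simp add: T_def del: mem_ball)
    then show ?thesis by (simp add: y_def c_def)
  qed
  have y_in: "y j (c j x) \<in> interior S" if "x \<in> T" for x j
    using segxy[OF that] by (meson ends_in_segment(2) subsetD)
  \<comment> \<open>The summand 1 accounts for the distance from \<open>x\<close> to the
    representative, the sum for the shift by \<open>v\<close>, whichever piece is involved.\<close>
  define V where "V = 1 + (\<Sum>p\<in>P. norm (v p))"
  have V: "V > 0" unfolding V_def by (intro add_pos_nonneg sum_nonneg) auto
  have dist_y: "norm (x - y j (c j x)) \<le> h0 * V / 2 ^ j" if x: "x \<in> T" for x j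
  proof -
    have "norm (v (piece x)) \<le> (\<Sum>p\<in>P. norm (v p))" using P piece[OF x] by (intro member_le_sum) auto
    then have vb: "(h0 / 2 ^ j) * norm (v (piece x)) \<le> (h0 / 2 ^ j) * (\<Sum>p\<in>P. norm (v p))"
      using h0 by (intro mult_left_mono) auto
    have diff: "x - y j (c j x) = (x - rep j (c j x)) - (h0 / 2 ^ j) *\<^sub>R v (piece x)" by (simp add: y_def c_def)
    have "norm (x - y j (c j x)) \<le> norm (x - rep j (c j x)) + (h0 / 2 ^ j) * norm (v (piece x))"
      unfolding diff using norm_triangle_ineq4[of "x - rep j (c j x)" "(h0 / 2 ^ j) *\<^sub>R v (piece x)"] h0 by simp
    also have "\<dots> \<le> h0 / 2 ^ j + (h0 / 2 ^ j) * (\<Sum>p\<in>P. norm (v p))"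
      using close[of j x "rep j (c j x)"] rep(2)[OF x] vb by (intro add_mono) auto
    also have "\<dots> = h0 * V / 2 ^ j" by (simp add: V_def distrib_left add_divide_distrib)
    finally show ?thesis .
  qed
  define B0 where "B0 = C * (h0 * V) powr s"
  have B0: "B0 > 0" using C h0 V by (simp add: B0_def)
  have width: "\<exists>z\<in>span (Fl (y j (c j x))). norm (K x - z) \<le> B0 * 2 powr (- (real j * s))" if x: "x \<in> T" for x j
  proof -
    obtain z where z: "z \<in> span (Fl (y j (c j x)))" "norm (K x - z) \<le> C * norm (x - y j (c j x)) powr s"
      using Fl(3)[OF y_in[OF x]] segxy[OF x] by (metis closed_segment_commute)
    have "C * norm (x - y j (c j x)) powr s \<le> C * (h0 * V / 2 ^ j) powr s"
      using dist_y[OF x] C s by (intro mult_left_mono powr_mono2) auto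
    also have "h0 * V / 2 ^ j = (h0 * V) * 2 powr (- real j)"
      by (simp add: powr_minus powr_realpow divide_inverse)
    also have "((h0 * V) * 2 powr (- real j)) powr s = (h0 * V) powr s * 2 powr (- (real j * s))"
      using h0 V by (simp add: powr_mult powr_powr)
    finally have "norm (K x - z) \<le> B0 * 2 powr (- (real j * s))"
      using z(2) by (simp add: B0_def mult.assoc)
    then show ?thesis using z(1) by blast
  qed
  show ?thesis unfolding T_def[symmetric]
  proof (rule multilevel_of_cells[where c = c and F = "\<lambda>j \<gamma>. Fl (y j \<gamma>)" and M = M and ?A0.0 = A0 and ?B0.0 = B0])
    show "1 \<le> A0" by (simp add: A0_def)
    show "1 \<le> DIM('a)" by (simp add: Suc_le_eq)
    show "norm (K x) \<le> 1" if "x \<in> T" for x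
    proof -
      have "x \<in> S" using that TS by blast
      then show ?thesis using norm_kernel_at k1 by simp
    qed
    show "c j x = c j y" if "c (Suc j) x = c (Suc j) y" for j x y using that by (rule nested)
    show "finite (Fl (y j (c j x)))" if "x \<in> T" for j x by (rule Fl(1)[OF y_in[OF that]])
    show "card (Fl (y j (c j x))) \<le> M" if "x \<in> T" for j x by (rule Fl(2)[OF y_in[OF that]])
    show "\<exists>z\<in>span (Fl (y j (c j x))). norm (K x - z) \<le> B0 * 2 powr (- (real j * s))" if "x \<in> T" for j x
      using that by (rule width)
  qed (fact M s B0 cells)+
qed

text \<open>The multilevel expansion is available for kernel functions of interior points. The
  others are limits of these, since the domain lies in the closure of its interior and the kernel
  map is continuous.\<close>

lemma entropy_number_kernel_hull_le:
  fixes S :: "'a::euclidean_space set" and ev :: "'h::{real_inner,complete_space} \<Rightarrow> 'a \<Rightarrow> real"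
  assumes rkhs: "rkhs S k ev" and cont: "continuous_on (S \<times> S) (\<lambda>(x, y). k x y)"
    and k1: "\<And>x. x \<in> S \<Longrightarrow> k x x \<le> 1" and bdd: "bounded S" and sb: "smooth_boundary S"
    and s: "s > 0" and emb: "continuously_embedded_lip s S ev"
  shows "\<exists>C>0. \<forall>n\<ge>1. entropy_number n (closed_abs_hull (kernel_at S k ev ` S))
           \<le> ennreal (C * real n powr (- (s / DIM('a)) - 1 / 2))"
proof -
  let ?K = "kernel_at S k ev"
  have "?K ` S \<subseteq> closure (?K ` interior S)"
  proof safe
    fix x assume x: "x \<in> S"
    then have "x \<in> closure (interior S)" using subset_closure_interior[OF sb] by blast
    then obtain f where f: "\<And>n. f n \<in> interior S" "f \<longlonglongrightarrow> x" unfolding closure_sequential by blast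
    then have "(\<lambda>n. ?K (f n)) \<longlonglongrightarrow> ?K x"
      using interior_subset x by (intro kernel_at_tendsto[OF rkhs cont]) auto
    then show "?K x \<in> closure (?K ` interior S)"
      unfolding closure_sequential using f(1) by (intro exI[of _ "\<lambda>n. ?K (f n)"]) auto
  qed
  then have sub: "closed_abs_hull (?K ` S) \<subseteq> closed_abs_hull (?K ` interior S)"
    by (rule closed_abs_hull_mono_closure)
  obtain e A B where "multilevel (?K ` interior S) e A DIM('a) B s"
    using kernel_multilevel[OF rkhs k1 bdd sb s emb] by blast
  then obtain C where "C > 0" "\<forall>n\<ge>1. entropy_number n (closed_abs_hull (?K ` interior S))
           \<le> ennreal (C * real n powr (- (s / DIM('a)) - 1 / 2))"
    using multilevel.entropy_number_hull_le by blast
  then show ?thesis using entropy_number_mono[OF sub] by (meson order_trans)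
qed

theorem corollary11:
  fixes \<Omega> :: "'a::euclidean_space set"
    and k :: "'a \<Rightarrow> 'a \<Rightarrow> real"
    and ev :: "'h::{real_inner,complete_space} \<Rightarrow> 'a \<Rightarrow> real"
    and ev_closure :: "'g::{real_inner,complete_space} \<Rightarrow> 'a \<Rightarrow> real"
    and E :: "'h \<Rightarrow> 'g"
    and s :: real
  assumes "bounded \<Omega>" and "smooth_boundary \<Omega>"
    and "strictly_pd_kernel \<Omega> k" and "continuous_on (\<Omega> \<times> \<Omega>) (\<lambda>(x, y). k x y)"
    and "\<forall>x\<in>\<Omega>. k x x \<le> 1"
    and "strictly_pd_kernel (closure \<Omega>) k"
    and "continuous_on (closure \<Omega> \<times> closure \<Omega>) (\<lambda>(x, y). k x y)"
    and "rkhs \<Omega> k ev" and "rkhs (closure \<Omega>) k ev_closure"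
    and "\<forall>f. (\<forall>x\<in>\<Omega>. ev_closure (E f) x = ev f x) \<and> norm (E f) = norm f"
    and "0 < s" and "continuously_embedded_lip s \<Omega> ev"
  shows "let d = real DIM('a);
      I = interpolant \<Omega> k ev;
      entropy_bound = (\<lambda>C. \<forall>n\<ge>1.
        entropy_number n (closed_abs_hull (kernel_at \<Omega> k ev ` \<Omega>))
          \<le> ennreal (C * real n powr (- (s / d) - 1 / 2)))
    in
      (\<exists>C>0. entropy_bound C) \<and>
      (\<forall>C \<beta> \<gamma> f x.
         0 < C \<and> entropy_bound C \<and> admissible_weakness \<Omega> \<gamma> \<and> weak_greedy \<Omega> k ev \<beta> \<gamma> f x \<longrightarrow>
         (\<forall>n\<ge>1.
           (MIN i\<in>{n + 1..2 * n}. sup_norm \<Omega> (ev (f - I (x ` {1..i}) f)))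
             \<le> ennreal
                 ((if \<beta> = \<infinity> then 1 else (C * sqrt 5) powr (1 / max 1 (enn2real \<beta>))) *
                  inverse \<gamma> *
                  (if \<beta> = \<infinity> then real n powr (- 1 / 2)
                   else (real n powr (- (s / d) - enn2real \<beta> / 2)) powr (1 / max 1 (enn2real \<beta>))) *
                  norm (f - I (x ` {1..n + 1}) f))))"
proof -
  interpret rkhs_space \<Omega> k ev by standard (rule assms(8))
  have k1: "\<And>x. x \<in> \<Omega> \<Longrightarrow> k x x \<le> 1" using assms(5) by blast
  have "0 < \<gamma> \<and> \<gamma> \<le> 1" if "admissible_weakness \<Omega> \<gamma>" for \<gamma>
    using that by (auto simp: admissible_weakness_def)
  then show ?thesis
    unfolding Let_def
    using entropy_number_kernel_hull_le[OF assms(8,4) k1 assms(1,2,11,12)]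
    by (intro conjI allI impI weak_greedy_min_bound[OF assms(3) k1]) auto
qed

end
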